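(* Let $n\geq 2$ and $a>0$, and equip $\mathcal{O}_{\mathbb{CP}^{n-1}}(-n)$ with the Ricci-flat Calabi-Eguchi-Hanson metric with parameter $a$. The only non-constant closed geodesics in $\mathcal{O}_{\mathbb{CP}^{n-1}}(-n)$ are the (non-constant) geodesics of $(\mathbb{CP}^{n-1},g_{FS})$, where $\mathbb{CP}^{n-1}\subset\mathcal{O}_{\mathbb{CP}^{n-1}}(-n)$ is the zero section and $g_{FS}$ is the Fubini-Study metric. All of these geodesics are closed (when extended to all of $\mathbb{R}$), and they are not stable.
   Context: $\mu_n$ is the group of $n$-th roots of unity acting on $\mathbb{C}^n$ by scalar multiplication. The total space of $\mathcal{O}(-n)$ is $\mathcal{O}_{\mathbb{CP}^{n-1}}(-n)=\{(z,[\xi]) : z^i(\xi^j)^n=z^j(\xi^i)^n\ \forall i,j\}\subset\mathbb{C}^n\times\mathbb{CP}^{n-1}$, with zero section $\{(0,[\xi])\}\cong\mathbb{CP}^{n-1}$. The blow-down map $\pi:\mathcal{O}_{\mathbb{CP}^{n-1}}(-n)\to\mathbb{C}^n/\mu_n$ is given over $\{\xi^i\neq0\}$, with $\zeta^j=\xi^j/\xi^i$ and $t=z^i$ (so $z^j=(\zeta^j)^n t$), by $(z,[\xi])\mapsto[t^{1/n}(\zeta^1,\dots,\zeta^n)]$, where $\zeta^i=1$ and $t^{1/n}$ is any $n$-th root of $t$. It restricts to a biholomorphism $\mathcal{O}_{\mathbb{CP}^{n-1}}(-n)\setminus\mathbb{CP}^{n-1}\cong(\mathbb{C}^n\setminus\{0\})/\mu_n$.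 For a parameter $a>0$, the Calabi-Eguchi-Hanson metric is the Ricci-flat Kähler metric on $\mathcal{O}_{\mathbb{CP}^{n-1}}(-n)$ which, under this identification, is given on $(\mathbb{C}^n\setminus\{0\})/\mu_n$ in standard coordinates by $$g_{\mu\bar\nu}=\sqrt[n]{1+\frac{a^n}{u^n}}\left(\delta_{\mu\bar\nu}-\frac{a^n}{a^n+u^n}\frac{\bar z_\mu z_\nu}{u}\right),\qquad u=|z|^2_{\mathbb{C}^n},$$ where indices on $z$ are lowered with the Euclidean metric ($z_\nu=z^\nu$, $\bar z_\mu=\bar z^\mu$); it extends smoothly across the zero section and restricts there to $a\cdot g_{FS}$. In homogeneous coordinates $[z^1:\dots:z^n]$, $g_{FS}=\frac{|dz|^2}{|z|^2}-\frac{|\bar z\cdot dz|^2}{|z|^4}$. A closed geodesic is stable if the second variation of energy (equivalently length) is non-negative for all variations through closed curves. *)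

theory Defs
  imports "HOL-Analysis.Analysis"
begin

section \<open>Riemannian manifolds presented by an atlas\<close>

text \<open>
  Chart \<open>i\<close> maps \<open>cdom i\<close> into an affine subspace of the Euclidean space \<open>'e\<close> whose direction
  is the linear subspace \<open>tang i\<close>; the Riemannian metric is given in each chart by
  \<open>metr i x v w\<close>, for \<open>x\<close> in the image of the chart and \<open>v, w\<close> in \<open>tang i\<close>.
  The points of the manifold are the elements of the chart domains.
\<close>

record ('m, 'i, 'e) riem =
  cdom :: "'i \<Rightarrow> 'm set"
  chart :: "'i \<Rightarrow> 'm \<Rightarrow> 'e"
  tang :: "'i \<Rightarrow> 'e set"
  metr :: "'i \<Rightarrow> 'e \<Rightarrow> 'e \<Rightarrow> 'e \<Rightarrow> real"

fun Ck_on :: "nat \<Rightarrow> ('a::real_normed_vector \<Rightarrow> 'b::real_normed_vector) \<Rightarrow> 'a set \<Rightarrow> bool" where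
  "Ck_on 0 f S \<longleftrightarrow> continuous_on S f"
| "Ck_on (Suc k) f S \<longleftrightarrow>
     (\<forall>x\<in>S. f differentiable (at x)) \<and> (\<forall>v. Ck_on k (\<lambda>x. frechet_derivative f (at x) v) S)"

text \<open>Only meant for open \<open>S\<close>, as are the notions below that refer to an open domain \<open>D\<close> or \<open>I\<close>.\<close>

definition smooth_on :: "('a::real_normed_vector \<Rightarrow> 'b::real_normed_vector) \<Rightarrow> 'a set \<Rightarrow> bool" where
  "smooth_on f S \<longleftrightarrow> (\<forall>k. Ck_on k f S)"

definition smooth_map ::
  "('m, 'i, 'e::real_normed_vector, 'x) riem_scheme \<Rightarrow> 'd::real_normed_vector set \<Rightarrow> ('d \<Rightarrow> 'm) \<Rightarrow> bool" where
  "smooth_map X D f \<longleftrightarrow>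
     (\<forall>p\<in>D. (\<exists>i. f p \<in> cdom X i) \<and>
       (\<forall>i. f p \<in> cdom X i \<longrightarrow>
         (\<exists>W. open W \<and> p \<in> W \<and> W \<subseteq> D \<and> f ` W \<subseteq> cdom X i \<and> smooth_on (chart X i \<circ> f) W)))"

definition dir_deriv :: "('e::real_normed_vector \<Rightarrow> real) \<Rightarrow> 'e \<Rightarrow> 'e \<Rightarrow> real" where
  "dir_deriv f x v = deriv (\<lambda>s. f (x + s *\<^sub>R v)) 0"

text \<open>Christoffel symbols of the first kind, contracted with \<open>u, w\<close> (lower pair) and \<open>v\<close>.\<close>

definition christoffel :: "('e::real_normed_vector \<Rightarrow> 'e \<Rightarrow> 'e \<Rightarrow> real) \<Rightarrow> 'e \<Rightarrow> 'e \<Rightarrow> 'e \<Rightarrow> 'e \<Rightarrow> real" where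
  "christoffel g x u w v =
     (dir_deriv (\<lambda>y. g y w v) x u + dir_deriv (\<lambda>y. g y u v) x w - dir_deriv (\<lambda>y. g y u w) x v) / 2"

abbreviation vel :: "(real \<Rightarrow> 'e::real_normed_vector) \<Rightarrow> real \<Rightarrow> 'e" where
  "vel x t \<equiv> vector_derivative x (at t)"

text \<open>
  The geodesic equation is stated with its free index lowered by the metric, that is, as
  \<open>g(\<nabla>\<^bsub>x'\<^esub>x', v) = 0\<close> for all tangent vectors \<open>v\<close>.
\<close>

definition geodesic_on ::
  "('m, 'i, 'e::real_normed_vector, 'x) riem_scheme \<Rightarrow> real set \<Rightarrow> (real \<Rightarrow> 'm) \<Rightarrow> bool" where
  "geodesic_on X I \<gamma> \<longleftrightarrow> smooth_map X I \<gamma> \<and>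
     (\<forall>i. \<forall>t\<in>I. \<gamma> t \<in> cdom X i \<longrightarrow>
       (let x = chart X i \<circ> \<gamma> in
        \<forall>v\<in>tang X i. metr X i (x t) (vel (vel x) t) v
                        + christoffel (metr X i) (x t) (vel x t) (vel x t) v = 0))"

definition nonconstant_on :: "'a set \<Rightarrow> ('a \<Rightarrow> 'b) \<Rightarrow> bool" where
  "nonconstant_on I \<gamma> \<longleftrightarrow> (\<exists>s\<in>I. \<exists>t\<in>I. \<gamma> s \<noteq> \<gamma> t)"

definition closed_geodesic ::
  "('m, 'i, 'e::real_normed_vector, 'x) riem_scheme \<Rightarrow> real \<Rightarrow> (real \<Rightarrow> 'm) \<Rightarrow> bool" where
  "closed_geodesic X T \<gamma> \<longleftrightarrow> T > 0 \<and> geodesic_on X UNIV \<gamma> \<and> (\<forall>t. \<gamma> (t + T) = \<gamma> t)"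

text \<open>The choice of the chart is immaterial when the local metrics agree on overlaps.\<close>

definition speed_sq ::
  "('m, 'i, 'e::real_normed_vector, 'x) riem_scheme \<Rightarrow> (real \<Rightarrow> 'm) \<Rightarrow> real \<Rightarrow> real" where
  "speed_sq X \<gamma> t =
     (let i = (SOME i. \<gamma> t \<in> cdom X i); x = chart X i \<circ> \<gamma>
      in metr X i (x t) (vel x t) (vel x t))"

definition energy ::
  "('m, 'i, 'e::real_normed_vector, 'x) riem_scheme \<Rightarrow> real \<Rightarrow> (real \<Rightarrow> 'm) \<Rightarrow> real" where
  "energy X T \<gamma> = (1/2) * integral {0..T} (speed_sq X \<gamma>)"

definition closed_variation ::
  "('m, 'i, 'e::real_normed_vector, 'x) riem_scheme \<Rightarrow> real \<Rightarrow> (real \<Rightarrow> 'm) \<Rightarrow> real \<Rightarrow> (real \<Rightarrow> real \<Rightarrow> 'm) \<Rightarrow> bool" where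
  "closed_variation X T \<gamma> \<delta> \<Phi> \<longleftrightarrow>
     \<delta> > 0 \<and> smooth_map X ({-\<delta><..<\<delta>} \<times> UNIV) (\<lambda>(\<epsilon>, t). \<Phi> \<epsilon> t) \<and>
     (\<forall>t. \<Phi> 0 t = \<gamma> t) \<and> (\<forall>\<epsilon>\<in>{-\<delta><..<\<delta>}. \<forall>t. \<Phi> \<epsilon> (t + T) = \<Phi> \<epsilon> t)"

definition stable_geodesic ::
  "('m, 'i, 'e::real_normed_vector, 'x) riem_scheme \<Rightarrow> real \<Rightarrow> (real \<Rightarrow> 'm) \<Rightarrow> bool" where
  "stable_geodesic X T \<gamma> \<longleftrightarrow>
     (\<forall>\<delta> \<Phi>. closed_variation X T \<gamma> \<delta> \<Phi> \<longrightarrow> deriv (deriv (\<lambda>\<epsilon>. energy X T (\<Phi> \<epsilon>))) 0 \<ge> 0)"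


section \<open>Complex projective space with the Fubini--Study metric\<close>

definition cline :: "complex ^ 'n \<Rightarrow> (complex ^ 'n) set" where
  "cline \<xi> = range (\<lambda>c. c *s \<xi>)"

definition CP :: "(complex ^ 'n) set set" where
  "CP = {cline \<xi> | \<xi>. \<xi> \<noteq> 0}"

definition CP_dom :: "'n \<Rightarrow> (complex ^ 'n) set set" where
  "CP_dom i = {L \<in> CP. \<exists>\<xi>\<in>L. \<xi> $ i \<noteq> 0}"

text \<open>The vector \<open>\<zeta>\<close> with \<open>\<zeta>\<^sup>j = \<xi>\<^sup>j / \<xi>\<^sup>i\<close>, in particular \<open>\<zeta>\<^sup>i = 1\<close>.\<close>

definition affine_rep :: "'n \<Rightarrow> (complex ^ 'n) set \<Rightarrow> complex ^ 'n" where
  "affine_rep i L = (THE \<zeta>. \<zeta> \<in> L \<and> \<zeta> $ i = 1)"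

definition fubini_study :: "complex ^ 'n \<Rightarrow> complex ^ 'n \<Rightarrow> complex ^ 'n \<Rightarrow> real" where
  "fubini_study z v w =
     Re ((\<Sum>j\<in>UNIV. v $ j * cnj (w $ j)) / of_real ((norm z)\<^sup>2)
         - (\<Sum>j\<in>UNIV. cnj (z $ j) * v $ j) * cnj (\<Sum>j\<in>UNIV. cnj (z $ j) * w $ j) / of_real ((norm z) ^ 4))"

definition CP_FS :: "((complex ^ 'n) set, 'n, complex ^ 'n) riem" where
  "CP_FS = \<lparr>cdom = CP_dom, chart = affine_rep, tang = (\<lambda>i. {v. v $ i = 0}), metr = (\<lambda>i. fubini_study)\<rparr>"


section \<open>The total space of O(-n) with the Calabi--Eguchi--Hanson metric\<close>

definition O_tot :: "((complex ^ 'n) \<times> (complex ^ 'n) set) set" where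
  "O_tot = {(z, cline \<xi>) | z \<xi>. \<xi> \<noteq> 0 \<and>
     (\<forall>i j. z $ i * (\<xi> $ j) ^ CARD('n) = z $ j * (\<xi> $ i) ^ CARD('n))}"

definition zero_section :: "(complex ^ 'n) set \<Rightarrow> (complex ^ 'n) \<times> (complex ^ 'n) set" where
  "zero_section L = (0, L)"

definition O_dom :: "'n \<Rightarrow> ((complex ^ 'n) \<times> (complex ^ 'n) set) set" where
  "O_dom i = {p \<in> O_tot. snd p \<in> CP_dom i}"

text \<open>
  Over \<open>\<xi>\<^sup>i \<noteq> 0\<close> the coordinates are \<open>\<zeta>\<^sup>j\<close> (\<open>j \<noteq> i\<close>) and \<open>t = z\<^sup>i\<close>, the latter being put
  in the \<open>i\<close>-th slot; the chart is a bijection onto all of \<open>complex ^ 'n\<close>, with inverse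
  \<open>O_param i\<close>.
\<close>

definition O_chart :: "'n \<Rightarrow> (complex ^ 'n) \<times> (complex ^ 'n) set \<Rightarrow> complex ^ 'n" where
  "O_chart i p = (\<chi> j. if j = i then fst p $ i else affine_rep i (snd p) $ j)"

definition unit_at :: "'n \<Rightarrow> complex ^ 'n \<Rightarrow> complex ^ 'n" where
  "unit_at i x = (\<chi> j. if j = i then 1 else x $ j)"

definition O_param :: "'n::finite \<Rightarrow> complex ^ 'n \<Rightarrow> (complex ^ 'n) \<times> (complex ^ 'n) set" where
  "O_param i x = ((\<chi> j. (unit_at i x $ j) ^ CARD('n) * x $ i), cline (unit_at i x))"

text \<open>The blow-down map; a point of the quotient by the \<open>n\<close>-th roots of unity is an orbit.\<close>

definition blowdown :: "(complex ^ 'n) \<times> (complex ^ 'n) set \<Rightarrow> (complex ^ 'n) set" where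
  "blowdown p = {s *s affine_rep i (snd p) | i s. p \<in> O_dom i \<and> s ^ CARD('n) = fst p $ i}"

definition ceh_coeff :: "real \<Rightarrow> complex ^ 'n \<Rightarrow> 'n \<Rightarrow> 'n \<Rightarrow> complex" where
  "ceh_coeff a z \<mu> \<nu> =
     (let n = CARD('n); u = (norm z)\<^sup>2
      in of_real (root n (1 + a ^ n / u ^ n)) *
         ((if \<mu> = \<nu> then 1 else 0) - of_real (a ^ n / (a ^ n + u ^ n)) * (cnj (z $ \<mu>) * z $ \<nu> / of_real u)))"

text \<open>
  The real metric of the Hermitian form \<open>g\<^bsub>\<mu>\<nu>\<^esub>\<close> is normalised as its real part, so that the
  restriction to the zero section is \<open>a\<close> times the Fubini--Study metric above.
\<close>

definition ceh_flat :: "real \<Rightarrow> complex ^ 'n \<Rightarrow> complex ^ 'n \<Rightarrow> complex ^ 'n \<Rightarrow> real" where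
  "ceh_flat a z v w = Re (\<Sum>\<mu>\<in>UNIV. \<Sum>\<nu>\<in>UNIV. ceh_coeff a z \<mu> \<nu> * v $ \<mu> * cnj (w $ \<nu>))"

text \<open>
  A local lift, near the point with coordinates \<open>w\<close> in chart \<open>i\<close>, of the blow-down map to
  \<open>complex ^ 'n\<close>, i.e. the coordinate expression of the blow-down map in chart \<open>i\<close> and
  the standard coordinates of the quotient.
\<close>

definition local_lift :: "'n \<Rightarrow> complex ^ 'n \<Rightarrow> (complex ^ 'n \<Rightarrow> complex ^ 'n) \<Rightarrow> bool" where
  "local_lift i w F \<longleftrightarrow> (\<forall>x. F x \<in> blowdown (O_param i x)) \<and> F differentiable (at w)"

definition ceh_pullback :: "real \<Rightarrow> 'n \<Rightarrow> complex ^ 'n \<Rightarrow> complex ^ 'n \<Rightarrow> complex ^ 'n \<Rightarrow> real" where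
  "ceh_pullback a i x v w =
     (let F = (SOME F. local_lift i x F)
      in ceh_flat a (F x) (frechet_derivative F (at x) v) (frechet_derivative F (at x) w))"

text \<open>Off the zero section \<open>x $ i \<noteq> 0\<close> the metric is the pull-back; it is extended by continuity; see \<open>ceh_metric_explicit\<close> below.\<close>

definition ceh_metric :: "real \<Rightarrow> 'n \<Rightarrow> complex ^ 'n \<Rightarrow> complex ^ 'n \<Rightarrow> complex ^ 'n \<Rightarrow> real" where
  "ceh_metric a i x v w =
     (if x $ i \<noteq> 0 then ceh_pullback a i x v w
      else Lim (at x within {y. y $ i \<noteq> 0}) (\<lambda>y. ceh_pullback a i y v w))"

definition O_CEH :: "real \<Rightarrow> ((complex ^ 'n) \<times> (complex ^ 'n) set, 'n, complex ^ 'n) riem" where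
  "O_CEH a = \<lparr>cdom = O_dom, chart = O_chart, tang = (\<lambda>i. UNIV), metr = ceh_metric a\<rparr>"


section \<open>Well-posedness of the metric\<close>

text \<open>
  \<open>O_param\<close> inverts \<open>O_chart\<close>, and the limit in \<open>ceh_metric\<close> exists: writing \<open>\<zeta>\<close> for
  \<open>unit_at i x\<close>, the metric has an expression in the coordinates \<open>(t, \<zeta>\<^sup>j)\<close> that is smooth
  across \<open>t = 0\<close> and does not depend on the chosen lift (\<open>ceh_metric_explicit\<close>). On vectors
  tangent to the zero section it equals \<open>a\<close> times the Fubini--Study metric
  (\<open>ceh_metric_zero_section\<close>).
\<close>

lemma affine_rep_cline:
  assumes "\<xi> $ i \<noteq> 0"
  shows "affine_rep i (cline \<xi>) = (1 / \<xi> $ i) *s \<xi>"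
  unfolding affine_rep_def cline_def
proof (rule the_equality)
  show "(1 / \<xi> $ i) *s \<xi> \<in> range (\<lambda>c. c *s \<xi>) \<and> ((1 / \<xi> $ i) *s \<xi>) $ i = 1"
    using assms by auto
next
  fix \<zeta> assume "\<zeta> \<in> range (\<lambda>c. c *s \<xi>) \<and> \<zeta> $ i = 1"
  then obtain c where c: "\<zeta> = c *s \<xi>" and "\<zeta> $ i = 1" by blast
  then have "c * \<xi> $ i = 1" by simp
  then have "c = 1 / \<xi> $ i" using assms by (simp add: field_simps)
  with c show "\<zeta> = (1 / \<xi> $ i) *s \<xi>" by simp
qed

lemma unit_at_nth [simp]: "unit_at i x $ i = 1"
  by (simp add: unit_at_def)

lemma unit_at_nonzero: "unit_at i x \<noteq> 0"
  by (metis unit_at_nth zero_index zero_neq_one)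

lemma cline_in_CP_dom: "cline \<xi> \<in> CP_dom i \<longleftrightarrow> \<xi> $ i \<noteq> 0"
proof
  assume "cline \<xi> \<in> CP_dom i"
  then show "\<xi> $ i \<noteq> 0" by (auto simp: CP_dom_def cline_def)
next
  assume *: "\<xi> $ i \<noteq> 0"
  then have "\<xi> \<noteq> 0" by auto
  moreover have "\<xi> \<in> cline \<xi>" unfolding cline_def by (rule range_eqI[of _ _ 1]) simp
  ultimately show "cline \<xi> \<in> CP_dom i" using * by (auto simp: CP_dom_def CP_def)
qed

lemma O_param_in_O_dom: "O_param i x \<in> O_dom i"
proof -
  have "O_param i x \<in> O_tot"
    unfolding O_tot_def O_param_def
    by (rule CollectI, rule exI, rule exI[of _ "unit_at i x"]) (auto simp: unit_at_nonzero)
  then show ?thesis by (simp add: O_dom_def cline_in_CP_dom O_param_def)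
qed

lemma O_chart_O_param: "O_chart i (O_param i x) = x"
  by (simp add: O_chart_def O_param_def affine_rep_cline vec_eq_iff unit_at_def)

lemma O_param_O_chart:
  assumes "p \<in> O_dom i" shows "O_param i (O_chart i p) = p"
proof -
  from assms obtain z \<xi> where p: "p = (z, cline \<xi>)" and
    eq: "\<And>j k. z $ j * (\<xi> $ k) ^ CARD('a) = z $ k * (\<xi> $ j) ^ CARD('a)"
    by (auto simp: O_dom_def O_tot_def)
  have i: "\<xi> $ i \<noteq> 0" using assms by (simp add: O_dom_def p cline_in_CP_dom)
  have u: "unit_at i (O_chart i p) = (1 / \<xi> $ i) *s \<xi>"
    using i by (simp add: vec_eq_iff unit_at_def O_chart_def p affine_rep_cline)
  have "cline ((1 / \<xi> $ i) *s \<xi>) = cline \<xi>"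
    unfolding cline_def
  proof safe
    fix c
    show "c *s ((1 / \<xi> $ i) *s \<xi>) \<in> range (\<lambda>c. c *s \<xi>)"
      by (rule range_eqI[of _ _ "c / \<xi> $ i"]) (simp add: vec_eq_iff)
    show "c *s \<xi> \<in> range (\<lambda>c. c *s ((1 / \<xi> $ i) *s \<xi>))"
      by (rule range_eqI[of _ _ "c * \<xi> $ i"]) (simp add: vec_eq_iff i)
  qed
  moreover have "(\<xi> $ j / \<xi> $ i) ^ CARD('a) * z $ i = z $ j" for j
    using eq[of i j] i by (simp add: power_divide field_simps)
  ultimately show ?thesis
    unfolding O_param_def u by (simp add: p O_chart_def vec_eq_iff)
qed

lemma blowdown_O_param:
  fixes x :: "complex ^ 'n"
  shows "blowdown (O_param i x) = {s *s unit_at i x | s. s ^ CARD('n) = x $ i}" (is "?A = ?B")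
proof -
  have aff: "affine_rep i (snd (O_param i x)) = unit_at i x"
    by (simp add: O_param_def affine_rep_cline)
  have "\<exists>r. y = r *s unit_at i x \<and> r ^ CARD('n) = x $ i" if "y \<in> ?A" for y
  proof -
    from that obtain j s where y: "y = s *s affine_rep j (snd (O_param i x))"
      "O_param i x \<in> O_dom j" and s: "s ^ CARD('n) = fst (O_param i x) $ j"
      unfolding blowdown_def by blast
    let ?\<zeta> = "unit_at i x"
    have nz: "?\<zeta> $ j \<noteq> 0" using y(2) by (simp add: O_dom_def O_param_def cline_in_CP_dom)
    have "y = (s / ?\<zeta> $ j) *s ?\<zeta>"
      unfolding y(1) by (simp add: O_param_def affine_rep_cline[OF nz] vec_eq_iff)
    moreover have "(s / ?\<zeta> $ j) ^ CARD('n) = x $ i"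
      using s nz by (simp add: power_divide O_param_def)
    ultimately show ?thesis by blast
  qed
  then have "?A \<subseteq> ?B" by blast
  moreover have "?B \<subseteq> ?A"
  proof
    fix y assume "y \<in> ?B"
    then obtain s where s: "y = s *s unit_at i x" "s ^ CARD('n) = x $ i" by blast
    have "fst (O_param i x) $ i = x $ i" by (simp add: O_param_def)
    with s show "y \<in> ?A" unfolding blowdown_def using O_param_in_O_dom[of i x] aff by force
  qed
  ultimately show ?thesis by blast
qed

definition tang_at :: "'n \<Rightarrow> complex ^ 'n \<Rightarrow> complex ^ 'n" where
  "tang_at i v = (\<chi> j. if j = i then 0 else v $ j)"

lemma linear_tang_at: "linear (tang_at i)"
  by (auto simp: linear_iff tang_at_def vec_eq_iff)

lemma has_derivative_unit_at: "(unit_at i has_derivative tang_at i) (at x)"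
proof -
  have "unit_at i = (\<lambda>x. axis i 1 + tang_at i x)"
    by (auto simp: fun_eq_iff unit_at_def tang_at_def axis_def vec_eq_iff)
  moreover have "(tang_at i has_derivative tang_at i) (at x)"
    by (intro bounded_linear_imp_has_derivative linear_tang_at[unfolded linear_conv_bounded_linear])
  ultimately show ?thesis by (auto intro!: derivative_eq_intros)
qed

lemma bounded_bilinear_smult: "bounded_bilinear ((*s) :: complex \<Rightarrow> complex ^ 'n::finite \<Rightarrow> _)"
proof -
  have "bilinear ((*s) :: complex \<Rightarrow> complex ^ 'n \<Rightarrow> _)"
    by (auto simp: bilinear_def linear_iff vec_eq_iff algebra_simps)
  then show ?thesis using bilinear_conv_bounded_bilinear by blast
qed

lemma local_lift_exists:
  fixes x :: "complex ^ 'n"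
  assumes "x $ i \<noteq> 0"
  shows "\<exists>F. local_lift i x F"
proof -
  let ?n = "CARD('n)"
  have n0: "?n > 0" by simp
  have root_ex: "\<exists>s. s ^ ?n = c" for c :: complex
  proof (cases "c = 0")
    case False
    have "exp (Ln c / of_nat ?n) ^ ?n = c"
      using False n0 by (simp flip: exp_of_nat_mult)
    then show ?thesis by blast
  qed (use n0 in \<open>auto intro!: exI[of _ 0]\<close>)
  then obtain s0 where s0: "s0 ^ ?n = x $ i" by blast
  define s where "s y = (if y $ i = 0 then 0 else s0 * exp (Ln (y $ i / x $ i) / of_nat ?n))" for y :: "complex ^ 'n"
  have s: "s y ^ ?n = y $ i" for y
    using assms n0 s0 by (auto simp: s_def power_mult_distrib zero_power simp flip: exp_of_nat_mult)
  let ?t = "\<lambda>y::complex^'n. s0 * exp (Ln (y $ i / x $ i) / of_nat ?n)"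
  have ev: "eventually (\<lambda>y::complex^'n. y $ i \<noteq> 0) (nhds x)"
  proof -
    have "open {y :: complex ^ 'n. y $ i \<noteq> 0}" by (intro open_Collect_neq continuous_intros)
    then show ?thesis using assms unfolding eventually_nhds by blast
  qed
  have d1: "((\<lambda>z. s0 * exp (Ln (z / x $ i) / of_nat ?n)) has_field_derivative
     (s0 * (exp (Ln 1 / of_nat ?n) * (1 / x $ i / of_nat ?n)))) (at (x $ i))"
    using assms by (auto intro!: derivative_eq_intros)
  have d2: "((\<lambda>y::complex^'n. y $ i) has_derivative (\<lambda>v. v $ i)) (at x)"
    by (intro bounded_linear_imp_has_derivative bounded_linear_vec_nth)
  have "?t differentiable (at x)"
    using has_derivative_compose[OF d2, OF d1[unfolded has_field_derivative_def]]
    by (auto simp: differentiable_def)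
  then obtain t' where "(?t has_derivative t') (at x)" by (auto simp: differentiable_def)
  then have sd: "(s has_derivative t') (at x)"
  proof (rule has_derivative_transform_eventually)
    show "eventually (\<lambda>y. ?t y = s y) (at x)"
      using ev by (auto simp: s_def eventually_at_filter elim: eventually_mono)
  qed (use assms in \<open>auto simp: s_def\<close>)
  have "(\<lambda>y. s y *s unit_at i y) differentiable (at x)"
    using bounded_bilinear.FDERIV[OF bounded_bilinear_smult sd has_derivative_unit_at]
    by (auto simp: differentiable_def)
  moreover have "s y *s unit_at i y \<in> blowdown (O_param i y)" for y
    using s by (auto simp: blowdown_O_param)
  ultimately show ?thesis
    unfolding local_lift_def by (intro exI[of _ "\<lambda>y. s y *s unit_at i y"] conjI allI)
qed

lemma local_lift_deriv:
  fixes x :: "complex ^ 'n"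
  assumes "local_lift i x F" "x $ i \<noteq> 0"
  obtains s where "s ^ CARD('n) = x $ i" "F x = s *s unit_at i x"
    "\<And>v. frechet_derivative F (at x) v =
       s *s ((v $ i / (of_nat CARD('n) * x $ i)) *s unit_at i x + tang_at i v)"
proof -
  let ?n = "CARD('n)" and ?D = "frechet_derivative F (at x)"
  define s where "s y = F y $ i" for y
  have F': "F y = s y *s unit_at i y \<and> s y ^ ?n = y $ i" for y
  proof -
    from assms(1) have "F y \<in> {s *s unit_at i y | s. s ^ CARD('n) = y $ i}"
      unfolding local_lift_def blowdown_O_param by blast
    then obtain r where "F y = r *s unit_at i y" "r ^ CARD('n) = y $ i" by blast
    then show ?thesis by (simp add: s_def)
  qed
  have F: "F = (\<lambda>y. s y *s unit_at i y)" "s y ^ ?n = y $ i" for y using F' by (auto simp: fun_eq_iff)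
  have D: "(F has_derivative ?D) (at x)"
    using assms(1) by (simp add: local_lift_def frechet_derivative_works)
  have sd: "(s has_derivative (\<lambda>v. ?D v $ i)) (at x)"
    unfolding s_def by (rule bounded_linear.has_derivative[OF bounded_linear_vec_nth D])
  have "((\<lambda>y. s y ^ ?n) has_derivative (\<lambda>v. of_nat ?n * ?D v $ i * s x ^ (?n - 1))) (at x)"
    using has_derivative_power[OF sd, of ?n] by (simp only: mult_ac)
  moreover have "(\<lambda>y. s y ^ ?n) = (\<lambda>y. y $ i)" using F' by auto
  moreover have "((\<lambda>y::complex^'n. y $ i) has_derivative (\<lambda>v. v $ i)) (at x)"
    by (intro bounded_linear_imp_has_derivative bounded_linear_vec_nth)
  ultimately have "(\<lambda>v. of_nat ?n * ?D v $ i * s x ^ (?n - 1)) = (\<lambda>v. v $ i)"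
    by (metis has_derivative_unique)
  from fun_cong[OF this] have e: "of_nat ?n * ?D v $ i * s x ^ (?n - 1) = v $ i" for v .
  have di: "?D v $ i = s x * (v $ i / (of_nat ?n * x $ i))" for v
  proof -
    have "s x * v $ i = of_nat ?n * ?D v $ i * (s x * s x ^ (?n - 1))"
      using e[of v] by (simp add: mult_ac)
    also have "s x * s x ^ (?n - 1) = x $ i"
      using F(2)[of x] by (simp only: power_Suc[symmetric]) simp
    finally have "s x * v $ i = of_nat ?n * ?D v $ i * x $ i" .
    then show ?thesis using assms(2) by (simp add: nonzero_eq_divide_eq mult_ac)
  qed
  have "((\<lambda>y. s y *s unit_at i y) has_derivative (\<lambda>v. s x *s tang_at i v + ?D v $ i *s unit_at i x)) (at x)"
    by (rule bounded_bilinear.FDERIV[OF bounded_bilinear_smult sd has_derivative_unit_at])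
  then have "(F has_derivative (\<lambda>v. s x *s tang_at i v + ?D v $ i *s unit_at i x)) (at x)"
    unfolding F(1)[symmetric] .
  from fun_cong[OF has_derivative_unique[OF D this]]
  have "?D v = s x *s tang_at i v + ?D v $ i *s unit_at i x" for v .
  then have "?D v = s x *s tang_at i v + (s x * (v $ i / (of_nat ?n * x $ i))) *s unit_at i x" for v
    using di[of v] by metis
  moreover have "s x *s tang_at i v + (s x * (v $ i / (of_nat ?n * x $ i))) *s unit_at i x
      = s x *s ((v $ i / (of_nat ?n * x $ i)) *s unit_at i x + tang_at i v)" for v
    by (simp add: vec_eq_iff algebra_simps)
  ultimately have "?D v = s x *s ((v $ i / (of_nat ?n * x $ i)) *s unit_at i x + tang_at i v)" for v
    by (rule trans)
  then show ?thesis using that[of "s x"] F'[of x] by blast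
qed

lemma norm_sq_complex_vec:
  fixes z :: "complex ^ 'n"
  shows "complex_of_real ((norm z)\<^sup>2) = (\<Sum>j\<in>UNIV. z $ j * cnj (z $ j))"
  by (simp add: norm_vec_def L2_set_def sum_nonneg complex_norm_square del: of_real_power)

definition herm :: "complex ^ 'n \<Rightarrow> complex ^ 'n \<Rightarrow> complex" where
  "herm v w = (\<Sum>j\<in>UNIV. v $ j * cnj (w $ j))"

lemma herm_simps:
  "herm (u + v) w = herm u w + herm v w" "herm u (v + w) = herm u v + herm u w"
  "herm (c *s u) v = c * herm u v" "herm u (c *s v) = cnj c * herm u v"
  "cnj (herm u v) = herm v u" "herm z z = of_real ((norm z)\<^sup>2)"
  by (simp_all add: herm_def norm_sq_complex_vec sum.distrib algebra_simps sum_distrib_left del: of_real_power)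

lemma fubini_study_herm:
  "fubini_study z v w = Re (herm v w / of_real ((norm z)\<^sup>2) - herm v z * herm z w / of_real ((norm z) ^ 4))"
proof -
  have "(\<Sum>j\<in>UNIV. cnj (z $ j) * v $ j) = herm v z" for v by (simp add: herm_def mult.commute)
  then show ?thesis unfolding fubini_study_def using herm_simps(5)[of w z]
    by (simp add: herm_def[of v w])
qed

lemma ceh_flat_herm:
  fixes z :: "complex ^ 'n"
  shows "ceh_flat a z v w = root CARD('n) (1 + a ^ CARD('n) / ((norm z)\<^sup>2) ^ CARD('n)) *
    Re (herm v w - of_real (a ^ CARD('n) / (a ^ CARD('n) + ((norm z)\<^sup>2) ^ CARD('n)) / (norm z)\<^sup>2) * herm v z * herm z w)"
proof -
  define r where "r = root CARD('n) (1 + a ^ CARD('n) / ((norm z)\<^sup>2) ^ CARD('n))"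
  define c where "c = a ^ CARD('n) / (a ^ CARD('n) + ((norm z)\<^sup>2) ^ CARD('n))"
  have "ceh_coeff a z \<mu> \<nu> * v $ \<mu> * cnj (w $ \<nu>) = of_real r * ((if \<nu> = \<mu> then v $ \<mu> * cnj (w $ \<nu>) else 0)
     - of_real (c / (norm z)\<^sup>2) * ((v $ \<mu> * cnj (z $ \<mu>)) * (z $ \<nu> * cnj (w $ \<nu>))))" for \<mu> \<nu>
    unfolding ceh_coeff_def Let_def r_def[symmetric] c_def[symmetric]
    by (simp add: algebra_simps)
  then have "(\<Sum>\<mu>\<in>UNIV. \<Sum>\<nu>\<in>UNIV. ceh_coeff a z \<mu> \<nu> * v $ \<mu> * cnj (w $ \<nu>)) =
    of_real r * (herm v w - of_real (c / (norm z)\<^sup>2) * (herm v z * herm z w))"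
    by (simp only: sum_subtractf herm_def sum_product flip: sum_distrib_left) simp
  then show ?thesis unfolding ceh_flat_def r_def[symmetric] c_def[symmetric]
    by (simp add: mult.assoc Re_complex_of_real)
qed

definition ceh_explicit :: "real \<Rightarrow> 'n \<Rightarrow> complex ^ 'n \<Rightarrow> complex ^ 'n \<Rightarrow> complex ^ 'n \<Rightarrow> real" where
  "ceh_explicit a i x v w =
     (let n = CARD('n); \<zeta> = unit_at i x; N = (norm \<zeta>)\<^sup>2; t = x $ i;
          q = a ^ n + (norm t)\<^sup>2 * N ^ n;
          \<theta> = (\<lambda>v. v $ i / of_nat n + t * herm (tang_at i v) \<zeta> / of_real N)
      in root n q * (fubini_study \<zeta> (tang_at i v) (tang_at i w) + N ^ n / q * Re (\<theta> v * cnj (\<theta> w))))"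

lemma ceh_pullback_explicit:
  fixes x :: "complex ^ 'n"
  assumes a: "a > 0" and t: "x $ i \<noteq> 0"
  shows "ceh_pullback a i x v w = ceh_explicit a i x v w"
proof -
  let ?n = "CARD('n)"
  have "local_lift i x (SOME F. local_lift i x F)" by (rule someI_ex[OF local_lift_exists[OF t]])
  then obtain s where s: "s ^ ?n = x $ i" 
    and Fx: "(SOME F. local_lift i x F) x = s *s unit_at i x"
    and D: "\<And>v. frechet_derivative (SOME F. local_lift i x F) (at x) v =
       s *s ((v $ i / (of_nat ?n * x $ i)) *s unit_at i x + tang_at i v)"
    using local_lift_deriv[OF _ t] by blast
  define \<zeta> where "\<zeta> = unit_at i x"
  define N where "N = (norm \<zeta>)\<^sup>2"
  have N: "N > 0" by (simp add: N_def \<zeta>_def unit_at_nonzero)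
  define S where "S = (norm s)\<^sup>2"
  have "s \<noteq> 0" using s t by (metis zero_power zero_less_card_finite)
  then have S: "S > 0" by (simp add: S_def)
  have sc: "s * cnj s = of_real S" by (simp only: S_def complex_norm_square)
  have nz: "(norm (s *s \<zeta>))\<^sup>2 = S * N"
  proof -
    have "complex_of_real ((norm (s *s \<zeta>))\<^sup>2) = of_real (S * N)"
      unfolding herm_simps(6)[symmetric] herm_simps(3,4) 
      by (simp add: herm_simps(6) N_def flip: sc)
    then show ?thesis using of_real_eq_iff by blast
  qed
  have Sn: "S ^ ?n = (norm (x $ i))\<^sup>2"
    unfolding S_def s[symmetric] norm_power by (simp add: power_mult[symmetric] mult.commute)
  define q where "q = a ^ ?n + (norm (x $ i))\<^sup>2 * N ^ ?n"
  have qe: "a ^ ?n + (S * N) ^ ?n = q" by (simp add: q_def power_mult_distrib Sn)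
  have q: "q > 0" using a N S by (simp add: add_pos_pos flip: qe)
  have r: "root ?n (1 + a ^ ?n / (S * N) ^ ?n) * S = root ?n q / N"
  proof -
    have "1 + a ^ ?n / (S * N) ^ ?n = q / (S * N) ^ ?n"
      using N S unfolding qe[symmetric] by (simp add: field_simps)
    then have "root ?n (1 + a ^ ?n / (S * N) ^ ?n) = root ?n q / (S * N)"
      using N S by (simp add: real_root_divide real_root_power_cancel)
    then show ?thesis using N S by (simp add: field_simps)
  qed
  define l where "l v = v $ i / (of_nat ?n * x $ i)" for v :: "complex ^ 'n"
  define b where "b v = herm (tang_at i v) \<zeta>" for v
  define h where "h = herm (tang_at i v) (tang_at i w)"
  let ?X = "\<lambda>v. s *s (l v *s \<zeta> + tang_at i v)"
  have X1: "herm (?X v) (s *s \<zeta>) = of_real S * (l v * of_real N + b v)" for v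
    unfolding herm_simps(1-4) b_def[symmetric] herm_simps(6) N_def[symmetric]
    by (simp add: algebra_simps flip: sc)
  have X2: "herm (s *s \<zeta>) (?X v) = of_real S * cnj (l v * of_real N + b v)" for v
    using arg_cong[OF X1[of v], of cnj] by (simp add: herm_simps(5))
  have X3: "herm (?X v) (?X w) = of_real S * (l v * cnj (l w) * of_real N + l v * cnj (b w) + b v * cnj (l w) + h)"
    unfolding herm_simps(1-4) b_def herm_simps(5,6) N_def[symmetric] h_def
    by (simp add: algebra_simps flip: sc)
  define A where "A v = l v * of_real N + b v" for v
  have key: "herm (?X v) (?X w) - of_real (a ^ ?n / q / (S * N)) * herm (?X v) (s *s \<zeta>) * herm (s *s \<zeta>) (?X w)
     = of_real S * (h - b v * cnj (b w) / of_real N + of_real ((1 - a ^ ?n / q) / N) * (A v * cnj (A w)))"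
  proof -
    have "l v * cnj (l w) * of_real N + l v * cnj (b w) + b v * cnj (l w) + h
      = h - b v * cnj (b w) / of_real N + A v * cnj (A w) / of_real N"
      using N by (simp add: A_def field_simps)
    then have "herm (?X v) (?X w) = of_real S * (h - b v * cnj (b w) / of_real N + A v * cnj (A w) / of_real N)"
      using X3 by simp
    moreover have "of_real (a ^ ?n / q / (S * N)) * herm (?X v) (s *s \<zeta>) * herm (s *s \<zeta>) (?X w)
       = of_real S * (of_real (a ^ ?n / q / N) * (A v * cnj (A w)))"
      unfolding X1 X2 A_def[symmetric] using S by simp
    ultimately show ?thesis by (simp add: algebra_simps diff_divide_distrib)
  qed
  have one: "1 - a ^ ?n / q = (norm (x $ i))\<^sup>2 * N ^ ?n / q"
    using q by (simp add: q_def field_simps)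
  have th: "x $ i * A v = of_real N * (v $ i / of_nat ?n + x $ i * b v / of_real N)" for v
    using N t by (simp add: A_def l_def field_simps)
  define \<theta> where "\<theta> v = v $ i / of_nat ?n + x $ i * b v / of_real N" for v
  have "of_real ((norm (x $ i))\<^sup>2) * (A v * cnj (A w)) = (x $ i * A v) * cnj (x $ i * A w)"
    by (simp only: complex_norm_square complex_cnj_mult mult_ac)
  also have "\<dots> = of_real (N\<^sup>2) * (\<theta> v * cnj (\<theta> w))"
    unfolding th \<theta>_def[symmetric] by (simp add: power2_eq_square)
  finally have AA: "of_real ((norm (x $ i))\<^sup>2) * (A v * cnj (A w)) = of_real (N\<^sup>2) * (\<theta> v * cnj (\<theta> w))" .
  have key2: "of_real ((1 - a ^ ?n / q) / N) * (A v * cnj (A w)) = of_real N * (of_real (N ^ ?n / q) * (\<theta> v * cnj (\<theta> w)))"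
  proof -
    have "of_real ((1 - a ^ ?n / q) / N) * (A v * cnj (A w)) 
       = of_real (N ^ ?n / q / N) * (of_real ((norm (x $ i))\<^sup>2) * (A v * cnj (A w)))"
      unfolding one by simp
    also have "\<dots> = of_real N * (of_real (N ^ ?n / q) * (\<theta> v * cnj (\<theta> w)))"
      unfolding AA using N by (simp add: power2_eq_square)
    finally show ?thesis .
  qed
  have FS: "fubini_study \<zeta> (tang_at i v) (tang_at i w) = Re (h - b v * cnj (b w) / of_real N) / N"
  proof -
    have "(norm \<zeta>) ^ 4 = N * N" by (simp add: N_def power_add[symmetric])
    then have "fubini_study \<zeta> (tang_at i v) (tang_at i w) = Re ((h - b v * cnj (b w) / of_real N) / of_real N)"
      unfolding fubini_study_herm b_def herm_simps(5) h_def N_def[symmetric]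
      by (simp add: diff_divide_distrib)
    then show ?thesis by simp
  qed
  have "ceh_pullback a i x v w = ceh_flat a (s *s \<zeta>) (?X v) (?X w)"
    unfolding ceh_pullback_def Let_def Fx D \<zeta>_def l_def ..
  also have "\<dots> = (root ?n (1 + a ^ ?n / (S * N) ^ ?n) * S) *
      (Re (h - b v * cnj (b w) / of_real N) + N * (N ^ ?n / q * Re (\<theta> v * cnj (\<theta> w))))"
  proof -
    have *: "k * Re (of_real S * (P + of_real N * (of_real m * Q))) = (k * S) * (Re P + N * (m * Re Q))"
      for k m :: real and P Q :: complex
      by (simp add: Re_complex_of_real)
    show ?thesis unfolding ceh_flat_herm nz qe key key2 * ..
  qed
  also have "\<dots> = root ?n q * (fubini_study \<zeta> (tang_at i v) (tang_at i w) + N ^ ?n / q * Re (\<theta> v * cnj (\<theta> w)))"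
    unfolding r FS using N by (simp add: field_simps)
  also have "\<dots> = ceh_explicit a i x v w"
    unfolding ceh_explicit_def Let_def \<theta>_def b_def q_def N_def \<zeta>_def ..
  finally show ?thesis .
qed

lemma isCont_herm:
  fixes f g :: "'a::t2_space \<Rightarrow> complex ^ 'n"
  assumes "isCont f x" "isCont g x"
  shows "isCont (\<lambda>y. herm (f y) (g y)) x"
  unfolding herm_def using assms by (intro continuous_intros)

lemma isCont_ceh_explicit:
  fixes x :: "complex ^ 'n"
  assumes a: "a > 0"
  shows "isCont (\<lambda>y. ceh_explicit a i y v w) x"
proof -
  define N where "N y = (norm (unit_at i y))\<^sup>2" for y :: "complex ^ 'n"
  define q where "q y = a ^ CARD('n) + (norm (y $ i))\<^sup>2 * N y ^ CARD('n)" for y :: "complex ^ 'n"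
  define \<theta> where "\<theta> v y = v $ i / of_nat CARD('n) + y $ i * herm (tang_at i v) (unit_at i y) / of_real (N y)"
    for v y :: "complex ^ 'n"
  define FS where "FS y = fubini_study (unit_at i y) (tang_at i v) (tang_at i w)" for y :: "complex ^ 'n"
  have u: "isCont (unit_at i) x"
    using has_derivative_unit_at has_derivative_continuous by blast
  have n: "norm (unit_at i x) \<noteq> 0" by (simp add: unit_at_nonzero)
  have N: "isCont N x" unfolding N_def by (intro continuous_intros u)
  have N0: "complex_of_real (N x) \<noteq> 0" using n by (simp add: N_def)
  have "q x > 0" unfolding q_def using a by (intro add_pos_nonneg) (auto simp: N_def)
  then have q0: "q x \<noteq> 0" by simp
  have q: "isCont q x" unfolding q_def by (intro continuous_intros N)
  have \<theta>: "isCont (\<theta> v) x" for v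
    unfolding \<theta>_def by (intro continuous_intros isCont_herm N u N0)
  have FS: "isCont FS x"
  proof -
    have "isCont (\<lambda>y. Re (herm (tang_at i v) (tang_at i w) / of_real (N y) -
        herm (tang_at i v) (unit_at i y) * herm (unit_at i y) (tang_at i w) / of_real (N y * N y))) x"
      by (intro continuous_intros continuous_Re isCont_herm u N N0) (use N0 in auto)
    moreover have N4: "(norm z) ^ 4 = (norm z)\<^sup>2 * (norm z)\<^sup>2" for z :: "complex ^ 'n"
      by (simp add: power_add[symmetric])
    ultimately show ?thesis unfolding FS_def fubini_study_herm N4 N_def by (simp only:)
  qed
  have "isCont (\<lambda>y. root CARD('n) (q y) * (FS y + N y ^ CARD('n) / q y * Re (\<theta> v y * cnj (\<theta> w y)))) x"
    by (intro continuous_intros continuous_Re q N FS \<theta> q0)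
  then show ?thesis
    unfolding ceh_explicit_def Let_def q_def FS_def N_def \<theta>_def .
qed

lemma ceh_metric_explicit:
  fixes x :: "complex ^ 'n"
  assumes a: "a > 0"
  shows "ceh_metric a i x v w = ceh_explicit a i x v w"
proof (cases "x $ i = 0")
  case True
  let ?S = "{y :: complex ^ 'n. y $ i \<noteq> 0}"
  have "x islimpt ?S"
    unfolding islimpt_approachable
  proof safe
    fix e :: real assume "e > 0"
    let ?y = "x + axis i (of_real (e/2))"
    have "?y \<in> ?S" "?y \<noteq> x" using True \<open>e > 0\<close> by (auto simp: axis_def vec_eq_iff)
    moreover have "dist ?y x < e" using \<open>e > 0\<close> 
      by (simp add: dist_norm norm_vec_def L2_set_def axis_def if_distrib[of norm] if_distrib[of "\<lambda>x. x\<^sup>2"] norm_divide cong: if_cong)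
    ultimately show "\<exists>x'\<in>?S. x' \<noteq> x \<and> dist x' x < e" by blast
  qed
  then have nt: "at x within ?S \<noteq> bot" by (simp add: trivial_limit_within)
  have "((\<lambda>y. ceh_explicit a i y v w) \<longlongrightarrow> ceh_explicit a i x v w) (at x within ?S)"
    using isCont_ceh_explicit[OF a, of x i v w] unfolding isCont_def
    by (rule tendsto_within_subset) simp
  then have "((\<lambda>y. ceh_pullback a i y v w) \<longlongrightarrow> ceh_explicit a i x v w) (at x within ?S)"
    by (rule Lim_transform_eventually)
       (auto simp: eventually_at_filter ceh_pullback_explicit[OF a])
  then show ?thesis using True nt tendsto_Lim by (auto simp: ceh_metric_def)
qed (simp add: ceh_metric_def ceh_pullback_explicit[OF a])

lemma ceh_metric_zero_section:
  assumes "a > 0" "x $ i = 0" "v $ i = 0" "w $ i = 0"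
  shows "ceh_metric a i x v w = a * fubini_study (unit_at i x) v w"
proof -
  have "tang_at i v = v" "tang_at i w = w" using assms by (auto simp: tang_at_def vec_eq_iff)
  then show ?thesis
    using assms by (simp add: ceh_metric_explicit ceh_explicit_def Let_def real_root_power_cancel)
qed

end

theory Submission
  imports Defs
begin

text \<open>
  In an affine chart the Fubini--Study geodesic equation is \<open>\<zeta>'' = 2 \<phi> \<zeta>'\<close> with
  \<open>\<phi> = \<langle>\<zeta>', \<zeta>\<rangle> / |\<zeta>|\<^sup>2\<close>; rescaling \<open>\<zeta>\<close> by \<open>exp (- \<integral>\<phi>)\<close> linearises it to \<open>z'' = - l\<^sup>2 z\<close>. Hence
  the geodesics are the circles \<open>[cos (l t) p + sin (l t) / l w]\<close> with \<open>w\<close> orthogonal to \<open>p\<close>, which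
  are complete and of period \<open>\<pi> / l\<close>.

  On the total space let \<open>s = (a\<^sup>n + u\<^sup>n)\<^bsup>1/n\<^esup>\<close>. Off the zero section the metric is
  \<open>ds\<^sup>2 / (4 B) + B \<eta>\<^sup>2 + s g\<^bsub>FS\<^esub>\<close> with \<open>B = s - a\<^sup>n s\<^bsup>1-n\<^esup>\<close>, so along a geodesic
  \<open>s'' = 2 B' (s'\<^sup>2 / (4 B) + B \<eta>(\<gamma>')\<^sup>2) + 2 B g\<^bsub>FS\<^esub>(\<gamma>', \<gamma>') \<ge> 0\<close>. On a closed geodesic the convex
  periodic function \<open>s\<close> is constant, and \<open>s'' = 0\<close> forces either \<open>\<gamma>' = 0\<close> or \<open>B = 0\<close>, the zero
  section. The zero section is totally geodesic, since there the metric coefficients of its tangent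
  vectors have vanishing derivative in the fibre direction.

  A closed geodesic of the zero section is a great circle of a round projective line. Moving it to the
  parallel circle at angle \<open>2 \<epsilon>\<close> scales its energy by \<open>cos\<^sup>2 (2 \<epsilon>)\<close>, so it is unstable.
\<close>

section \<open>Calculus of iterated differentiability\<close>

text \<open>The geodesic equation comes with its index lowered. For the height argument it need only
  be paired with one vector, the fibre scaling field \<open>V = axis i (x $ i)\<close>, that is t
  d/dt. Up to the factor 2n this is the gradient of the height, so
  \<open>s' = 2 n g(\<gamma>', V)\<close>, and along a geodesic the derivative of
  \<open>g(\<gamma>', V)\<close> is half the derivative of the metric along the flow of
  \<open>V\<close>. This flow scales a single coordinate, so the sign of \<open>s''\<close> becomes
  a one-variable computation, valid on and off the zero section alike. On projective space,
  uniqueness rests on quantities that are constant along the explicit circles instead of a theory of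
  differential equations. Each time of a geodesic determines a whole model curve; the model is
  locally constant in that time, and connectedness of the interval does the gluing.\<close>

lemma Ck_on_cong:
  assumes "open S" "\<And>x. x \<in> S \<Longrightarrow> f x = g x"
  shows "Ck_on k f S \<longleftrightarrow> Ck_on k g S"
proof -
  have "Ck_on k g S" if "Ck_on k f S" "\<And>x. x \<in> S \<Longrightarrow> f x = g x" for f g
    using that
  proof (induction k arbitrary: f g)
    case 0
    then show ?case by (simp cong: continuous_on_cong)
  next
    case (Suc k)
    have D: "(g has_derivative frechet_derivative f (at x)) (at x)" if "x \<in> S" for x
      using Suc.prems that assms(1)
      by (intro has_derivative_transform_within_open[of f _ x UNIV S g])
         (auto simp: frechet_derivative_works)
    have "Ck_on k (\<lambda>x. frechet_derivative g (at x) v) S" for v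
      by (rule Suc.IH[of "\<lambda>x. frechet_derivative f (at x) v"])
         (use Suc.prems frechet_derivative_at[OF D] in auto)
    then show ?case using D by (auto simp: differentiable_def)
  qed
  from this[of f g] this[of g f] assms(2) show ?thesis by auto
qed

text \<open>Replaces the chosen \<open>frechet_derivative\<close> by an explicit formula
  \<open>f'\<close>, to which an induction hypothesis can then be applied.\<close>

lemma Ck_on_SucI:
  assumes "open S" "\<And>x. x \<in> S \<Longrightarrow> (f has_derivative f' x) (at x)" "\<And>v. Ck_on k (\<lambda>x. f' x v) S"
  shows "Ck_on (Suc k) f S"
proof -
  have "Ck_on k (\<lambda>x. frechet_derivative f (at x) v) S" for v
    using Ck_on_cong[OF assms(1), of "\<lambda>x. f' x v" "\<lambda>x. frechet_derivative f (at x) v"] assms(3)[of v]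
      frechet_derivative_at[OF assms(2)] by metis
  then show ?thesis using assms(2) by (auto simp: differentiable_def)
qed

lemma Ck_on_mono: "Ck_on (Suc k) f S \<Longrightarrow> Ck_on k f S"
proof (induction k arbitrary: f)
  case 0
  then show ?case
    by (auto intro!: differentiable_imp_continuous_on differentiable_at_imp_differentiable_on)
next
  case (Suc k)
  then show ?case by (metis Ck_on.simps(2))
qed

lemma Ck_on_subset: "Ck_on k f S \<Longrightarrow> T \<subseteq> S \<Longrightarrow> Ck_on k f T"
  by (induction k arbitrary: f) (auto intro: continuous_on_subset)

lemma Ck_on_const: "Ck_on k (\<lambda>x. c) S"
  by (induction k arbitrary: c) auto

lemma Ck_on_bounded_linear:
  assumes "open S" "bounded_linear L" "Ck_on k f S"
  shows "Ck_on k (\<lambda>x. L (f x)) S"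
  using assms(3)
proof (induction k arbitrary: f)
  case 0
  then show ?case by (simp add: assms(2) bounded_linear.continuous_on)
next
  case (Suc k)
  then show ?case
    by (intro Ck_on_SucI[where f' = "\<lambda>x v. L (frechet_derivative f (at x) v)"] assms(1)
         bounded_linear.has_derivative[OF assms(2)]) (auto simp: frechet_derivative_works)
qed

lemma Ck_on_linear: "open S \<Longrightarrow> bounded_linear L \<Longrightarrow> Ck_on k L S"
  by (cases k) (auto intro!: Ck_on_SucI[where f' = "\<lambda>_. L"] Ck_on_const
      bounded_linear_imp_has_derivative linear_continuous_on simp del: Ck_on.simps(2))

lemma Ck_on_add:
  assumes "open S" "Ck_on k f S" "Ck_on k g S"
  shows "Ck_on k (\<lambda>x. f x + g x) S"
  using assms(2,3)
proof (induction k arbitrary: f g)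
  case 0
  then show ?case by (simp add: continuous_on_add)
next
  case (Suc k)
  then show ?case
    by (intro Ck_on_SucI[where f' = "\<lambda>x v. frechet_derivative f (at x) v + frechet_derivative g (at x) v"]
          assms(1) has_derivative_add) (auto simp: frechet_derivative_works)
qed

lemma Ck_on_bilinear:
  assumes "open S" "bounded_bilinear B" "Ck_on k f S" "Ck_on k g S"
  shows "Ck_on k (\<lambda>x. B (f x) (g x)) S"
  using assms(3,4)
proof (induction k arbitrary: f g)
  case 0
  then show ?case by (simp add: bounded_bilinear.continuous_on[OF assms(2)])
next
  case (Suc k)
  have "Ck_on k (\<lambda>x. B (f x) (frechet_derivative g (at x) v) + B (frechet_derivative f (at x) v) (g x)) S" for v
    using Suc.prems Ck_on_mono[OF Suc.prems(1)] Ck_on_mono[OF Suc.prems(2)]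
    by (intro Ck_on_add Suc.IH assms(1)) auto
  then show ?case using Suc.prems
    by (intro Ck_on_SucI[OF assms(1), OF bounded_bilinear.FDERIV[OF assms(2), of f _ _ _ g]])
       (auto simp: frechet_derivative_works)
qed

text \<open>Each of the two functions is the derivative of the other up to sign, so the induction
  has to carry both.\<close>

lemma Ck_on_cos_sin:
  fixes f :: "'a::real_normed_vector \<Rightarrow> real"
  assumes "open S" "Ck_on k f S"
  shows "Ck_on k (\<lambda>x. cos (f x)) S \<and> Ck_on k (\<lambda>x. sin (f x)) S"
  using assms(2)
proof (induction k)
  case 0
  then show ?case by (simp add: continuous_on_cos continuous_on_sin)
next
  case (Suc k)
  have D: "x \<in> S \<Longrightarrow> (f has_derivative frechet_derivative f (at x)) (at x)" for x
    using Suc.prems by (auto simp: frechet_derivative_works)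
  have "Ck_on k (\<lambda>x. frechet_derivative f (at x) v) S" for v using Suc.prems by auto
  note * = Ck_on_bilinear[OF assms(1) bounded_bilinear_mult this] Ck_on_mono[OF Suc.prems] Suc.IH
  have 1: "Ck_on k (\<lambda>x. frechet_derivative f (at x) v * cos (f x)) S" for v
    by (intro * conjunct1[OF Suc.IH])
  have 2: "Ck_on k (\<lambda>x. - (frechet_derivative f (at x) v * sin (f x))) S" for v
    by (intro Ck_on_bounded_linear[OF assms(1), of uminus] * conjunct2[OF Suc.IH] bounded_linear_minus bounded_linear_ident)
  have "Ck_on (Suc k) (\<lambda>x. cos (f x)) S"
    by (rule Ck_on_SucI[OF assms(1) _ 2]) (use D in \<open>auto intro!: derivative_eq_intros\<close>)
  moreover have "Ck_on (Suc k) (\<lambda>x. sin (f x)) S"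
    by (rule Ck_on_SucI[OF assms(1) _ 1]) (use D in \<open>auto intro!: derivative_eq_intros\<close>)
  ultimately show ?case ..
qed

lemma Ck_on_inverse:
  fixes f :: "'a::real_normed_vector \<Rightarrow> 'b::real_normed_field"
  assumes "open S" "Ck_on k f S" "\<And>x. x \<in> S \<Longrightarrow> f x \<noteq> 0"
  shows "Ck_on k (\<lambda>x. inverse (f x)) S"
  using assms(2)
proof (induction k)
  case 0
  then show ?case using assms(3) by (simp add: continuous_on_inverse)
next
  case (Suc k)
  have D: "x \<in> S \<Longrightarrow> (f has_derivative frechet_derivative f (at x)) (at x)" for x
    using Suc.prems by (auto simp: frechet_derivative_works)
  have "Ck_on k (\<lambda>x. frechet_derivative f (at x) v) S" for v using Suc.prems by auto
  then have "Ck_on k (\<lambda>x. - (inverse (f x) * frechet_derivative f (at x) v * inverse (f x))) S" for v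
    using Suc.IH[OF Ck_on_mono[OF Suc.prems]]
    by (intro Ck_on_bounded_linear[OF assms(1), of uminus] Ck_on_bilinear[OF assms(1) bounded_bilinear_mult]
        bounded_linear_minus bounded_linear_ident)
  then show ?case
    by (rule Ck_on_SucI[OF assms(1), rotated]) (use D assms(3) in \<open>auto intro!: derivative_eq_intros\<close>)
qed

text \<open>Passes from iterated Frechet derivatives in direction 1 to iterated \<open>vel\<close>.
  Openness enters at second order, where the two first derivatives must agree on a whole
  neighbourhood.\<close>

lemma smooth_on_curveD:
  fixes x :: "real \<Rightarrow> 'a::real_normed_vector"
  assumes "smooth_on x W" "s \<in> W"
  shows "(x has_vector_derivative vel x s) (at s)"
    and "open W \<Longrightarrow> (vel x has_vector_derivative vel (vel x) s) (at s)"
proof -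
  have 2: "Ck_on 2 x W" using assms by (simp add: smooth_on_def)
  have d: "r \<in> W \<Longrightarrow> x differentiable (at r)" for r using 2 by (simp add: eval_nat_numeral)
  then show "(x has_vector_derivative vel x s) (at s)"
    using assms(2) vector_derivative_works by blast
  have e: "r \<in> W \<Longrightarrow> frechet_derivative x (at r) 1 = vel x r" for r
    using d[of r] frechet_derivative_eq_vector_derivative by fastforce
  have "(\<lambda>r. frechet_derivative x (at r) 1) differentiable (at s)"
    using 2 assms(2) by (simp add: eval_nat_numeral)
  moreover assume "open W"
  ultimately have "vel x differentiable (at s)"
    unfolding differentiable_def
    using e assms(2) by (blast intro: has_derivative_transform_within_open)
  then show "(vel x has_vector_derivative vel (vel x) s) (at s)"
    using vector_derivative_works by blast
qed

section \<open>The Fubini--Study metric\<close>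

lemma scaleR_smult: "r *\<^sub>R (v :: complex ^ 'n) = of_real r *s v"
  unfolding vec_eq_iff vector_scaleR_component by (simp add: scaleR_conv_of_real)

text \<open>Conjugate linearity in the second argument is still real linearity, so the product rules
  of real calculus apply.\<close>

lemma bounded_bilinear_herm: "bounded_bilinear (herm :: complex ^ 'n \<Rightarrow> complex ^ 'n \<Rightarrow> complex)"
proof -
  have "bilinear (herm :: complex ^ 'n \<Rightarrow> complex ^ 'n \<Rightarrow> complex)"
    by (auto simp: bilinear_def linear_iff scaleR_smult herm_simps scaleR_conv_of_real)
  then show ?thesis using bilinear_conv_bounded_bilinear by blast
qed

lemmas herm_zero [simp] = bounded_bilinear.zero_left[OF bounded_bilinear_herm] bounded_bilinear.zero_right[OF bounded_bilinear_herm]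
lemmas herm_diff = bounded_bilinear.diff_left[OF bounded_bilinear_herm] bounded_bilinear.diff_right[OF bounded_bilinear_herm]
lemmas herm_scaleR = bounded_bilinear.scaleR_left[OF bounded_bilinear_herm] bounded_bilinear.scaleR_right[OF bounded_bilinear_herm]

lemma norm_sq_herm: "(norm z)\<^sup>2 = Re (herm z z)"
  by (simp add: herm_simps(6))

lemma norm_smult_sq: "(norm (c *s (z :: complex ^ 'n)))\<^sup>2 = (cmod c)\<^sup>2 * (norm z)\<^sup>2"
proof -
  have "complex_of_real ((norm (c *s z))\<^sup>2) = of_real ((cmod c)\<^sup>2 * (norm z)\<^sup>2)"
    unfolding herm_simps(6)[symmetric] herm_simps(3,4) of_real_mult complex_norm_square by simp
  then show ?thesis using of_real_eq_iff by blast
qed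

lemma norm_smult: "norm (c *s (z :: complex ^ 'n)) = cmod c * norm z"
  using norm_smult_sq[of c z] by (metis power_mult_distrib power2_eq_iff_nonneg mult_nonneg_nonneg norm_ge_zero)

lemma fubini_study_eq:
  "fubini_study z v w = Re (herm v w) / (norm z)\<^sup>2 - Re (herm v z * herm z w) / ((norm z)\<^sup>2)\<^sup>2"
  unfolding fubini_study_herm by (simp flip: of_real_power power_mult)

lemma fubini_study_linear:
  "fubini_study z (v + v') w = fubini_study z v w + fubini_study z v' w"
  "fubini_study z v (w + w') = fubini_study z v w + fubini_study z v w'"
  "fubini_study z (v - v') w = fubini_study z v w - fubini_study z v' w"
  "fubini_study z (r *\<^sub>R v) w = r * fubini_study z v w"
  unfolding fubini_study_eq
  by (simp_all add: herm_simps(1,2) herm_diff herm_scaleR distrib_left distrib_right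
      left_diff_distrib right_diff_distrib add_divide_distrib diff_divide_distrib)

lemma fubini_study_sym: "fubini_study z v w = fubini_study z w v"
proof -
  have "herm w v = cnj (herm v w)" "herm w z * herm z v = cnj (herm v z * herm z w)"
    by (simp_all add: herm_simps(5))
  then show ?thesis unfolding fubini_study_eq by simp
qed

text \<open>Completing the square: what is measured is the part of \<open>w\<close> orthogonal to
  the complex line of \<open>z\<close>. Positivity, definiteness on a chart slice and projective
  invariance are all read off from this form.\<close>

lemma fubini_study_norm:
  assumes "z \<noteq> 0"
  shows "fubini_study z w w = (norm (w - (herm w z / of_real ((norm z)\<^sup>2)) *s z))\<^sup>2 / (norm z)\<^sup>2"
proof -
  define N where "N = (norm z)\<^sup>2"
  have N: "N > 0" "herm z z = of_real N" using assms by (auto simp: N_def herm_simps(6))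
  define b where "b = herm w z"
  have b': "herm z w = cnj b" by (simp add: b_def herm_simps(5))
  have "herm (w - (b / of_real N) *s z) (w - (b / of_real N) *s z) = herm w w - b * cnj b / of_real N"
    using N by (simp add: herm_diff herm_simps(3,4) b' flip: b_def)
  then have "(norm (w - (b / of_real N) *s z))\<^sup>2 = Re (herm w w) - Re (b * cnj b) / N"
    by (simp add: norm_sq_herm del: complex_mult_cnj)
  then show ?thesis
    unfolding fubini_study_eq b_def[symmetric] N_def[symmetric] b' using N
    by (simp add: diff_divide_distrib power2_eq_square)
qed

lemma fubini_study_nonneg: "fubini_study z w w \<ge> 0"
  by (cases "z = 0") (simp_all add: fubini_study_norm, simp add: fubini_study_eq)

text \<open>The kernel of the form is the complex line of \<open>z\<close>, which meets the slice
  \<open>w $ i = 0\<close> only in zero because \<open>z $ i\<close> does not vanish.\<close>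

lemma fubini_study_definite:
  assumes "z $ i \<noteq> 0" "w $ i = 0" "fubini_study z w w = 0"
  shows "w = 0"
proof -
  have z: "z \<noteq> 0" using assms(1) by auto
  define \<alpha> where "\<alpha> = herm w z / of_real ((norm z)\<^sup>2)"
  have "w = \<alpha> *s z" using assms(3) z by (simp add: fubini_study_norm \<alpha>_def)
  then show ?thesis using assms(1,2) by auto
qed

text \<open>A rescaled curve \<open>c *s z\<close> has velocity of the form
  \<open>c *s w + d *s z\<close>; the multiple of \<open>z\<close> is vertical and disappears in the
  orthogonal projection, and the factor \<open>cmod c\<close> cancels.\<close>

lemma fubini_study_projective:
  assumes "z \<noteq> 0" "c \<noteq> 0"
  shows "fubini_study (c *s z) (c *s w + d *s z) (c *s w + d *s z) = fubini_study z w w"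
proof -
  define N where "N = (norm z)\<^sup>2"
  have N: "N > 0" "herm z z = of_real N" using assms by (auto simp: N_def herm_simps(6))
  have cz: "c *s z \<noteq> 0" using assms by auto
  have e: "herm (c *s w + d *s z) (c *s z) / of_real ((norm (c *s z))\<^sup>2) = (herm w z / of_real N) + d / c"
  proof -
    have "complex_of_real ((norm (c *s z))\<^sup>2) = c * cnj c * of_real N"
      unfolding norm_smult_sq N_def of_real_mult complex_norm_square ..
    then show ?thesis using N assms by (simp add: herm_simps(1-4) field_simps del: complex_mult_cnj)
  qed
  have "c *s w + d *s z - ((herm w z / of_real N) + d / c) *s (c *s z) = c *s (w - (herm w z / of_real N) *s z)"
    using assms by (simp add: vec_eq_iff field_simps)
  then show ?thesis
    unfolding fubini_study_norm[OF cz] fubini_study_norm[OF assms(1)] e N_def[symmetric]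
    using assms(2) by (simp only: norm_smult_sq N_def) simp
qed

lemma has_vector_derivative_herm:
  assumes "(f has_vector_derivative f') (at t)" "(g has_vector_derivative g') (at t)"
  shows "((\<lambda>s. herm (f s) (g s)) has_vector_derivative herm (f t) g' + herm f' (g t)) (at t)"
  by (rule bounded_bilinear.has_vector_derivative[OF bounded_bilinear_herm assms])

lemma has_vector_derivative_smult:
  assumes "(f has_vector_derivative f') (at t)" "(g has_vector_derivative g') (at t)"
  shows "((\<lambda>s. f s *s (g s :: complex ^ 'n)) has_vector_derivative f t *s g' + f' *s g t) (at t)"
  by (rule bounded_bilinear.has_vector_derivative[OF bounded_bilinear_smult assms])

lemma has_real_derivative_norm_sq:
  fixes f :: "real \<Rightarrow> complex ^ 'n"
  assumes "(f has_vector_derivative f') (at t)"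
  shows "((\<lambda>s. (norm (f s))\<^sup>2) has_real_derivative 2 * Re (herm f' (f t))) (at t)"
proof -
  have "Re (herm (f t) f') = Re (herm f' (f t))" by (metis herm_simps(5) cnj.simps(1))
  then show ?thesis
    using has_field_derivative_Re[OF has_vector_derivative_herm[OF assms assms]]
    by (simp add: norm_sq_herm)
qed

lemma fubini_study_line_deriv:
  fixes z :: "complex ^ 'n"
  assumes "z \<noteq> 0"
  shows "((\<lambda>s. fubini_study (z + s *\<^sub>R u) v w) has_real_derivative
     (- 2 * Re (herm u z) * Re (herm v w) / ((norm z)\<^sup>2)\<^sup>2
      - Re (herm v u * herm z w + herm v z * herm u w) / ((norm z)\<^sup>2)\<^sup>2
      + 4 * Re (herm u z) * Re (herm v z * herm z w) / ((norm z)\<^sup>2)^3)) (at 0)"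
proof -
  define N where "N s = (norm (z + s *\<^sub>R u))\<^sup>2" for s :: real
  have l: "((\<lambda>s. z + s *\<^sub>R u) has_vector_derivative u) (at 0)"
    by (auto intro!: derivative_eq_intros)
  have N: "(N has_real_derivative 2 * Re (herm u z)) (at 0)"
    unfolding N_def using has_real_derivative_norm_sq[OF l] by simp
  have N0: "N 0 > 0" "N 0 = (norm z)\<^sup>2" using assms by (auto simp: N_def)
  define M where "M s = Re (herm v (z + s *\<^sub>R u) * herm (z + s *\<^sub>R u) w)" for s
  define M' where "M' = Re (herm v u * herm z w + herm v z * herm u w)"
  have "((\<lambda>s. herm v (z + s *\<^sub>R u) * herm (z + s *\<^sub>R u) w) has_vector_derivative
      herm v z * herm u w + herm v u * herm z w) (at 0)"
    by (rule has_vector_derivative_eq_rhs[OF has_vector_derivative_mult[OF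
        has_vector_derivative_herm[OF has_vector_derivative_const l] has_vector_derivative_herm[OF l has_vector_derivative_const]]]) simp
  from has_field_derivative_Re[OF this] have M: "(M has_real_derivative M') (at 0)"
    unfolding M_def M'_def by (simp only: add.commute)
  have "((\<lambda>s. Re (herm v w) / N s - M s / (N s)\<^sup>2) has_real_derivative
     (- Re (herm v w) * (2 * Re (herm u z)) / (N 0)\<^sup>2 - (M' * (N 0)\<^sup>2 - M 0 * (2 * N 0 * (2 * Re (herm u z)))) / ((N 0)\<^sup>2 * (N 0)\<^sup>2))) (at 0)"
    using N0(1) by (auto intro!: derivative_eq_intros N M simp: power2_eq_square)
  also have "(- Re (herm v w) * (2 * Re (herm u z)) / (N 0)\<^sup>2 - (M' * (N 0)\<^sup>2 - M 0 * (2 * N 0 * (2 * Re (herm u z)))) / ((N 0)\<^sup>2 * (N 0)\<^sup>2))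
    = - 2 * Re (herm u z) * Re (herm v w) / (N 0)\<^sup>2 - M' / (N 0)\<^sup>2 + 4 * Re (herm u z) * M 0 / (N 0) ^ 3"
  proof -
    have "- A * (2 * B) / K\<^sup>2 - (m' * K\<^sup>2 - m * (2 * K * (2 * B))) / (K\<^sup>2 * K\<^sup>2) = - 2 * B * A / K\<^sup>2 - m' / K\<^sup>2 + 4 * B * m / K ^ 3"
      if "K > 0" for A B K m m' :: real
      using that by (simp add: field_simps power2_eq_square power3_eq_cube)
    from this[OF N0(1)] show ?thesis .
  qed
  finally show ?thesis
    unfolding fubini_study_eq by (simp only: N_def M_def M'_def scaleR_zero_left add_0_right)
qed

text \<open>The lowered symbols are recognised as the metric paired with a vector, so the form,
  degenerate on the ambient space, is never inverted. As for every Kaehler metric, that vector is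
  complex quadratic in \<open>X\<close>.\<close>

lemma christoffel_fubini_study:
  fixes z :: "complex ^ 'n"
  assumes "z \<noteq> 0"
  shows "christoffel fubini_study z X X v = - 2 * fubini_study z ((herm X z / of_real ((norm z)\<^sup>2)) *s X) v"
proof -
  define N where "N = (norm z)\<^sup>2"
  have N: "N > 0" using assms by (simp add: N_def)
  define b c d where "b = herm X z" and "c = herm X v" and "d = herm z v"
  have h: "herm z X = cnj b" "herm v X = cnj c" "herm v z = cnj d" by (simp_all add: b_def c_def d_def herm_simps(5))
  define x where "x = Re (herm X X)"
  have xx: "herm X X = of_real x" by (simp add: x_def herm_simps(6))
  have "christoffel fubini_study z X X v =
     (2 * (- 2 * Re b * Re c / N\<^sup>2 - Re (of_real x * d + b * c) / N\<^sup>2 + 4 * Re b * Re (b * d) / N ^ 3)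
     - (- 2 * Re (cnj d) * x / N\<^sup>2 - Re (c * cnj b + b * cnj c) / N\<^sup>2
         + 4 * Re (cnj d) * Re (b * cnj b) / N ^ 3)) / 2"
    unfolding christoffel_def dir_deriv_def DERIV_imp_deriv[OF fubini_study_line_deriv[OF assms]] N_def[symmetric]
    by (simp only: xx Re_complex_of_real b_def[symmetric] c_def[symmetric] d_def[symmetric] h)
      (use N in \<open>simp add: field_simps\<close>)
  also have "\<dots> = - 2 * (Re (b / of_real N * c) / N - Re (b / of_real N * b * d) / N\<^sup>2)"
    using N by (simp add: Re_divide_of_real field_simps power2_eq_square power3_eq_cube)
  also have "\<dots> = - 2 * fubini_study z ((b / of_real N) *s X) v"
    unfolding fubini_study_eq herm_simps(3) c_def b_def d_def N_def ..
  finally show ?thesis unfolding b_def N_def .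
qed

section \<open>Horizontal lifts of geodesics of projective space\<close>

text \<open>The velocity \<open>w\<close> is horizontal at \<open>p\<close> when \<open>herm w p = 0\<close>; for \<open>w = 0\<close> the junk value
  \<open>sin 0 / 0 = 0\<close> makes the lift constant.\<close>

definition hor_lift :: "complex ^ 'n \<Rightarrow> complex ^ 'n \<Rightarrow> real \<Rightarrow> complex ^ 'n" where
  "hor_lift p w t = (let l = norm w / norm p in cos (l * t) *\<^sub>R p + (sin (l * t) / l) *\<^sub>R w)"

definition hor_vel :: "complex ^ 'n \<Rightarrow> complex ^ 'n \<Rightarrow> real \<Rightarrow> complex ^ 'n" where
  "hor_vel p w t = (let l = norm w / norm p in (- l * sin (l * t)) *\<^sub>R p + cos (l * t) *\<^sub>R w)"

lemma hor_lift_0 [simp]: "hor_lift p w 0 = p" and hor_vel_0 [simp]: "hor_vel p w 0 = w"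
  by (simp_all add: hor_lift_def hor_vel_def)

lemma hor_lift_deriv:
  assumes "p \<noteq> 0"
  shows "(hor_lift p w has_vector_derivative hor_vel p w t) (at t)"
    and "(hor_vel p w has_vector_derivative - ((norm w / norm p)\<^sup>2 *\<^sub>R hor_lift p w t)) (at t)"
proof -
  define l where "l = norm w / norm p"
  have w: "l = 0 \<Longrightarrow> w = 0" using assms by (simp add: l_def)
  show "(hor_lift p w has_vector_derivative hor_vel p w t) (at t)"
    unfolding hor_lift_def[abs_def] hor_vel_def Let_def l_def[symmetric]
    by (cases "l = 0") (auto intro!: derivative_eq_intros simp: w)
  show "(hor_vel p w has_vector_derivative - ((norm w / norm p)\<^sup>2 *\<^sub>R hor_lift p w t)) (at t)"
    unfolding hor_lift_def hor_vel_def[abs_def] Let_def l_def[symmetric]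
    by (cases "l = 0") (auto intro!: derivative_eq_intros simp: w power2_eq_square algebra_simps)
qed

lemma hor_lift_herm:
  fixes p :: "complex ^ 'n"
  assumes "p \<noteq> 0" "herm w p = 0"
  shows "norm (hor_lift p w t) = norm p" "norm (hor_vel p w t) = norm w"
    "herm (hor_vel p w t) (hor_lift p w t) = 0"
proof -
  define l where "l = norm w / norm p"
  define S C where "S = sin (l * t)" and "C = cos (l * t)"
  have SC: "S\<^sup>2 + C\<^sup>2 = 1" by (simp add: S_def C_def)
  have w: "l = 0 \<Longrightarrow> w = 0 \<and> S = 0 \<and> C = 1" using assms by (simp add: l_def S_def C_def)
  have lp: "l * norm p = norm w" using assms by (simp add: l_def)
  define P where "P = (norm p)\<^sup>2"
  have hp: "herm p p = of_real P" "herm p w = 0" "herm w w = of_real (l\<^sup>2 * P)" "herm w p = 0"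
    using assms(2) herm_simps(5)[of w p] unfolding herm_simps(6) lp[symmetric] P_def
    by (auto simp: power_mult_distrib)
  have L: "hor_lift p w t = C *\<^sub>R p + (S / l) *\<^sub>R w" and V: "hor_vel p w t = (- l * S) *\<^sub>R p + C *\<^sub>R w"
    by (simp_all add: hor_lift_def hor_vel_def Let_def S_def C_def l_def)
  have "Re (herm (hor_lift p w t) (hor_lift p w t)) = (S\<^sup>2 + C\<^sup>2) * P"
    unfolding L by (cases "l = 0") (auto simp: w herm_simps(1,2) herm_scaleR hp field_simps power2_eq_square)
  then have "(norm (hor_lift p w t))\<^sup>2 = (norm p)\<^sup>2" using SC by (simp add: norm_sq_herm P_def)
  then show "norm (hor_lift p w t) = norm p" by simp
  have "Re (herm (hor_vel p w t) (hor_vel p w t)) = (S\<^sup>2 + C\<^sup>2) * (l\<^sup>2 * P)"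
    by (simp add: V herm_simps(1,2) herm_diff herm_scaleR hp algebra_simps power2_eq_square)
  then have "(norm (hor_vel p w t))\<^sup>2 = (norm w)\<^sup>2"
    using SC by (simp add: norm_sq_herm P_def power_mult_distrib flip: lp)
  then show "norm (hor_vel p w t) = norm w" by simp
  show "herm (hor_vel p w t) (hor_lift p w t) = 0"
    unfolding L V by (cases "l = 0")
      (auto simp: w herm_simps(1,2) herm_diff herm_scaleR hp algebra_simps power2_eq_square scaleR_conv_of_real[where 'a = complex])
qed

text \<open>The rate \<open>norm w / norm p\<close> is conserved along the lift, so restarting at
  time \<open>s\<close> is just the addition theorem for sine and cosine.\<close>

lemma hor_lift_add:
  assumes "p \<noteq> 0" "herm w p = 0"
  shows "hor_lift (hor_lift p w s) (hor_vel p w s) t = hor_lift p w (s + t)"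
proof -
  define l where "l = norm w / norm p"
  have w: "l = 0 \<Longrightarrow> w = 0" using assms by (simp add: l_def)
  have "hor_lift (hor_lift p w s) (hor_vel p w s) t =
    cos (l * t) *\<^sub>R (cos (l * s) *\<^sub>R p + (sin (l * s) / l) *\<^sub>R w)
    + (sin (l * t) / l) *\<^sub>R ((- l * sin (l * s)) *\<^sub>R p + cos (l * s) *\<^sub>R w)"
    using hor_lift_herm[OF assms, of s] unfolding l_def
    by (simp add: hor_lift_def[of "hor_lift p w s"]) (simp add: hor_lift_def hor_vel_def)
  also have "\<dots> = (cos (l * t) * cos (l * s) - sin (l * t) * sin (l * s)) *\<^sub>R p
      + ((cos (l * t) * sin (l * s) + sin (l * t) * cos (l * s)) / l) *\<^sub>R w"
    by (cases "l = 0") (simp_all add: w algebra_simps add_divide_distrib)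
  also have "\<dots> = hor_lift p w (s + t)"
    by (simp add: hor_lift_def Let_def l_def[symmetric] distrib_left cos_add sin_add mult.commute add.commute)
  finally show ?thesis .
qed

lemma hor_lift_smult:
  assumes "c \<noteq> 0"
  shows "hor_lift (c *s p) (c *s w) t = c *s hor_lift p w t"
  using assms by (simp add: hor_lift_def Let_def norm_smult scaleR_smult vec_eq_iff algebra_simps)

text \<open>Horizontality makes the norms of \<open>z\<close> and \<open>z'\<close> constant, so the
  equation is linear with a constant rate \<open>l\<close>. Turning the pair \<open>(z, z')\<close>
  back by the angle \<open>l (s - t0)\<close> then gives constants \<open>P\<close> and
  \<open>R\<close>, and undoing the rotation recovers \<open>z s\<close>.\<close>

lemma hor_lift_unique:
  fixes z :: "real \<Rightarrow> complex ^ 'n"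
  assumes z: "\<And>s. s \<in> {a<..<b} \<Longrightarrow> (z has_vector_derivative z' s) (at s)"
    and z': "\<And>s. s \<in> {a<..<b} \<Longrightarrow> (z' has_vector_derivative - ((norm (z' s) / norm (z s))\<^sup>2 *\<^sub>R z s)) (at s)"
    and h: "\<And>s. s \<in> {a<..<b} \<Longrightarrow> herm (z' s) (z s) = 0"
    and nz: "\<And>s. s \<in> {a<..<b} \<Longrightarrow> z s \<noteq> 0"
    and t0: "t0 \<in> {a<..<b}" and s: "s \<in> {a<..<b}"
  shows "z s = hor_lift (z t0) (z' t0) (s - t0)"
proof -
  have const: "f s = f t0" if f: "\<And>s. s \<in> {a<..<b} \<Longrightarrow> (f has_vector_derivative 0) (at s)" and s: "s \<in> {a<..<b}"
    for f :: "real \<Rightarrow> 'b::real_normed_vector" and s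
  proof (rule has_derivative_zero_unique_connected[OF _ _ _ s t0, of f])
    show "(f has_derivative (\<lambda>x. 0)) (at x)" if "x \<in> {a<..<b}" for x
      using f[OF that] by (simp add: has_vector_derivative_def)
  qed auto
  define l where "l = norm (z' t0) / norm (z t0)"
  have "norm (z s) = norm (z t0)" if "s \<in> {a<..<b}" for s
  proof -
    have "((\<lambda>s. (norm (z s))\<^sup>2) has_vector_derivative 0) (at s)" if "s \<in> {a<..<b}" for s
      using has_real_derivative_norm_sq[OF z[OF that]] h[OF that]
      by (simp add: has_real_derivative_iff_has_vector_derivative)
    from const[OF this that] show ?thesis by simp
  qed
  moreover have "norm (z' s) = norm (z' t0)" if "s \<in> {a<..<b}" for s
  proof -
    have "((\<lambda>s. (norm (z' s))\<^sup>2) has_vector_derivative 0) (at s)" if "s \<in> {a<..<b}" for s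
    proof -
      have "herm (z s) (z' s) = 0" using h[OF that] herm_simps(5)[of "z' s" "z s"] by simp
      then show ?thesis
        using has_real_derivative_norm_sq[OF z'[OF that]]
        by (simp add: has_real_derivative_iff_has_vector_derivative bounded_bilinear.minus_left[OF bounded_bilinear_herm] herm_scaleR)
    qed
    from const[OF this that] show ?thesis by simp
  qed
  ultimately have l: "norm (z' s) / norm (z s) = l" if "s \<in> {a<..<b}" for s
    using that by (simp add: l_def)
  \<comment> \<open>For \<open>l = 0\<close> the quotient by \<open>l\<close> in \<open>P\<close>
    has its default value zero; this is harmless since it multiplies a vanishing velocity.\<close>
  have l0: "z' s = 0" if "l = 0" "s \<in> {a<..<b}" for s
    using l[OF that(2)] nz[OF that(2)] that(1) by simp
  define P where "P s = cos (l * (s - t0)) *\<^sub>R z s - (sin (l * (s - t0)) / l) *\<^sub>R z' s" for s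
  define R where "R s = (l * sin (l * (s - t0))) *\<^sub>R z s + cos (l * (s - t0)) *\<^sub>R z' s" for s
  have "(P has_vector_derivative 0) (at s)" if "s \<in> {a<..<b}" for s
    unfolding P_def using z[OF that] z'[OF that, unfolded l[OF that]] l0[OF _ that]
    by (cases "l = 0") (auto intro!: derivative_eq_intros simp: power2_eq_square)
  from const[OF this s] have P: "z t0 = cos (l * (s - t0)) *\<^sub>R z s - (sin (l * (s - t0)) / l) *\<^sub>R z' s"
    by (simp add: P_def)
  have "(R has_vector_derivative 0) (at s)" if "s \<in> {a<..<b}" for s
    unfolding R_def using z[OF that] z'[OF that, unfolded l[OF that]] l0[OF _ that]
    by (auto intro!: derivative_eq_intros simp: power2_eq_square mult_ac)
  from const[OF this s] have R: "z' t0 = (l * sin (l * (s - t0))) *\<^sub>R z s + cos (l * (s - t0)) *\<^sub>R z' s"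
    by (simp add: R_def)
  define S C where "S = sin (l * (s - t0))" and "C = cos (l * (s - t0))"
  have "hor_lift (z t0) (z' t0) (s - t0) = C *\<^sub>R z t0 + (S / l) *\<^sub>R z' t0"
    by (simp add: hor_lift_def Let_def l_def S_def C_def)
  also have "\<dots> = z s"
  proof (cases "l = 0")
    case True
    then show ?thesis using P R by (simp add: S_def C_def)
  next
    case False
    then have "C *\<^sub>R z t0 + (S / l) *\<^sub>R z' t0 = (S\<^sup>2 + C\<^sup>2) *\<^sub>R z s"
      unfolding P R S_def[symmetric] C_def[symmetric]
      by (simp add: algebra_simps power2_eq_square)
    then show ?thesis by (simp add: S_def C_def)
  qed
  finally show ?thesis ..
qed

text \<open>The integrating factor \<open>exp (- \<integral>\<phi>)\<close> turns the geodesic equation \<open>\<zeta>'' = 2 \<phi> \<zeta>'\<close> of the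
  affine chart into \<open>z'' = - K z\<close> with \<open>K\<close> the squared speed.\<close>

lemma geodesic_chart_lift:
  fixes \<zeta> :: "real \<Rightarrow> complex ^ 'n"
  defines "\<phi> \<equiv> \<lambda>s. herm (vel \<zeta> s) (\<zeta> s) / of_real ((norm (\<zeta> s))\<^sup>2)"
  assumes d1: "\<And>s. s \<in> {a..b} \<Longrightarrow> (\<zeta> has_vector_derivative vel \<zeta> s) (at s)"
    and d2: "\<And>s. s \<in> {a..b} \<Longrightarrow> (vel \<zeta> has_vector_derivative (2 * \<phi> s) *s vel \<zeta> s) (at s)"
    and nz: "\<And>s. s \<in> {a..b} \<Longrightarrow> \<zeta> s \<noteq> 0"
    and t0: "t0 \<in> {a<..<b}" and s: "s \<in> {a<..<b}"
  shows "\<exists>g. g \<noteq> 0 \<and> g *s \<zeta> s = hor_lift (\<zeta> t0) (vel \<zeta> t0 - \<phi> t0 *s \<zeta> t0) (s - t0)"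
proof -
  define N where "N s = (norm (\<zeta> s))\<^sup>2" for s
  have N: "s \<in> {a..b} \<Longrightarrow> N s > 0" for s using nz by (simp add: N_def)
  have N': "s \<in> {a..b} \<Longrightarrow> (N has_real_derivative 2 * Re (herm (vel \<zeta> s) (\<zeta> s))) (at s)" for s
    unfolding N_def by (rule has_real_derivative_norm_sq[OF d1])
  have \<phi>N: "s \<in> {a..b} \<Longrightarrow> herm (vel \<zeta> s) (\<zeta> s) = \<phi> s * of_real (N s)" for s
    using N[of s] by (simp add: \<phi>_def N_def)
  \<comment> \<open>A Riccati equation: \<open>\<phi>' = \<phi>\<^sup>2 + K\<close> with
    \<open>K\<close> the squared speed. Its quadratic term is what the integrating factor
    cancels.\<close>
  have \<phi>': "(\<phi> has_vector_derivative (\<phi> s)\<^sup>2 + of_real (fubini_study (\<zeta> s) (vel \<zeta> s) (vel \<zeta> s))) (at s)"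
    if s: "s \<in> {a..b}" for s
  proof -
    define V where "V = (norm (vel \<zeta> s))\<^sup>2"
    have "((\<lambda>s. 1 / N s) has_vector_derivative - (2 * Re (\<phi> s * of_real (N s))) / (N s)\<^sup>2) (at s)"
      unfolding has_real_derivative_iff_has_vector_derivative[symmetric] \<phi>N[OF s, symmetric]
      using N[OF s] by (auto intro!: derivative_eq_intros N'[OF s] simp: power2_eq_square)
    then have i: "((\<lambda>s. of_real (1 / N s)) has_vector_derivative complex_of_real (- (2 * Re (\<phi> s) / N s))) (at s)"
      using N[OF s] by (intro has_vector_derivative_of_real) (simp add: power2_eq_square has_real_derivative_iff_has_vector_derivative)
    have h: "((\<lambda>s. herm (vel \<zeta> s) (\<zeta> s)) has_vector_derivative of_real V + 2 * \<phi> s * (\<phi> s * of_real (N s))) (at s)"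
      using has_vector_derivative_herm[OF d2[OF s] d1[OF s]]
      unfolding herm_simps(3,6) \<phi>N[OF s] V_def .
    have e: "\<phi> = (\<lambda>s. of_real (1 / N s) * herm (vel \<zeta> s) (\<zeta> s))" by (simp add: \<phi>_def N_def fun_eq_iff)
    have "Re (\<phi> s * of_real (N s) * (cnj (\<phi> s) * of_real (N s))) = Re (\<phi> s * cnj (\<phi> s)) * (N s)\<^sup>2"
      by (simp add: power2_eq_square algebra_simps)
    then have "fubini_study (\<zeta> s) (vel \<zeta> s) (vel \<zeta> s) = V / N s - Re (\<phi> s * cnj (\<phi> s))"
      using N[OF s] unfolding fubini_study_eq N_def[symmetric] \<phi>N[OF s] herm_simps(5)[of "vel \<zeta> s" "\<zeta> s", symmetric]
      by (simp add: herm_simps(6) V_def del: complex_mult_cnj)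
    moreover have "complex_of_real (Re (\<phi> s * cnj (\<phi> s))) = \<phi> s * cnj (\<phi> s)"
      by (simp add: complex_eq_iff)
    ultimately have K: "of_real (fubini_study (\<zeta> s) (vel \<zeta> s) (vel \<zeta> s)) = of_real V / of_real (N s) - \<phi> s * cnj (\<phi> s)"
      by simp
    have "2 * complex_of_real (Re (\<phi> s)) = \<phi> s + cnj (\<phi> s)" by (simp add: complex_eq_iff)
    then have "of_real (1 / N s) * (of_real V + 2 * \<phi> s * (\<phi> s * of_real (N s)))
        + complex_of_real (- (2 * Re (\<phi> s) / N s)) * (\<phi> s * of_real (N s))
        = (\<phi> s)\<^sup>2 + of_real (fubini_study (\<zeta> s) (vel \<zeta> s) (vel \<zeta> s))"
      unfolding K using N[OF s] by (simp add: field_simps power2_eq_square)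
    then show ?thesis
      by (subst e) (use has_vector_derivative_mult[OF i h] in \<open>simp add: \<phi>N[OF s]\<close>)
  qed
  \<comment> \<open>The antiderivative is taken on the closed interval, where its derivative is
    one-sided at the ends; from here on only interior points are used.\<close>
  have "continuous_on {a..b} \<phi>"
    using \<phi>' by (meson continuous_at_imp_continuous_on has_vector_derivative_continuous)
  then obtain \<Phi> where \<Phi>: "\<And>x. x \<in> {a..b} \<Longrightarrow> (\<Phi> has_vector_derivative \<phi> x) (at x within {a..b})"
    using antiderivative_continuous by blast
  have \<Phi>': "(\<Phi> has_vector_derivative \<phi> x) (at x)" if "x \<in> {a<..<b}" for x
    using \<Phi>[of x] that by (metis at_within_Icc_at atLeastAtMost_iff greaterThanLessThan_iff less_eq_real_def)
  define E where "E s = exp (\<Phi> t0 - \<Phi> s)" for s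
  have E: "(E has_vector_derivative - \<phi> s * E s) (at s)" if "s \<in> {a<..<b}" for s
  proof -
    have "((\<lambda>s. \<Phi> t0 - \<Phi> s) has_vector_derivative - \<phi> s) (at s)"
      using \<Phi>'[OF that] by (auto intro!: derivative_eq_intros)
    from field_vector_diff_chain_at[OF this DERIV_exp] show ?thesis
      unfolding E_def o_def .
  qed
  \<comment> \<open>Differentiating \<open>E\<close> subtracts exactly the component of the velocity
    along \<open>\<zeta>\<close>, so the rescaled curve is automatically horizontal.\<close>
  define z z' where "z s = E s *s \<zeta> s" and "z' s = E s *s (vel \<zeta> s - \<phi> s *s \<zeta> s)" for s
  have h: "herm (z' s) (z s) = 0" if "s \<in> {a<..<b}" for s
  proof -
    have "herm (\<zeta> s) (\<zeta> s) = of_real (N s)" by (simp add: N_def herm_simps(6))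
    then show ?thesis
      using \<phi>N[of s] that by (simp add: z_def z'_def herm_simps(3,4) herm_diff)
  qed
  have z: "(z has_vector_derivative z' s) (at s)" if "s \<in> {a<..<b}" for s
    unfolding z_def
    by (rule has_vector_derivative_eq_rhs[OF has_vector_derivative_smult[OF E d1]])
      (use that in \<open>auto simp: z'_def vec_eq_iff algebra_simps\<close>)
  have z': "(z' has_vector_derivative - ((norm (z' s) / norm (z s))\<^sup>2 *\<^sub>R z s)) (at s)" if "s \<in> {a<..<b}" for s
  proof -
    define K where "K = fubini_study (\<zeta> s) (vel \<zeta> s) (vel \<zeta> s)"
    have s: "s \<in> {a..b}" using that by auto
    have "(norm (z' s) / norm (z s))\<^sup>2 = K"
      unfolding K_def fubini_study_norm[OF nz[OF s]] z_def z'_def norm_smult \<phi>_def E_def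
      by (simp add: power_divide)
    moreover have "(z' has_vector_derivative E s *s ((2 * \<phi> s) *s vel \<zeta> s - (\<phi> s *s vel \<zeta> s + ((\<phi> s)\<^sup>2 + of_real K) *s \<zeta> s))
       + (- \<phi> s * E s) *s (vel \<zeta> s - \<phi> s *s \<zeta> s)) (at s)"
      unfolding z'_def using \<phi>'[OF s]
      by (intro has_vector_derivative_smult has_vector_derivative_diff E d1 d2 s that) (simp add: K_def)
    moreover have "E s *s ((2 * \<phi> s) *s vel \<zeta> s - (\<phi> s *s vel \<zeta> s + ((\<phi> s)\<^sup>2 + of_real K) *s \<zeta> s))
       + (- \<phi> s * E s) *s (vel \<zeta> s - \<phi> s *s \<zeta> s) = - (K *\<^sub>R z s)"
      by (simp add: scaleR_smult z_def vec_eq_iff algebra_simps power2_eq_square)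
    ultimately show ?thesis by simp
  qed
  have "z s = hor_lift (z t0) (z' t0) (s - t0)"
    by (rule hor_lift_unique[OF z z' h _ t0 s]) (use nz in \<open>auto simp: z_def E_def vec_eq_iff\<close>)
  moreover have "z t0 = \<zeta> t0" "z' t0 = vel \<zeta> t0 - \<phi> t0 *s \<zeta> t0" by (simp_all add: z_def z'_def E_def)
  ultimately show ?thesis by (intro exI[of _ "E s"]) (simp add: z_def E_def)
qed

section \<open>Affine charts of projective space and gluing of local lifts\<close>

lemma CP_FS_simps [simp]:
  "cdom CP_FS = CP_dom" "chart CP_FS = affine_rep" "tang CP_FS i = {v. v $ i = 0}" "metr CP_FS i = fubini_study"
  by (simp_all add: CP_FS_def)

lemma smooth_mapE:
  assumes "smooth_map X D f" "p \<in> D" "f p \<in> cdom X i"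
  obtains W where "open W" "p \<in> W" "W \<subseteq> D" "f ` W \<subseteq> cdom X i" "smooth_on (chart X i \<circ> f) W"
  using assms unfolding smooth_map_def by blast

lemma smooth_map_chart_ex: "smooth_map X D f \<Longrightarrow> p \<in> D \<Longrightarrow> \<exists>i. f p \<in> cdom X i"
  unfolding smooth_map_def by blast

lemma cline_smult:
  assumes "c \<noteq> 0"
  shows "cline (c *s \<xi>) = cline \<xi>"
  unfolding cline_def
proof safe
  fix d
  show "d *s (c *s \<xi>) \<in> range (\<lambda>c. c *s \<xi>)" by (rule range_eqI[of _ _ "d * c"]) simp
  show "d *s \<xi> \<in> range (\<lambda>d. d *s (c *s \<xi>))" by (rule range_eqI[of _ _ "d / c"]) (simp add: assms)
qed

lemma cline_eqD:
  assumes "cline \<xi> = cline \<eta>"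
  obtains c where "\<xi> = c *s \<eta>"
proof -
  have "\<xi> \<in> cline \<xi>" unfolding cline_def by (rule range_eqI[of _ _ 1]) simp
  with assms that show ?thesis by (auto simp: cline_def)
qed

lemma CP_dom_affine_rep:
  assumes "L \<in> CP_dom i"
  shows "affine_rep i L $ i = 1" "cline (affine_rep i L) = L"
proof -
  obtain \<xi> where L: "L = cline \<xi>" using assms by (auto simp: CP_dom_def CP_def)
  then have "\<xi> $ i \<noteq> 0" using assms by (simp add: cline_in_CP_dom)
  then show "affine_rep i L $ i = 1" "cline (affine_rep i L) = L"
    by (simp_all add: L affine_rep_cline cline_smult)
qed

lemma has_vector_derivative_nth:
  fixes x :: "real \<Rightarrow> complex ^ 'n"
  assumes "(x has_vector_derivative x') (at t)"
  shows "((\<lambda>s. x s $ i) has_vector_derivative x' $ i) (at t)"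
  by (rule bounded_linear.has_vector_derivative[OF bounded_linear_vec_nth assms])

lemma vector_derivative_nth_const:
  fixes x :: "real \<Rightarrow> complex ^ 'n"
  assumes "(x has_vector_derivative x') (at t)" "open W" "t \<in> W" "\<And>s. s \<in> W \<Longrightarrow> x s $ i = k"
  shows "x' $ i = 0"
proof -
  have "((\<lambda>s. x s $ i) has_vector_derivative 0) (at t)"
    by (rule has_vector_derivative_transform_within_open[OF has_vector_derivative_const[of k] assms(2,3)])
      (simp add: assms(4))
  then show ?thesis using has_vector_derivative_nth[OF assms(1), of i] vector_derivative_unique_at by blast
qed

text \<open>Raises the free index: the left side is the metric against the fixed tangent vector
  \<open>B\<close>, and the test vector \<open>v = B\<close> together with definiteness on the slice
  gives \<open>B = 0\<close>.\<close>

lemma fubini_study_geodesic_iff: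
  fixes z :: "complex ^ 'n"
  assumes "z $ i \<noteq> 0" "X $ i = 0" "A $ i = 0"
  shows "(\<forall>v. v $ i = 0 \<longrightarrow> fubini_study z A v + christoffel fubini_study z X X v = 0) \<longleftrightarrow>
     A = (2 * (herm X z / of_real ((norm z)\<^sup>2))) *s X"
proof -
  define B where "B = A - (2 * (herm X z / of_real ((norm z)\<^sup>2))) *s X"
  have z: "z \<noteq> 0" using assms(1) by auto
  have eq: "fubini_study z A v + christoffel fubini_study z X X v = fubini_study z B v" for v
  proof -
    have "B = A - 2 *\<^sub>R ((herm X z / of_real ((norm z)\<^sup>2)) *s X)" by (simp add: B_def scaleR_smult mult.assoc)
    then show ?thesis unfolding christoffel_fubini_study[OF z]
      by (simp only: fubini_study_linear)
  qed
  have "B $ i = 0" using assms by (simp add: B_def)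
  then have "(\<forall>v. v $ i = 0 \<longrightarrow> fubini_study z B v = 0) \<longleftrightarrow> B = 0"
    using fubini_study_definite[OF assms(1)] by (auto simp: fubini_study_eq)
  then show ?thesis unfolding eq by (simp add: B_def)
qed

text \<open>The entire circle predicted by position and velocity at the single time
  \<open>t\<close>, the velocity being replaced by its horizontal part. It is a function of
  \<open>t\<close> so that gluing amounts to local constancy in \<open>t\<close>.\<close>

definition fs_model :: "'n \<Rightarrow> (real \<Rightarrow> (complex ^ 'n) set) \<Rightarrow> real \<Rightarrow> real \<Rightarrow> (complex ^ 'n) set" where
  "fs_model i c t =
     (let \<zeta> = affine_rep i \<circ> c;
          w = vel \<zeta> t - (herm (vel \<zeta> t) (\<zeta> t) / of_real ((norm (\<zeta> t))\<^sup>2)) *s \<zeta> t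
      in (\<lambda>s. cline (hor_lift (\<zeta> t) w (s - t))))"

lemma horizontal_part:
  assumes "z \<noteq> 0"
  shows "herm (X - (herm X z / of_real ((norm z)\<^sup>2)) *s z) z = 0"
  using assms by (simp add: herm_diff herm_simps(3,6))

lemma geodesic_eq_fs_model:
  fixes c :: "real \<Rightarrow> (complex ^ 'n) set"
  assumes c: "geodesic_on CP_FS I c" and t: "t \<in> I" "c t \<in> CP_dom i"
  obtains U where "open U" "t \<in> U" "U \<subseteq> I" "\<And>s. s \<in> U \<Longrightarrow> c s = fs_model i c t s"
proof -
  define \<zeta> where "\<zeta> = affine_rep i \<circ> c"
  have "smooth_map CP_FS I c" using c by (simp add: geodesic_on_def)
  then obtain W where W: "open W" "t \<in> W" "W \<subseteq> I" "c ` W \<subseteq> CP_dom i" "smooth_on \<zeta> W"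
    unfolding \<zeta>_def using t by (elim smooth_mapE) simp_all
  then obtain e where e: "e > 0" "cball t e \<subseteq> W" using open_contains_cball by blast
  define a b where "a = t - e" and "b = t + e"
  have ab: "{a..b} \<subseteq> W" "t \<in> {a<..<b}" using e by (auto simp: a_def b_def cball_eq_atLeastAtMost)
  have 1: "\<zeta> s $ i = 1" if "s \<in> W" for s
    using W(4) that CP_dom_affine_rep(1)[of "c s" i] by (auto simp: \<zeta>_def)
  then have nz: "\<zeta> s \<noteq> 0" if "s \<in> W" for s using that by force
  have d1: "(\<zeta> has_vector_derivative vel \<zeta> s) (at s)" if "s \<in> W" for s
    by (rule smooth_on_curveD(1)[OF W(5) that])
  have v0: "vel \<zeta> s $ i = 0" if "s \<in> W" for s
    by (rule vector_derivative_nth_const[OF d1[OF that] W(1) that 1])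
  have d2: "(vel \<zeta> has_vector_derivative vel (vel \<zeta>) s) (at s)" if "s \<in> W" for s
    by (rule smooth_on_curveD(2)[OF W(5) that W(1)])
  have a0: "vel (vel \<zeta>) s $ i = 0" if "s \<in> W" for s
    by (rule vector_derivative_nth_const[OF d2[OF that] W(1) that v0])
  have eq: "vel (vel \<zeta>) s = (2 * (herm (vel \<zeta> s) (\<zeta> s) / of_real ((norm (\<zeta> s))\<^sup>2))) *s vel \<zeta> s"
    if s: "s \<in> W" for s
  proof -
    have "s \<in> I" "c s \<in> CP_dom i" using s W by auto
    then have "\<forall>v. v $ i = 0 \<longrightarrow> fubini_study (\<zeta> s) (vel (vel \<zeta>) s) v + christoffel fubini_study (\<zeta> s) (vel \<zeta> s) (vel \<zeta> s) v = 0"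
      using c unfolding geodesic_on_def Let_def \<zeta>_def by simp
    then show ?thesis
      using fubini_study_geodesic_iff[of "\<zeta> s" i "vel \<zeta> s" "vel (vel \<zeta>) s"] 1[OF s] v0[OF s] a0[OF s] by simp
  qed
  have "c s = fs_model i c t s" if s: "s \<in> {a<..<b}" for s
  proof -
    have "\<exists>g. g \<noteq> 0 \<and> g *s \<zeta> s = hor_lift (\<zeta> t) (vel \<zeta> t - (herm (vel \<zeta> t) (\<zeta> t) / of_real ((norm (\<zeta> t))\<^sup>2)) *s \<zeta> t) (s - t)"
      using ab d1 d2 eq nz by (intro geodesic_chart_lift[of a b \<zeta> t s] s) auto
    then obtain g where g: "g \<noteq> 0" "cline (g *s \<zeta> s) = fs_model i c t s"
      unfolding fs_model_def Let_def \<zeta>_def[symmetric] by auto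
    moreover have "s \<in> W" using ab s by force
    then have "c s \<in> CP_dom i" using W(4) by blast
    then have "cline (\<zeta> s) = c s" by (simp add: \<zeta>_def CP_dom_affine_rep(2))
    ultimately show ?thesis by (simp add: cline_smult)
  qed
  then show ?thesis using that[of "{a<..<b}"] ab W(3) by force
qed

text \<open>The quotient rule for \<open>V\<close> divided by \<open>V $ i\<close>, kept in the form
  \<open>c *s V' + d *s V\<close> that \<open>fubini_study_projective\<close> accepts.\<close>

lemma affine_rep_cline_deriv:
  fixes V :: "real \<Rightarrow> complex ^ 'n"
  assumes V: "(V has_vector_derivative V') (at t)" and i: "V t $ i \<noteq> 0"
  shows "((\<lambda>s. affine_rep i (cline (V s))) has_vector_derivative
     (1 / V t $ i) *s V' + (- V' $ i / (V t $ i)\<^sup>2) *s V t) (at t)"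
proof -
  have "((\<lambda>s. 1 / V s $ i) has_vector_derivative - V' $ i / (V t $ i)\<^sup>2) (at t)"
    using i field_vector_diff_chain_at[OF has_vector_derivative_nth[OF V] DERIV_inverse, of i]
    by (simp add: o_def inverse_eq_divide power2_eq_square divide_simps)
  from has_vector_derivative_smult[OF this V]
  have d: "((\<lambda>s. (1 / V s $ i) *s V s) has_vector_derivative (1 / V t $ i) *s V' + (- V' $ i / (V t $ i)\<^sup>2) *s V t) (at t)" .
  have "continuous (at t) (\<lambda>s. V s $ i)"
    using has_vector_derivative_continuous[OF V] by (intro continuous_intros)
  then have "eventually (\<lambda>s. V s $ i \<noteq> 0) (at t)"
    using i by (auto simp: continuous_at intro: tendsto_imp_eventually_ne)
  then have "eventually (\<lambda>s. V s $ i \<noteq> 0) (nhds t)"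
    using i by (simp add: eventually_nhds_conv_at)
  then obtain W where "open W" "t \<in> W" "\<And>s. s \<in> W \<Longrightarrow> V s $ i \<noteq> 0"
    by (auto simp: eventually_nhds)
  then show ?thesis
    using has_vector_derivative_transform_within_open[OF d] by (simp add: affine_rep_cline)
qed

text \<open>Passing to a chart rescales the lift: this adds a vertical term to the velocity, removed
  by the horizontal projection, and a common factor \<open>1 / f\<close>, invisible to
  \<open>cline\<close>. Hence a circle is its own model, whatever the chart and the time.\<close>

lemma fs_model_eq:
  fixes p w :: "complex ^ 'n"
  assumes p: "p \<noteq> 0" "herm w p = 0"
    and c: "open U" "t \<in> U" "\<And>s. s \<in> U \<Longrightarrow> c s = cline (hor_lift p w (s - t0))" and i: "c t \<in> CP_dom i"
  shows "fs_model i c t = (\<lambda>s. cline (hor_lift p w (s - t0)))"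
proof -
  define V V' where "V s = hor_lift p w (s - t0)" and "V' s = hor_vel p w (s - t0)" for s
  have V: "(V has_vector_derivative V' s) (at s)" for s
  proof -
    have "((\<lambda>s. s - t0) has_vector_derivative 1) (at s)" by (auto intro!: derivative_eq_intros)
    from vector_diff_chain_at[OF this hor_lift_deriv(1)[OF p(1)]] show ?thesis
      by (simp add: o_def V_def[abs_def] V'_def)
  qed
  have h: "herm (V' s) (V s) = 0" for s unfolding V_def V'_def by (rule hor_lift_herm[OF p])
  define f f' where "f = V t $ i" and "f' = V' t $ i"
  have f: "f \<noteq> 0" using i c(2,3) by (simp add: f_def V_def cline_in_CP_dom)
  then have V0: "V t \<noteq> 0" by (auto simp: f_def)
  define \<zeta> where "\<zeta> = affine_rep i \<circ> c"
  have z: "\<zeta> t = (1 / f) *s V t"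
    using f c(2,3) by (simp add: \<zeta>_def f_def affine_rep_cline flip: V_def)
  have "((\<lambda>s. affine_rep i (cline (V s))) has_vector_derivative
     (1 / f) *s V' t + (- f' / f\<^sup>2) *s V t) (at t)"
    using affine_rep_cline_deriv[OF V] f unfolding f_def f'_def by blast
  then have "(\<zeta> has_vector_derivative (1 / f) *s V' t + (- f' / f\<^sup>2) *s V t) (at t)"
    by (rule has_vector_derivative_transform_within_open[OF _ c(1,2)]) (simp add: \<zeta>_def c(3) V_def)
  then have v: "vel \<zeta> t = (1 / f) *s V' t + (- f' / f\<^sup>2) *s V t"
    by (rule vector_derivative_at)
  \<comment> \<open>As \<open>V' t\<close> is horizontal, only the derivative of the chart factor
    contributes.\<close>
  have \<phi>: "herm (vel \<zeta> t) (\<zeta> t) / of_real ((norm (\<zeta> t))\<^sup>2) = - f' / f"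
  proof -
    define N where "N = (norm (V t))\<^sup>2"
    have N: "N > 0" "herm (V t) (V t) = of_real N" using V0 by (simp_all add: N_def herm_simps(6))
    have "herm (vel \<zeta> t) (\<zeta> t) = - f' / f\<^sup>2 * (cnj (1 / f) * of_real N)"
      unfolding v z by (simp only: herm_simps(1-4) h N) simp
    moreover have "complex_of_real ((norm (\<zeta> t))\<^sup>2) = 1 / f * cnj (1 / f) * of_real N"
      unfolding z norm_smult_sq of_real_mult complex_norm_square N_def ..
    ultimately show ?thesis
      using f N(1) by (simp only:) (simp add: divide_simps power2_eq_square del: complex_mult_cnj)
  qed
  have w: "vel \<zeta> t - (herm (vel \<zeta> t) (\<zeta> t) / of_real ((norm (\<zeta> t))\<^sup>2)) *s \<zeta> t = (1 / f) *s V' t"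
    unfolding \<phi> using f by (simp add: v z vec_eq_iff field_simps power2_eq_square)
  have "hor_lift (V t) (V' t) (s - t) = V s" for s
    unfolding V_def V'_def hor_lift_add[OF p] by simp
  then show ?thesis
    unfolding fs_model_def Let_def \<zeta>_def[symmetric] w unfolding z
    using f by (simp add: hor_lift_smult cline_smult V_def)
qed

theorem geodesic_CP_FS_hor_lift:
  fixes c :: "real \<Rightarrow> (complex ^ 'n) set"
  assumes c: "geodesic_on CP_FS I c" and I: "open I" "is_interval I" "I \<noteq> {}"
  obtains p w where "p \<noteq> 0" "herm w p = 0" "\<And>t. t \<in> I \<Longrightarrow> c t = cline (hor_lift p w t)"
proof -
  obtain t0 where t0: "t0 \<in> I" using I(3) by blast
  define M where "M t = fs_model (SOME i. c t \<in> CP_dom i) c t" for t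
  have i: "c t \<in> CP_dom (SOME i. c t \<in> CP_dom i)" if "t \<in> I" for t
    using smooth_map_chart_ex[of CP_FS I c t] c that
    by (intro someI_ex[of "\<lambda>i. c t \<in> CP_dom i"]) (simp add: geodesic_on_def)
  have lift: "\<exists>p w. p \<noteq> 0 \<and> herm w p = 0 \<and> M t = (\<lambda>s. cline (hor_lift p w (s - t)))" if "t \<in> I" for t
  proof -
    let ?i = "SOME i. c t \<in> CP_dom i"
    have "affine_rep ?i (c t) \<noteq> 0"
      using CP_dom_affine_rep(1)[OF i[OF that]] by force
    then show ?thesis unfolding M_def fs_model_def Let_def using horizontal_part by fastforce
  qed
  have near: "\<exists>U. open U \<and> t \<in> U \<and> U \<subseteq> I \<and> (\<forall>s\<in>U. c s = M t s)" if "t \<in> I" for t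
    using geodesic_eq_fs_model[OF c that i[OF that]] unfolding M_def by metis
  \<comment> \<open>Near \<open>t\<close> the geodesic is the circle \<open>M t\<close>, and
    recomputing the model from this circle at a nearby time returns the same circle.\<close>
  have "M t = M t0" if t: "t \<in> I" for t
  proof (rule connected_local_const[of I])
    show "connected I" using I(2) by (simp add: is_interval_connected_1)
    show "\<forall>t\<in>I. eventually (\<lambda>s. M t = M s) (at t within I)"
    proof
      fix t assume t: "t \<in> I"
      obtain U where U: "open U" "t \<in> U" "U \<subseteq> I" "\<And>s. s \<in> U \<Longrightarrow> c s = M t s" using near[OF t] by blast
      obtain p w where p: "p \<noteq> 0" "herm w p = 0" and M: "M t = (\<lambda>s. cline (hor_lift p w (s - t)))"
        using lift[OF t] by blast
      have "M t = M s" if "s \<in> U" for s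
        using fs_model_eq[OF p U(1) that, of c t] U(3,4) M i that unfolding M_def by (metis subsetD)
      then show "eventually (\<lambda>s. M t = M s) (at t within I)"
        using U(1,2) unfolding eventually_at_topological by blast
    qed
  qed (use t t0 in auto)
  then have cM: "c t = M t0 t" if "t \<in> I" for t using near[OF that] that by auto
  obtain p w where p: "p \<noteq> 0" "herm w p = 0" and M: "M t0 = (\<lambda>s. cline (hor_lift p w (s - t0)))"
    using lift[OF t0] by blast
  \<comment> \<open>Time 0 need not lie in \<open>I\<close>, so the base point of the circle is
    carried from \<open>t0\<close> to 0 by the flow property.\<close>
  have "hor_lift p w (- t0) \<noteq> 0" using hor_lift_herm(1)[OF p, of "- t0"] p(1) by auto
  moreover have "hor_lift (hor_lift p w (- t0)) (hor_vel p w (- t0)) t = hor_lift p w (t - t0)" for t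
    unfolding hor_lift_add[OF p] by simp
  ultimately show ?thesis
    using that[of "hor_lift p w (- t0)" "hor_vel p w (- t0)"] hor_lift_herm(3)[OF p] cM M by simp
qed

section \<open>The zero section\<close>

lemma O_CEH_simps [simp]:
  "cdom (O_CEH a) = O_dom" "chart (O_CEH a) = O_chart" "tang (O_CEH a) i = UNIV"
  by (simp_all add: O_CEH_def)

lemma metr_O_CEH [simp]: "a > 0 \<Longrightarrow> metr (O_CEH a) i = ceh_explicit a i"
  by (simp add: O_CEH_def fun_eq_iff ceh_metric_explicit)

lemma zero_section_in_O_dom [simp]: "zero_section L \<in> O_dom i \<longleftrightarrow> L \<in> CP_dom i"
  by (force simp: O_dom_def zero_section_def O_tot_def CP_dom_def CP_def)

lemma O_chart_zero_section: "O_chart i (zero_section L) = tang_at i (affine_rep i L)"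
  by (simp add: O_chart_def zero_section_def tang_at_def vec_eq_iff)

lemma unit_at_eq: "unit_at i x = axis i 1 + tang_at i x"
  by (auto simp: unit_at_def tang_at_def axis_def vec_eq_iff)

lemma unit_at_O_chart_zero_section:
  "L \<in> CP_dom i \<Longrightarrow> unit_at i (O_chart i (zero_section L)) = affine_rep i L"
  using CP_dom_affine_rep(1)[of L i]
  by (auto simp: O_chart_zero_section unit_at_def tang_at_def vec_eq_iff)

lemma bounded_linear_tang_at: "bounded_linear (tang_at i :: complex ^ 'n \<Rightarrow> complex ^ 'n)"
  using linear_tang_at linear_conv_bounded_linear by blast

lemma tang_at_id: "v $ i = 0 \<Longrightarrow> tang_at i v = v"
  by (auto simp: tang_at_def vec_eq_iff)

lemma tang_at_nth [simp]: "tang_at i v $ i = 0"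
  by (simp add: tang_at_def)

lemma smooth_on_transform:
  assumes "\<And>k. Ck_on k f S" "open S" "\<And>x. x \<in> S \<Longrightarrow> f x = g x"
  shows "smooth_on g S"
  using assms(1) Ck_on_cong[OF assms(2,3)] by (simp add: smooth_on_def)

text \<open>The chart expressions differ only in slot \<open>i\<close>, which is 0 on the total
  space and 1 on projective space. The affine maps \<open>tang_at i\<close> and
  \<open>axis i 1 + tang_at i\<close> exchange them and preserve smoothness.\<close>

lemma smooth_map_zero_section_iff:
  "smooth_map (O_CEH a) D (zero_section \<circ> c) \<longleftrightarrow> smooth_map CP_FS D c"
proof -
  have "smooth_on (O_chart i \<circ> (zero_section \<circ> c)) W \<longleftrightarrow> smooth_on (affine_rep i \<circ> c) W"
    if W: "open W" "c ` W \<subseteq> CP_dom i" for W i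
  proof
    assume "smooth_on (affine_rep i \<circ> c) W"
    then have "Ck_on k (\<lambda>x. tang_at i ((affine_rep i \<circ> c) x)) W" for k
      by (intro Ck_on_bounded_linear[OF W(1) bounded_linear_tang_at]) (simp add: smooth_on_def o_def)
    then show "smooth_on (O_chart i \<circ> (zero_section \<circ> c)) W"
      by (simp add: smooth_on_def o_def O_chart_zero_section)
  next
    assume "smooth_on (O_chart i \<circ> (zero_section \<circ> c)) W"
    then have "Ck_on k (\<lambda>x. axis i 1 + tang_at i ((O_chart i \<circ> (zero_section \<circ> c)) x)) W" for k
      by (intro Ck_on_add[OF W(1) Ck_on_const] Ck_on_bounded_linear[OF W(1) bounded_linear_tang_at])
        (simp add: smooth_on_def o_def)
    moreover have "axis i 1 + tang_at i ((O_chart i \<circ> (zero_section \<circ> c)) x) = (affine_rep i \<circ> c) x" if "x \<in> W" for x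
      using W(2) that unit_at_O_chart_zero_section[of "c x" i] by (auto simp: unit_at_eq)
    ultimately show "smooth_on (affine_rep i \<circ> c) W"
      by (intro smooth_on_transform[OF _ W(1)])
  qed
  moreover have "(zero_section \<circ> c) ` W \<subseteq> O_dom i \<longleftrightarrow> c ` W \<subseteq> CP_dom i" for W i by auto
  ultimately have "(\<exists>W. open W \<and> p \<in> W \<and> W \<subseteq> D \<and> (zero_section \<circ> c) ` W \<subseteq> O_dom i \<and> smooth_on (O_chart i \<circ> (zero_section \<circ> c)) W)
     \<longleftrightarrow> (\<exists>W. open W \<and> p \<in> W \<and> W \<subseteq> D \<and> c ` W \<subseteq> CP_dom i \<and> smooth_on (affine_rep i \<circ> c) W)" for p i
    by (metis (no_types, lifting))
  then show ?thesis
    unfolding smooth_map_def O_CEH_simps CP_FS_simps by (simp only: o_apply zero_section_in_O_dom)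
qed

text \<open>The difference quotient at 0 is \<open>s * m s\<close>. This disposes of the terms in
  which the fibre coordinate occurs quadratically.\<close>

lemma DERIV_square_mult:
  fixes m :: "real \<Rightarrow> real"
  assumes "isCont m 0"
  shows "((\<lambda>s. s\<^sup>2 * m s) has_real_derivative 0) (at 0)"
  unfolding CARAT_DERIV
  by (rule exI[of _ "\<lambda>s. s * m s"]) (use assms in \<open>auto simp: power2_eq_square intro!: continuous_intros\<close>)

text \<open>At \<open>x $ i = 0\<close> the vertical form \<theta> vanishes on \<open>w\<close>, and
  the root is \<open>a\<close>. Since \<open>v\<close> is arbitrary, this also says that the fibre
  is orthogonal to the zero section.\<close>

lemma ceh_explicit_zero:
  fixes x :: "complex ^ 'n"
  assumes "a > 0" "x $ i = 0" "w $ i = 0"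
  shows "ceh_explicit a i x w v = a * fubini_study (unit_at i x) w (tang_at i v)"
  using assms by (simp add: ceh_explicit_def Let_def real_root_power_cancel tang_at_id)

lemma unit_at_add: "unit_at i (x + s *\<^sub>R v) = unit_at i x + s *\<^sub>R tang_at i v"
  by (auto simp: unit_at_def tang_at_def vec_eq_iff)

text \<open>Derivatives along \<open>X\<close> stay inside the zero section. In the direction
  \<open>v\<close> the fibre coordinate is \<open>s\<close> times \<open>v $ i\<close> and enters
  only through its squared modulus, so it contributes nothing to first order.\<close>

lemma christoffel_ceh_zero:
  fixes x :: "complex ^ 'n"
  assumes a: "a > 0" and x: "x $ i = 0" and X: "X $ i = 0"
  shows "christoffel (ceh_explicit a i) x X X v = a * christoffel fubini_study (unit_at i x) X X (tang_at i v)"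
proof -
  let ?\<zeta> = "unit_at i x"
  have line: "((\<lambda>s. fubini_study (?\<zeta> + s *\<^sub>R u) w w') has_real_derivative dir_deriv (\<lambda>y. fubini_study y w w') ?\<zeta> u) (at 0)"
    for u w w'
    using fubini_study_line_deriv[OF unit_at_nonzero, of i x u w w'] unfolding dir_deriv_def
    by (simp add: DERIV_imp_deriv)
  have 1: "dir_deriv (\<lambda>y. ceh_explicit a i y X v) x X = a * dir_deriv (\<lambda>y. fubini_study y X (tang_at i v)) ?\<zeta> X"
  proof -
    have "(\<lambda>s. ceh_explicit a i (x + s *\<^sub>R X) X v) = (\<lambda>s. a * fubini_study (?\<zeta> + s *\<^sub>R X) X (tang_at i v))"
      using a x X by (simp add: ceh_explicit_zero unit_at_add tang_at_id fun_eq_iff)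
    then show ?thesis unfolding dir_deriv_def[of "\<lambda>y. ceh_explicit a i y X v"]
      using DERIV_imp_deriv[OF DERIV_cmult[OF line]] by metis
  qed
  have 2: "dir_deriv (\<lambda>y. ceh_explicit a i y X X) x v = a * dir_deriv (\<lambda>y. fubini_study y X X) ?\<zeta> (tang_at i v)"
  proof -
    define Z where "Z s = ?\<zeta> + s *\<^sub>R tang_at i v" for s
    define N where "N s = (norm (Z s))\<^sup>2" for s
    define k where "k s = (norm (v $ i))\<^sup>2 * N s ^ CARD('n)" for s
    define q where "q s = a ^ CARD('n) + s\<^sup>2 * k s" for s
    \<comment> \<open>Because \<open>X $ i = 0\<close>, the vertical form of \<open>X\<close> at
      \<open>x + s v\<close> is \<open>s\<close> times a continuous function; \<open>m\<close> is
      its weighted squared size with \<open>s\<^sup>2\<close> divided out.\<close>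
    define m where "m s = N s ^ CARD('n) / q s * (norm (v $ i * herm X (Z s) / of_real (N s)))\<^sup>2" for s
    have Z: "isCont Z 0" unfolding Z_def by (intro continuous_intros)
    have N: "isCont N 0" unfolding N_def by (intro continuous_intros Z)
    have N0: "complex_of_real (N 0) \<noteq> 0" by (simp add: N_def Z_def unit_at_nonzero)
    have k: "isCont k 0" unfolding k_def by (intro continuous_intros N)
    have q: "isCont q 0" unfolding q_def by (intro continuous_intros k)
    have q0: "q 0 > 0" using a by (simp add: q_def)
    have m: "isCont m 0"
      unfolding m_def by (intro continuous_intros N q isCont_herm Z N0) (use q0 in auto)
    have "ceh_explicit a i (x + s *\<^sub>R v) X X = root CARD('n) (q s) * (fubini_study (Z s) X X + s\<^sup>2 * m s)" for s
    proof -
      have r: "Re (\<theta> * cnj \<theta>) = (norm \<theta>)\<^sup>2" for \<theta>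
        by (metis Re_complex_of_real complex_norm_square)
      show ?thesis
        using X x unfolding ceh_explicit_def Let_def unit_at_add Z_def[symmetric] N_def[symmetric] r
        by (simp add: tang_at_id m_def q_def k_def norm_mult norm_divide power_mult_distrib power_divide mult_ac)
    qed
    then have e: "(\<lambda>s. ceh_explicit a i (x + s *\<^sub>R v) X X) = (\<lambda>s. root CARD('n) (q s) * (fubini_study (Z s) X X + s\<^sup>2 * m s))"
      by blast
    have dq: "(q has_real_derivative 0) (at 0)"
      unfolding q_def[abs_def] using DERIV_add[OF DERIV_const DERIV_square_mult[OF k]] by simp
    have "((\<lambda>s. root CARD('n) (q s)) has_real_derivative inverse (real CARD('n) * root CARD('n) (q 0) ^ (CARD('n) - Suc 0)) * 0) (at 0)"
      by (rule DERIV_chain2[OF DERIV_real_root dq]) (use q0 in auto)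
    then have "((\<lambda>s. root CARD('n) (q s)) has_real_derivative 0) (at 0)" by simp
    moreover have "((\<lambda>s. fubini_study (Z s) X X) has_real_derivative dir_deriv (\<lambda>y. fubini_study y X X) ?\<zeta> (tang_at i v)) (at 0)"
      unfolding Z_def by (rule line)
    ultimately have "((\<lambda>s. root CARD('n) (q s) * (fubini_study (Z s) X X + s\<^sup>2 * m s)) has_real_derivative
        0 * (fubini_study (Z 0) X X + 0\<^sup>2 * m 0) + (dir_deriv (\<lambda>y. fubini_study y X X) ?\<zeta> (tang_at i v) + 0) * root CARD('n) (q 0)) (at 0)"
      by (intro DERIV_mult DERIV_add DERIV_square_mult[OF m])
    moreover have "root CARD('n) (q 0) = a" using a by (simp add: q_def real_root_power_cancel)
    ultimately have "((\<lambda>s. root CARD('n) (q s) * (fubini_study (Z s) X X + s\<^sup>2 * m s)) has_real_derivative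
        a * dir_deriv (\<lambda>y. fubini_study y X X) ?\<zeta> (tang_at i v)) (at 0)"
      by (simp add: mult.commute)
    then show ?thesis unfolding dir_deriv_def[of "\<lambda>y. ceh_explicit a i y X X"] e
      by (rule DERIV_imp_deriv)
  qed
  show ?thesis unfolding christoffel_def 1 2 by (simp add: algebra_simps)
qed

theorem geodesic_zero_section_iff:
  fixes c :: "real \<Rightarrow> (complex ^ 'n) set"
  assumes a: "a > 0"
  shows "geodesic_on (O_CEH a) I (zero_section \<circ> c) \<longleftrightarrow> geodesic_on CP_FS I c"
proof (cases "smooth_map CP_FS I c")
  case False
  then show ?thesis by (simp add: geodesic_on_def smooth_map_zero_section_iff)
next
  case True
  have dom: "(zero_section \<circ> c) t \<in> cdom (O_CEH a) i \<longleftrightarrow> c t \<in> cdom CP_FS i" for t i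
    by simp
  have eq: "(let x = chart (O_CEH a) i \<circ> (zero_section \<circ> c)
      in \<forall>v\<in>tang (O_CEH a) i. metr (O_CEH a) i (x t) (vel (vel x) t) v + christoffel (metr (O_CEH a) i) (x t) (vel x t) (vel x t) v = 0)
     \<longleftrightarrow> (let x = chart CP_FS i \<circ> c
      in \<forall>v\<in>tang CP_FS i. metr CP_FS i (x t) (vel (vel x) t) v + christoffel (metr CP_FS i) (x t) (vel x t) (vel x t) v = 0)"
    if t: "t \<in> I" "c t \<in> cdom CP_FS i" for i t
  proof -
    define \<zeta> where "\<zeta> = affine_rep i \<circ> c"
    define x where "x = O_chart i \<circ> (zero_section \<circ> c)"
    from True t obtain W where W: "open W" "t \<in> W" "W \<subseteq> I" "c ` W \<subseteq> CP_dom i" "smooth_on \<zeta> W"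
      unfolding \<zeta>_def by (elim smooth_mapE) simp_all
    have 1: "\<zeta> s $ i = 1" if "s \<in> W" for s
      using W(4) that CP_dom_affine_rep(1)[of "c s" i] by (auto simp: \<zeta>_def)
    have d1: "(\<zeta> has_vector_derivative vel \<zeta> s) (at s)" if "s \<in> W" for s
      by (rule smooth_on_curveD(1)[OF W(5) that])
    have v0: "vel \<zeta> s $ i = 0" if "s \<in> W" for s
      by (rule vector_derivative_nth_const[OF d1[OF that] W(1) that 1])
    have d2: "(vel \<zeta> has_vector_derivative vel (vel \<zeta>) s) (at s)" if "s \<in> W" for s
      by (rule smooth_on_curveD(2)[OF W(5) that W(1)])
    have a0: "vel (vel \<zeta>) s $ i = 0" if "s \<in> W" for s
      by (rule vector_derivative_nth_const[OF d2[OF that] W(1) that v0])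
    have x: "x = (\<lambda>s. tang_at i (\<zeta> s))" by (simp add: x_def \<zeta>_def o_def O_chart_zero_section)
    have x1: "vel x s = vel \<zeta> s" if "s \<in> W" for s
      using bounded_linear.has_vector_derivative[OF bounded_linear_tang_at d1[OF that]] v0[OF that]
      unfolding x by (metis tang_at_id vector_derivative_at)
    have "(vel x has_vector_derivative vel (vel \<zeta>) t) (at t)"
      by (rule has_vector_derivative_transform_within_open[OF d2 W(1,2)]) (use W(2) x1 in auto)
    then have x2: "vel (vel x) t = vel (vel \<zeta>) t" by (rule vector_derivative_at)
    have u: "unit_at i (x t) = \<zeta> t" unfolding x_def \<zeta>_def using t(2) by (simp add: unit_at_O_chart_zero_section)
    have e: "ceh_explicit a i (x t) (vel (vel x) t) v + christoffel (ceh_explicit a i) (x t) (vel x t) (vel x t) v =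
       a * (fubini_study (\<zeta> t) (vel (vel \<zeta>) t) (tang_at i v) + christoffel fubini_study (\<zeta> t) (vel \<zeta> t) (vel \<zeta> t) (tang_at i v))" for v
    proof -
      have "x t $ i = 0" by (simp add: x)
      then show ?thesis
        unfolding x2 x1[OF W(2)]
        using a v0[OF W(2)] a0[OF W(2)] by (simp add: ceh_explicit_zero christoffel_ceh_zero u distrib_left)
    qed
    \<comment> \<open>The equation sees a test vector only through \<open>tang_at i v\<close>, so
      the fibre direction imposes no further condition.\<close>
    have "(\<forall>v. P (tang_at i v)) \<longleftrightarrow> (\<forall>v. v $ i = 0 \<longrightarrow> P v)" for P :: "complex ^ 'n \<Rightarrow> bool"
      by (metis tang_at_id tang_at_nth)
    from this[of "\<lambda>v. fubini_study (\<zeta> t) (vel (vel \<zeta>) t) v + christoffel fubini_study (\<zeta> t) (vel \<zeta> t) (vel \<zeta> t) v = 0"]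
    show ?thesis
      unfolding Let_def \<zeta>_def[symmetric] x_def[symmetric] metr_O_CEH[OF a] O_CEH_simps CP_FS_simps e
      using a by simp
  qed
  then show ?thesis
    unfolding geodesic_on_def smooth_map_zero_section_iff dom
    by (intro conj_cong all_cong1 ball_cong imp_cong refl eq)
qed

section \<open>Projected great circles are smooth geodesics\<close>

lemma smooth_map_cline:
  fixes V :: "'d::real_normed_vector \<Rightarrow> complex ^ 'n"
  assumes D: "open D" and V: "smooth_on V D" and nz: "\<And>x. x \<in> D \<Longrightarrow> V x \<noteq> 0"
  shows "smooth_map CP_FS D (\<lambda>x. cline (V x))"
  unfolding smooth_map_def CP_FS_simps cline_in_CP_dom
proof (intro ballI conjI allI impI)
  fix x assume "x \<in> D"
  then show "\<exists>i. V x $ i \<noteq> 0" using nz by (metis vec_eq_iff zero_index)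
next
  fix x i assume x: "x \<in> D" "V x $ i \<noteq> 0"
  define W where "W = {x \<in> D. V x $ i \<noteq> 0}"
  have "Ck_on 0 V D" using V by (simp only: smooth_on_def)
  then have "continuous_on D (\<lambda>x. V x $ i)" by (intro continuous_intros) simp
  then have "open (D \<inter> (\<lambda>x. V x $ i) -` (- {0}))"
    by (rule continuous_open_preimage[OF _ D]) auto
  moreover have "W = D \<inter> (\<lambda>x. V x $ i) -` (- {0})" by (auto simp: W_def)
  ultimately have oW: "open W" by simp
  have "Ck_on k (\<lambda>x. inverse (V x $ i) *s V x) W" for k
  proof -
    have VW: "Ck_on k V W" using V unfolding smooth_on_def W_def by (blast intro: Ck_on_subset)
    show ?thesis
      by (intro Ck_on_bilinear[OF oW bounded_bilinear_smult] Ck_on_inverse[OF oW]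
          Ck_on_bounded_linear[OF oW bounded_linear_vec_nth] VW) (simp add: W_def)
  qed
  moreover have "inverse (V x $ i) *s V x = (affine_rep i \<circ> (\<lambda>x. cline (V x))) x" if "x \<in> W" for x
    using that by (simp add: W_def affine_rep_cline inverse_eq_divide)
  ultimately have "smooth_on (affine_rep i \<circ> (\<lambda>x. cline (V x))) W"
    by (intro smooth_on_transform[OF _ oW])
  then show "\<exists>W. open W \<and> x \<in> W \<and> W \<subseteq> D \<and> (\<lambda>x. cline (V x)) ` W \<subseteq> CP_dom i \<and> smooth_on (affine_rep i \<circ> (\<lambda>x. cline (V x))) W"
    using oW x by (intro exI[of _ W]) (auto simp: W_def cline_in_CP_dom)
qed

lemma Ck_on_hor:
  fixes f :: "'d::real_normed_vector \<Rightarrow> real"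
  assumes "open D" "Ck_on k f D"
  shows "Ck_on k (\<lambda>x. hor_lift p w (f x)) D" "Ck_on k (\<lambda>x. hor_vel p w (f x)) D"
proof -
  define l where "l = norm w / norm p"
  have "Ck_on k (\<lambda>x. l * f x) D"
    by (intro Ck_on_bounded_linear[OF assms(1) bounded_linear_mult_right] assms(2))
  note cs = Ck_on_cos_sin[OF assms(1) this]
  have s: "Ck_on k (\<lambda>x. g x *\<^sub>R v) D" if "Ck_on k g D" for g and v :: "complex ^ 'n"
    by (intro Ck_on_bounded_linear[OF assms(1) bounded_linear_scaleR_left] that)
  have m: "Ck_on k (\<lambda>x. r * g x) D" if "Ck_on k g D" for g and r :: real
    by (intro Ck_on_bounded_linear[OF assms(1) bounded_linear_mult_right] that)
  have "Ck_on k (\<lambda>x. cos (l * f x) *\<^sub>R p + (1 / l * sin (l * f x)) *\<^sub>R w) D"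
    by (intro Ck_on_add[OF assms(1)] s m) (use cs in auto)
  then show "Ck_on k (\<lambda>x. hor_lift p w (f x)) D" by (simp add: hor_lift_def Let_def l_def mult_ac)
  have "Ck_on k (\<lambda>x. (- l * sin (l * f x)) *\<^sub>R p + cos (l * f x) *\<^sub>R w) D"
    by (intro Ck_on_add[OF assms(1)] s m) (use cs in auto)
  then show "Ck_on k (\<lambda>x. hor_vel p w (f x)) D" by (simp add: hor_vel_def Let_def l_def mult_ac)
qed

lemma hor_lift_nonzero:
  assumes "p \<noteq> 0" "herm w p = 0"
  shows "hor_lift p w t \<noteq> 0"
  using hor_lift_herm(1)[OF assms, of t] assms(1) by force

theorem geodesic_hor_lift:
  fixes p w :: "complex ^ 'n"
  assumes p: "p \<noteq> 0" "herm w p = 0"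
  shows "geodesic_on CP_FS UNIV (\<lambda>t. cline (hor_lift p w t))"
proof -
  define V V' where "V = hor_lift p w" and "V' = hor_vel p w"
  define l where "l = norm w / norm p"
  define c where "c = (\<lambda>t. cline (V t))"
  have V: "(V has_vector_derivative V' t) (at t)" "(V' has_vector_derivative - (l\<^sup>2 *\<^sub>R V t)) (at t)" for t
    unfolding V_def V'_def l_def by (intro hor_lift_deriv p)+
  have "smooth_on V UNIV"
    unfolding V_def smooth_on_def using Ck_on_hor(1)[OF open_UNIV Ck_on_linear[OF open_UNIV bounded_linear_ident]] by blast
  then have sm: "smooth_map CP_FS UNIV c"
    unfolding c_def by (intro smooth_map_cline) (auto simp: V_def hor_lift_nonzero[OF p])
  have "vel (vel \<zeta>) t = (2 * (herm (vel \<zeta> t) (\<zeta> t) / of_real ((norm (\<zeta> t))\<^sup>2))) *s vel \<zeta> t \<and> \<zeta> t $ i = 1 \<and> vel \<zeta> t $ i = 0 \<and> vel (vel \<zeta>) t $ i = 0"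
    if t: "c t \<in> CP_dom i" and \<zeta>: "\<zeta> = affine_rep i \<circ> c" for \<zeta> t i
  proof -
    from sm t obtain W where W: "open W" "t \<in> W" "c ` W \<subseteq> CP_dom i" "smooth_on \<zeta> W"
      unfolding \<zeta> by (elim smooth_mapE) simp_all
    have 1: "\<zeta> s $ i = 1" if "s \<in> W" for s
      using W(3) that CP_dom_affine_rep(1)[of "c s" i] by (auto simp: \<zeta>)
    have d1: "(\<zeta> has_vector_derivative vel \<zeta> s) (at s)" if "s \<in> W" for s
      by (rule smooth_on_curveD(1)[OF W(4) that])
    have v0: "vel \<zeta> s $ i = 0" if "s \<in> W" for s
      by (rule vector_derivative_nth_const[OF d1[OF that] W(1) that 1])
    have d2: "(vel \<zeta> has_vector_derivative vel (vel \<zeta>) s) (at s)" if "s \<in> W" for s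
      by (rule smooth_on_curveD(2)[OF W(4) that W(1)])
    have a0: "vel (vel \<zeta>) s $ i = 0" if "s \<in> W" for s
      by (rule vector_derivative_nth_const[OF d2[OF that] W(1) that v0])
    define f f' where "f s = V s $ i" and "f' s = V' s $ i" for s
    have f: "(f has_vector_derivative f' s) (at s)" "(f' has_vector_derivative of_real (- l\<^sup>2) * f s) (at s)" for s
      using has_vector_derivative_nth[OF V(1)[of s], of i] has_vector_derivative_nth[OF V(2)[of s], of i]
      by (simp_all add: f_def[abs_def] f'_def[abs_def] scaleR_smult)
    have f0: "f s \<noteq> 0" if "s \<in> W" for s
      using W(3) that by (auto simp: c_def f_def cline_in_CP_dom)
    have z: "V s = f s *s \<zeta> s" if "s \<in> W" for s
      using f0[OF that] by (simp add: \<zeta> c_def f_def affine_rep_cline)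
    have z': "V' s = f s *s vel \<zeta> s + f' s *s \<zeta> s" if "s \<in> W" for s
      using has_vector_derivative_transform_within_open[OF has_vector_derivative_smult[OF f(1) d1[OF that]] W(1) that, of V]
        V(1) z vector_derivative_unique_at by (metis (no_types, lifting))
    have "(V' has_vector_derivative (f t *s vel (vel \<zeta>) t + f' t *s vel \<zeta> t) + (f' t *s vel \<zeta> t + (of_real (- l\<^sup>2) * f t) *s \<zeta> t)) (at t)"
      by (rule has_vector_derivative_transform_within_open[OF has_vector_derivative_add[OF
        has_vector_derivative_smult[OF f(1) d2[OF W(2)]] has_vector_derivative_smult[OF f(2) d1[OF W(2)]]] W(1,2)])
        (simp add: z')
    then have "- (l\<^sup>2 *\<^sub>R V t) = (f t *s vel (vel \<zeta>) t + f' t *s vel \<zeta> t) + (f' t *s vel \<zeta> t + (of_real (- l\<^sup>2) * f t) *s \<zeta> t)"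
      using V(2) vector_derivative_unique_at by blast
    then have "f t *s vel (vel \<zeta>) t + (2 * f' t) *s vel \<zeta> t = 0"
      unfolding z[OF W(2)] by (simp add: scaleR_smult vec_eq_iff algebra_simps)
    then have acc: "vel (vel \<zeta>) t = (2 * (- f' t / f t)) *s vel \<zeta> t"
      using f0[OF W(2)] by (simp add: vec_eq_iff field_simps add_eq_0_iff)
    have nz: "\<zeta> t \<noteq> 0" using 1[OF W(2)] by auto
    have "herm (f t *s vel \<zeta> t + f' t *s \<zeta> t) (f t *s \<zeta> t) = 0"
      using hor_lift_herm(3)[OF p, of t] unfolding z[OF W(2), symmetric] z'[OF W(2), symmetric] V_def V'_def .
    then have "f t * herm (vel \<zeta> t) (\<zeta> t) + f' t * of_real ((norm (\<zeta> t))\<^sup>2) = 0"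
      using f0[OF W(2)] by (simp add: herm_simps(1-4,6) del: of_real_power)
    then have "herm (vel \<zeta> t) (\<zeta> t) / of_real ((norm (\<zeta> t))\<^sup>2) = - f' t / f t"
      using f0[OF W(2)] nz by (simp add: field_simps add_eq_0_iff)
    then show ?thesis using acc 1 v0 a0 W(2) by simp
  qed
  note key = this
  have "geodesic_on CP_FS UNIV c"
    unfolding geodesic_on_def CP_FS_simps Let_def
  proof (intro conjI allI ballI impI sm)
    fix i t and v :: "complex ^ 'n"
    assume t: "c t \<in> CP_dom i" and "v \<in> {v. v $ i = 0}"
    then show "fubini_study ((affine_rep i \<circ> c) t) (vel (vel (affine_rep i \<circ> c)) t) v
      + christoffel fubini_study ((affine_rep i \<circ> c) t) (vel (affine_rep i \<circ> c) t) (vel (affine_rep i \<circ> c) t) v = 0"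
      using key[OF t refl]
        fubini_study_geodesic_iff[of "(affine_rep i \<circ> c) t" i "vel (affine_rep i \<circ> c) t" "vel (vel (affine_rep i \<circ> c)) t"]
      by (simp del: o_apply)
  qed
  then show ?thesis by (simp add: c_def V_def)
qed

section \<open>Periodicity, speed and instability of the great circles\<close>

lemma hor_lift_period:
  fixes p w :: "complex ^ 'n"
  assumes "p \<noteq> 0" "sin (norm w / norm p * T) = 0"
  shows "hor_lift p w (t + T) = cos (norm w / norm p * T) *\<^sub>R hor_lift p w t"
    and "hor_vel p w (t + T) = cos (norm w / norm p * T) *\<^sub>R hor_vel p w t"
  using assms(2) by (simp_all add: hor_lift_def hor_vel_def Let_def distrib_left cos_add sin_add algebra_simps)

lemma cline_scaleR: "r \<noteq> 0 \<Longrightarrow> cline (r *\<^sub>R \<xi>) = cline (\<xi> :: complex ^ 'n)"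
  by (simp add: scaleR_smult cline_smult)

text \<open>Projective invariance removes the chart selected by \<open>SOME\<close>, so the speed
  can be computed on any homogeneous lift.\<close>

lemma speed_sq_zero_section:
  fixes V :: "real \<Rightarrow> complex ^ 'n"
  assumes a: "a > 0" and V: "(V has_vector_derivative V') (at t)" "V t \<noteq> 0"
  shows "speed_sq (O_CEH a) (\<lambda>s. zero_section (cline (V s))) t = a * fubini_study (V t) V' V'"
proof -
  define i where "i = (SOME i. zero_section (cline (V t)) \<in> O_dom i)"
  have "\<exists>i. V t $ i \<noteq> 0" using V(2) by (metis vec_eq_iff zero_index)
  then have "zero_section (cline (V t)) \<in> O_dom i"
    unfolding i_def by (intro someI_ex[of "\<lambda>i. zero_section (cline (V t)) \<in> O_dom i"]) (simp add: cline_in_CP_dom)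
  then have i: "V t $ i \<noteq> 0" by (simp add: cline_in_CP_dom)
  define x where "x = O_chart i \<circ> (\<lambda>s. zero_section (cline (V s)))"
  define X where "X = (1 / V t $ i) *s V' + (- V' $ i / (V t $ i)\<^sup>2) *s V t"
  have X: "X $ i = 0" using i by (simp add: X_def field_simps power2_eq_square)
  have "(x has_vector_derivative tang_at i X) (at t)"
    using bounded_linear.has_vector_derivative[OF bounded_linear_tang_at affine_rep_cline_deriv[OF V(1) i]]
    by (simp add: x_def o_def O_chart_zero_section X_def)
  then have vx: "vel x t = X" using X by (simp add: vector_derivative_at tang_at_id)
  have u: "unit_at i (x t) = (1 / V t $ i) *s V t"
    using i unit_at_O_chart_zero_section[of "cline (V t)" i] by (simp add: x_def cline_in_CP_dom affine_rep_cline)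
  have "x t $ i = 0" by (simp add: x_def O_chart_zero_section)
  then have "ceh_explicit a i (x t) X X = a * fubini_study ((1 / V t $ i) *s V t) X X"
    using a X by (simp add: ceh_explicit_zero tang_at_id u)
  also have "fubini_study ((1 / V t $ i) *s V t) X X = fubini_study (V t) V' V'"
    unfolding X_def using V(2) i by (intro fubini_study_projective) auto
  finally show ?thesis
    unfolding speed_sq_def Let_def O_CEH_simps i_def[symmetric] x_def[symmetric] metr_O_CEH[OF a] vx .
qed

text \<open>The great circle through \<open>p\<close> in the direction \<open>w\<close> lies in a projective line, which is a round
  sphere; the variation pushes it to its parallel circles, in the direction \<open>- \<i> \<gamma>'\<close>.\<close>

definition parallel_lift :: "complex ^ 'n \<Rightarrow> complex ^ 'n \<Rightarrow> real \<Rightarrow> real \<Rightarrow> complex ^ 'n" where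
  "parallel_lift p w \<epsilon> t =
     cos \<epsilon> *\<^sub>R hor_lift p w t + (- (sin \<epsilon> / (norm w / norm p))) *\<^sub>R (\<i> *s hor_vel p w t)"

text \<open>The vectors \<open>L\<close> and \<open>H / l\<close> are orthogonal of equal norm, so
  the curve stays on the sphere. Its velocity acquires a vertical part of relative size
  \<open>sin (2 * \<epsilon>)\<close>, which the metric discards. The angle doubles because a
  projective line is a sphere of radius 1/2.\<close>

lemma parallel_lift:
  fixes p w :: "complex ^ 'n"
  assumes p: "p \<noteq> 0" "herm w p = 0" and w: "w \<noteq> 0"
  defines "l \<equiv> norm w / norm p"
  shows "norm (parallel_lift p w \<epsilon> t) = norm p"
    and "\<exists>V'. (parallel_lift p w \<epsilon> has_vector_derivative V') (at t) \<and>
       fubini_study (parallel_lift p w \<epsilon> t) V' V' = l\<^sup>2 * (cos (2 * \<epsilon>))\<^sup>2"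
proof -
  define L H where "L = hor_lift p w t" and "H = hor_vel p w t"
  define P where "P = (norm p)\<^sup>2"
  have l: "l > 0" and P: "P > 0" using p w by (auto simp: l_def P_def)
  have lP: "(norm w)\<^sup>2 = l\<^sup>2 * P" using p by (simp add: l_def P_def power_divide)
  have h: "herm L L = of_real P" "herm H H = of_real (l\<^sup>2 * P)" "herm H L = 0" "herm L H = 0"
    unfolding lP[symmetric] unfolding P_def herm_simps(6) using hor_lift_herm[OF p, of t] herm_simps(5)[of H L]
    by (simp_all add: L_def H_def)
  define S C where "S = sin \<epsilon>" and "C = cos \<epsilon>"
  have SC: "S\<^sup>2 + C\<^sup>2 = 1" by (simp add: S_def C_def)
  define V V' where "V = of_real C *s L + (- of_real (S / l) * \<i>) *s H" and "V' = of_real C *s H + (of_real (l * S) * \<i>) *s L"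
  have V: "parallel_lift p w \<epsilon> t = V"
    by (simp add: parallel_lift_def V_def S_def C_def L_def H_def scaleR_smult l_def vec_eq_iff)
  have "herm V V = of_real (C\<^sup>2 * P + S\<^sup>2 * P)"
    using l unfolding V_def by (simp add: herm_simps(1-4) herm_diff h field_simps power2_eq_square)
  then have VV: "(norm V)\<^sup>2 = P"
    using SC by (simp add: norm_sq_herm) (metis distrib_right add.commute mult_1)
  then show "norm (parallel_lift p w \<epsilon> t) = norm p" by (simp add: V P_def)
  have "(parallel_lift p w \<epsilon> has_vector_derivative
      cos \<epsilon> *\<^sub>R H + (- (sin \<epsilon> / l)) *\<^sub>R (\<i> *s - (l\<^sup>2 *\<^sub>R L))) (at t)"
    unfolding parallel_lift_def[abs_def] l_def[symmetric] H_def L_def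
    by (intro has_vector_derivative_add bounded_linear.has_vector_derivative[OF bounded_linear_scaleR_right]
        bounded_linear.has_vector_derivative[OF bounded_bilinear.bounded_linear_right[OF bounded_bilinear_smult]]
        hor_lift_deriv[OF p(1), of w t, folded l_def])
  also have "cos \<epsilon> *\<^sub>R H + (- (sin \<epsilon> / l)) *\<^sub>R (\<i> *s - (l\<^sup>2 *\<^sub>R L)) = V'"
    using l by (simp add: V'_def S_def C_def scaleR_smult vec_eq_iff power2_eq_square)
  finally have d: "(parallel_lift p w \<epsilon> has_vector_derivative V') (at t)" .
  have "herm V' V' = of_real (l\<^sup>2 * (C\<^sup>2 * P + S\<^sup>2 * P))"
    unfolding V'_def by (simp add: herm_simps(1-4) herm_diff h field_simps power2_eq_square)
  moreover have "C\<^sup>2 * P + S\<^sup>2 * P = P" using SC by (metis distrib_right add.commute mult_1)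
  ultimately have V'V': "Re (herm V' V') = l\<^sup>2 * P" by simp
  have V'V: "herm V' V = \<i> * of_real (2 * S * C * l * P)"
    using l unfolding V'_def V_def by (simp add: herm_simps(1-4) herm_diff h field_simps power2_eq_square)
  have "herm V V' = cnj (herm V' V)" by (simp add: herm_simps(5))
  then have "Re (herm V' V * herm V V') = (2 * S * C * l * P)\<^sup>2"
    unfolding V'V by (simp add: power2_eq_square)
  then have "fubini_study V V' V' = l\<^sup>2 * (1 - (2 * S * C)\<^sup>2)"
    using P unfolding fubini_study_eq V'V' VV by (simp add: field_simps power2_eq_square)
  also have "2 * S * C = sin (2 * \<epsilon>)" by (simp add: S_def C_def sin_double)
  also have "1 - (sin (2 * \<epsilon>))\<^sup>2 = (cos (2 * \<epsilon>))\<^sup>2" by (simp add: cos_squared_eq)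
  finally show "\<exists>V'. (parallel_lift p w \<epsilon> has_vector_derivative V') (at t) \<and>
       fubini_study (parallel_lift p w \<epsilon> t) V' V' = l\<^sup>2 * (cos (2 * \<epsilon>))\<^sup>2"
    using d V by auto
qed

theorem not_stable_hor_lift:
  fixes p w :: "complex ^ 'n"
  assumes a: "a > 0" and p: "p \<noteq> 0" "herm w p = 0" and w: "w \<noteq> 0"
    and T: "T > 0" "\<And>t. cline (hor_lift p w (t + T)) = cline (hor_lift p w t)"
  shows "\<not> stable_geodesic (O_CEH a) T (\<lambda>t. zero_section (cline (hor_lift p w t)))"
proof
  define l where "l = norm w / norm p"
  have l: "l > 0" using p w by (simp add: l_def)
  define \<Phi> where "\<Phi> \<epsilon> t = zero_section (cline (parallel_lift p w \<epsilon> t))" for \<epsilon> t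
  have nz: "parallel_lift p w \<epsilon> t \<noteq> 0" for \<epsilon> t using parallel_lift(1)[OF p w, of \<epsilon> t] p(1) by force
  \<comment> \<open>\<open>T\<close> may be any period. The line returns to that of \<open>p\<close>
    only if the component along \<open>w\<close>, detected by pairing with \<open>w\<close>,
    vanishes.\<close>
  have sin0: "sin (l * T) = 0"
  proof -
    have "cline (hor_lift p w T) = cline p" using T(2)[of 0] by simp
    then obtain c where "hor_lift p w T = c *s p" by (rule cline_eqD)
    then have "herm (hor_lift p w T) w = 0"
      using p(2) herm_simps(5)[of w p] by (simp add: herm_simps(3))
    moreover have "herm (hor_lift p w T) w = of_real (sin (l * T) / l * (norm w)\<^sup>2)"
      using p(2) herm_simps(5)[of w p]
      by (simp add: hor_lift_def Let_def l_def[symmetric] herm_simps(1,6) herm_scaleR scaleR_conv_of_real[where 'a = complex])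
    ultimately show ?thesis using l w by auto
  qed
  \<comment> \<open>Position and velocity pick up the same real factor \<open>cos (l * T)\<close>,
    so every parallel curve closes up after the same time.\<close>
  have per: "\<Phi> \<epsilon> (t + T) = \<Phi> \<epsilon> t" for \<epsilon> t
  proof -
    have "parallel_lift p w \<epsilon> (t + T) = cos (l * T) *\<^sub>R parallel_lift p w \<epsilon> t"
      unfolding parallel_lift_def hor_lift_period[OF p(1) sin0[unfolded l_def]] l_def[symmetric]
      by (simp add: scaleR_smult vec_eq_iff algebra_simps)
    moreover have "cos (l * T) \<noteq> 0" using sin0 sin_zero_abs_cos_one by fastforce
    ultimately show ?thesis unfolding \<Phi>_def by (simp add: cline_scaleR)
  qed
  have var: "closed_variation (O_CEH a) T (\<lambda>t. zero_section (cline (hor_lift p w t))) 1 \<Phi>"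
  proof -
    define D where "D = {- 1<..<1 :: real} \<times> (UNIV :: real set)"
    have D: "open D" unfolding D_def by (intro open_Times) auto
    have "Ck_on k (\<lambda>x. parallel_lift p w (fst x) (snd x)) D" for k
    proof -
      have f: "Ck_on k fst D" and s: "Ck_on k snd D"
        by (intro Ck_on_linear D bounded_linear_fst bounded_linear_snd)+
      have "Ck_on k (\<lambda>x. cos (fst x) *\<^sub>R hor_lift p w (snd x) + (- (1 / l) * sin (fst x)) *\<^sub>R (\<i> *s hor_vel p w (snd x))) D"
        by (intro Ck_on_add D Ck_on_bilinear[OF D bounded_bilinear_scaleR] Ck_on_hor s
            Ck_on_bounded_linear[OF D bounded_linear_mult_right] conjunct1[OF Ck_on_cos_sin[OF D f]] conjunct2[OF Ck_on_cos_sin[OF D f]]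
            Ck_on_bounded_linear[OF D bounded_bilinear.bounded_linear_right[OF bounded_bilinear_smult]])
      then show ?thesis by (simp add: parallel_lift_def l_def mult_ac)
    qed
    then have "smooth_map CP_FS D (\<lambda>x. cline (parallel_lift p w (fst x) (snd x)))"
      by (intro smooth_map_cline D) (auto simp: smooth_on_def nz)
    then have "smooth_map (O_CEH a) D (zero_section \<circ> (\<lambda>x. cline (parallel_lift p w (fst x) (snd x))))"
      by (simp only: smooth_map_zero_section_iff)
    moreover have "zero_section \<circ> (\<lambda>x. cline (parallel_lift p w (fst x) (snd x))) = (\<lambda>(\<epsilon>, t). \<Phi> \<epsilon> t)"
      by (auto simp: fun_eq_iff \<Phi>_def)
    moreover have "\<Phi> 0 t = zero_section (cline (hor_lift p w t))" for t
      by (simp add: \<Phi>_def parallel_lift_def)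
    ultimately show ?thesis
      unfolding closed_variation_def D_def using per by simp
  qed
  have E: "energy (O_CEH a) T (\<Phi> \<epsilon>) = T * a * l\<^sup>2 / 2 * (cos (2 * \<epsilon>))\<^sup>2" for \<epsilon>
  proof -
    have "speed_sq (O_CEH a) (\<Phi> \<epsilon>) t = a * (l\<^sup>2 * (cos (2 * \<epsilon>))\<^sup>2)" for t
      using parallel_lift(2)[OF p w, of \<epsilon> t] speed_sq_zero_section[OF a _ nz]
      unfolding \<Phi>_def l_def by fastforce
    then have "speed_sq (O_CEH a) (\<Phi> \<epsilon>) = (\<lambda>t. a * (l\<^sup>2 * (cos (2 * \<epsilon>))\<^sup>2))" by blast
    then show ?thesis unfolding energy_def using T(1) by simp
  qed
  define K where "K = T * a * l\<^sup>2 / 2"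
  have K: "K > 0" using T(1) a l by (simp add: K_def)
  have "deriv (\<lambda>\<epsilon>. energy (O_CEH a) T (\<Phi> \<epsilon>)) = (\<lambda>\<epsilon>. K * (- 4 * cos (2 * \<epsilon>) * sin (2 * \<epsilon>)))"
    unfolding E K_def[symmetric] by (rule ext, rule DERIV_imp_deriv) (auto intro!: derivative_eq_intros)
  moreover have "deriv (\<lambda>\<epsilon>. K * (- 4 * cos (2 * \<epsilon>) * sin (2 * \<epsilon>))) 0 = - 8 * K"
    by (rule DERIV_imp_deriv) (auto intro!: derivative_eq_intros)
  ultimately have "deriv (deriv (\<lambda>\<epsilon>. energy (O_CEH a) T (\<Phi> \<epsilon>))) 0 < 0" using K by simp
  moreover assume "stable_geodesic (O_CEH a) T (\<lambda>t. zero_section (cline (hor_lift p w t)))"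
  ultimately show False using var unfolding stable_geodesic_def by (meson not_less)
qed

section \<open>Convexity of the height function\<close>

lemma differentiable_bilinear:
  assumes "bounded_bilinear B" "f differentiable (at x)" "g differentiable (at x)"
  shows "(\<lambda>x. B (f x) (g x)) differentiable (at x)"
  using assms(2,3) bounded_bilinear.FDERIV[OF assms(1)] unfolding differentiable_def by blast

lemma differentiable_linear:
  assumes "bounded_linear L" "f differentiable (at x)"
  shows "(\<lambda>x. L (f x)) differentiable (at x)"
  using assms(2) bounded_linear.has_derivative[OF assms(1)] unfolding differentiable_def by blast

lemma differentiable_root:
  assumes "f differentiable (at x)" "f x > (0::real)" "n > 0"
  shows "(\<lambda>x. root n (f x)) differentiable (at x)"
proof -
  obtain f' where f: "(f has_derivative f') (at x)" using assms(1) by (auto simp: differentiable_def)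
  have "((root n) has_derivative (*) (inverse (real n * root n (f x) ^ (n - Suc 0)))) (at (f x))"
    using DERIV_real_root[OF assms(3,2)] by (simp add: has_field_derivative_def)
  from has_derivative_compose[OF f this] show ?thesis by (auto simp: differentiable_def)
qed

lemma ceh_explicit_linear:
  fixes x :: "complex ^ 'n"
  shows "ceh_explicit a i x (v + v') w = ceh_explicit a i x v w + ceh_explicit a i x v' w"
  "ceh_explicit a i x (r *\<^sub>R v) w = r * ceh_explicit a i x v w"
proof -
  have t: "tang_at i (v + v') = tang_at i v + tang_at i v'" "tang_at i (r *\<^sub>R v) = r *\<^sub>R tang_at i v"
    by (auto simp: tang_at_def vec_eq_iff)
  have "(v + v') $ i / of_nat n + x $ i * herm (y + y') z / N
      = (v $ i / of_nat n + x $ i * herm y z / N) + (v' $ i / of_nat n + x $ i * herm y' z / N)"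
    for n N and y y' z :: "complex ^ 'n"
    by (simp add: herm_simps(1) add_divide_distrib distrib_left)
  note e = this
  have R: "Re ((\<alpha> + \<alpha>') * \<beta>) = Re (\<alpha> * \<beta>) + Re (\<alpha>' * \<beta>)" for \<alpha> \<alpha>' \<beta>
    by (simp add: algebra_simps)
  show "ceh_explicit a i x (v + v') w = ceh_explicit a i x v w + ceh_explicit a i x v' w"
    unfolding ceh_explicit_def Let_def t(1) e fubini_study_linear(1) unfolding R
    by (simp only: distrib_left add_ac)
  have "(r *\<^sub>R v) $ i / of_nat n + x $ i * herm (r *\<^sub>R y) z / N = r *\<^sub>R (v $ i / of_nat n + x $ i * herm y z / N)"
    for n N and y z :: "complex ^ 'n" by (simp add: herm_scaleR algebra_simps scaleR_conv_of_real[where 'a = complex])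
  note e' = this
  have R': "Re (r *\<^sub>R \<alpha> * \<beta>) = r * Re (\<alpha> * \<beta>)" for \<alpha> \<beta> by (simp add: algebra_simps)
  show "ceh_explicit a i x (r *\<^sub>R v) w = r * ceh_explicit a i x v w"
    unfolding ceh_explicit_def Let_def t(2) e' fubini_study_linear(4) unfolding R' by (simp only: distrib_left mult.left_commute)
qed

lemma ceh_explicit_sym: "ceh_explicit a i x v w = ceh_explicit a i x w v"
proof -
  have r: "Re (\<alpha> * cnj \<beta>) = Re (\<beta> * cnj \<alpha>)" for \<alpha> \<beta> by simp
  show ?thesis
    unfolding ceh_explicit_def Let_def by (subst fubini_study_sym, subst r) (rule refl)
qed

lemma ceh_explicit_linear_right:
  "ceh_explicit a i x v (w + r *\<^sub>R w') = ceh_explicit a i x v w + r * ceh_explicit a i x v w'"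
  using ceh_explicit_linear(1)[of a i x w "r *\<^sub>R w'" v] ceh_explicit_linear(2)[of a i x r w' v]
  by (metis ceh_explicit_sym)

lemma ceh_explicit_differentiable:
  fixes x :: "complex ^ 'n"
  assumes a: "a > 0"
  shows "(\<lambda>(y, w, v). ceh_explicit a i y w v) differentiable (at (x, w, v))"
proof -
  let ?F = "at (x, w, v)"
  let ?W = "\<lambda>p::(complex^'n) \<times> (complex^'n) \<times> (complex^'n). fst (snd p)" and ?V = "\<lambda>p::(complex^'n) \<times> (complex^'n) \<times> (complex^'n). snd (snd p)"
  define Z where "Z p = unit_at i (fst p)" for p :: "(complex^'n) \<times> (complex^'n) \<times> (complex^'n)"
  define N where "N p = (norm (Z p))\<^sup>2" for p
  define q where "q p = a ^ CARD('n) + (norm (fst p $ i))\<^sup>2 * N p ^ CARD('n)" for p :: "(complex^'n) \<times> (complex^'n) \<times> (complex^'n)"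
  define \<theta> where "\<theta> u p = u $ i / of_nat CARD('n) + fst p $ i * herm (tang_at i u) (Z p) / of_real (N p)"
    for u :: "complex ^ 'n" and p :: "(complex^'n) \<times> (complex^'n) \<times> (complex^'n)"
  have y: "fst differentiable ?F" by (intro bounded_linear_imp_differentiable bounded_linear_fst)
  have w: "?W differentiable ?F" and v: "?V differentiable ?F"
    by (intro bounded_linear_imp_differentiable bounded_linear_compose[OF bounded_linear_fst bounded_linear_snd]
        bounded_linear_compose[OF bounded_linear_snd bounded_linear_snd])+
  have nth: "(\<lambda>p. f p $ i) differentiable ?F" if "f differentiable ?F" for f :: "_ \<Rightarrow> complex ^ 'n"
    by (rule differentiable_linear[OF bounded_linear_vec_nth that])
  have tang: "(\<lambda>p. tang_at i (f p)) differentiable ?F" if "f differentiable ?F" for f :: "_ \<Rightarrow> complex ^ 'n"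
    by (rule differentiable_linear[OF bounded_linear_tang_at that])
  have herm: "(\<lambda>p. herm (f p) (g p)) differentiable ?F" if "f differentiable ?F" "g differentiable ?F" for f g :: "_ \<Rightarrow> complex ^ 'n"
    by (rule differentiable_bilinear[OF bounded_bilinear_herm that])
  have Re: "(\<lambda>p. Re (f p)) differentiable ?F" and cnj: "(\<lambda>p. cnj (f p)) differentiable ?F" if "f differentiable ?F" for f
    using that by (auto intro: differentiable_linear bounded_linear_Re bounded_linear_cnj)
  have real: "(\<lambda>p. complex_of_real (f p)) differentiable ?F" if "f differentiable ?F" for f
    by (rule differentiable_linear[OF bounded_linear_of_real that])
  have Z: "Z differentiable ?F"
    unfolding Z_def[abs_def] unit_at_eq[abs_def] by (intro derivative_intros tang y)
  have N: "N differentiable ?F"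
    unfolding N_def[abs_def] norm_sq_herm by (intro Re herm Z)
  have N0: "N (x, w, v) \<noteq> 0" by (simp add: N_def Z_def unit_at_nonzero)
  have "(norm z)\<^sup>2 = Re (z * cnj z)" for z by (metis Re_complex_of_real complex_norm_square)
  then have M: "(\<lambda>p. (norm (fst p $ i))\<^sup>2) differentiable ?F"
    by (simp only:) (intro Re cnj differentiable_mult nth y)
  have q: "q differentiable ?F"
    unfolding q_def[abs_def]
    by (rule differentiable_add[OF differentiable_const differentiable_mult[OF M differentiable_power[OF N]]])
  have q0: "q (x, w, v) > 0" unfolding q_def using a by (intro add_pos_nonneg) (auto simp: N_def)
  have \<theta>: "(\<lambda>p. \<theta> (f p) p) differentiable ?F" if "f differentiable ?F" for f
    unfolding \<theta>_def using N0 by (intro derivative_intros nth herm tang Z real N that y) auto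
  have "(\<lambda>p. root CARD('n) (q p) * ((Re (herm (tang_at i (?W p)) (tang_at i (?V p))) / N p
     - Re (herm (tang_at i (?W p)) (Z p) * herm (Z p) (tang_at i (?V p))) / (N p)\<^sup>2)
     + N p ^ CARD('n) / q p * Re (\<theta> (?W p) p * cnj (\<theta> (?V p) p)))) differentiable ?F"
    using N0 q0 by (intro derivative_intros differentiable_root Re cnj \<theta> herm tang Z N q w v) auto
  then show ?thesis
    unfolding ceh_explicit_def Let_def fubini_study_eq case_prod_beta q_def N_def Z_def \<theta>_def .
qed

text \<open>The product rule for the metric along a curve. The functional \<open>G\<close> depends
  only on the values at one instant, so the same \<open>G\<close> serves the geodesic, the straight
  lines in \<open>dir_deriv\<close> and the fibre scaling; comparing these gives identities without
  differentiating the coefficients.\<close>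

lemma ceh_explicit_curve:
  fixes x0 w0 v0 :: "complex ^ 'n"
  assumes a: "a > 0"
  obtains G where
    "\<And>x w v x' w' v' t. x t = x0 \<Longrightarrow> w t = w0 \<Longrightarrow> v t = v0 \<Longrightarrow> (x has_vector_derivative x') (at t) \<Longrightarrow>
       (w has_vector_derivative w') (at t) \<Longrightarrow> (v has_vector_derivative v') (at t) \<Longrightarrow>
       ((\<lambda>s. ceh_explicit a i (x s) (w s) (v s)) has_real_derivative
          (G x' + ceh_explicit a i x0 w' v0 + ceh_explicit a i x0 w0 v')) (at t)"
proof -
  obtain G where G: "((\<lambda>(y, w, v). ceh_explicit a i y w v) has_derivative G) (at (x0, w0, v0))"
    using ceh_explicit_differentiable[OF a] unfolding differentiable_def by blast
  interpret G: bounded_linear G using G by (rule has_derivative_bounded_linear)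
  have D: "((\<lambda>s. ceh_explicit a i (x s) (w s) (v s)) has_real_derivative G (x', w', v')) (at t)"
    if "x t = x0" "w t = w0" "v t = v0" "(x has_vector_derivative x') (at t)"
      "(w has_vector_derivative w') (at t)" "(v has_vector_derivative v') (at t)"
    for x w v x' w' v' t
  proof -
    have "((\<lambda>s. (x s, w s, v s)) has_derivative (\<lambda>h. (h *\<^sub>R x', h *\<^sub>R w', h *\<^sub>R v'))) (at t)"
      using that(4-6) unfolding has_vector_derivative_def by (intro has_derivative_Pair)
    from has_derivative_compose[OF this, of "\<lambda>(y, w, v). ceh_explicit a i y w v" G] G that(1-3)
    have "((\<lambda>s. ceh_explicit a i (x s) (w s) (v s)) has_derivative (\<lambda>h. G (h *\<^sub>R x', h *\<^sub>R w', h *\<^sub>R v'))) (at t)"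
      by simp
    moreover have "G (h *\<^sub>R x', h *\<^sub>R w', h *\<^sub>R v') = G (x', w', v') * h" for h
      using G.scaleR[of h "(x', w', v')"] by simp
    ultimately show ?thesis by (simp add: has_field_derivative_def)
  qed
  have c: "((\<lambda>s. c) has_vector_derivative 0) (at t)" for c :: "complex ^ 'n" and t :: real by (rule has_vector_derivative_const)
  have l: "((\<lambda>s. c + s *\<^sub>R d) has_vector_derivative d) (at 0)" for c d :: "complex ^ 'n"
    by (auto intro!: derivative_eq_intros)
  have w: "G (0, w', 0) = ceh_explicit a i x0 w' v0" for w'
  proof -
    have "((\<lambda>s. ceh_explicit a i x0 (w0 + s *\<^sub>R w') v0) has_real_derivative G (0, w', 0)) (at 0)"
      by (rule D[of "\<lambda>_. x0" _ "\<lambda>s. w0 + s *\<^sub>R w'" "\<lambda>_. v0"]) (use c l in auto)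
    moreover have "((\<lambda>s. ceh_explicit a i x0 (w0 + s *\<^sub>R w') v0) has_real_derivative ceh_explicit a i x0 w' v0) (at 0)"
      unfolding ceh_explicit_linear by (auto intro!: derivative_eq_intros)
    ultimately show ?thesis by (rule DERIV_unique)
  qed
  have v: "G (0, 0, v') = ceh_explicit a i x0 w0 v'" for v'
  proof -
    have "((\<lambda>s. ceh_explicit a i x0 w0 (v0 + s *\<^sub>R v')) has_real_derivative G (0, 0, v')) (at 0)"
      by (rule D[of "\<lambda>_. x0" _ "\<lambda>_. w0" "\<lambda>s. v0 + s *\<^sub>R v'"]) (use c l in auto)
    moreover have "((\<lambda>s. ceh_explicit a i x0 w0 (v0 + s *\<^sub>R v')) has_real_derivative ceh_explicit a i x0 w0 v') (at 0)"
      unfolding ceh_explicit_linear_right by (auto intro!: derivative_eq_intros)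
    ultimately show ?thesis by (rule DERIV_unique)
  qed
  have sum: "G (x', w', v') = G (x', 0, 0) + ceh_explicit a i x0 w' v0 + ceh_explicit a i x0 w0 v'" for x' w' v'
    unfolding w[symmetric] v[symmetric] G.add[symmetric] by simp
  show ?thesis
  proof (rule that[of "\<lambda>x'. G (x', 0, 0)"])
    fix x w v x' w' v' t
    assume "x t = x0" "w t = w0" "v t = v0" "(x has_vector_derivative x') (at t)"
      "(w has_vector_derivative w') (at t)" "(v has_vector_derivative v') (at t)"
    from D[OF this] show "((\<lambda>s. ceh_explicit a i (x s) (w s) (v s)) has_real_derivative
          (G (x', 0, 0) + ceh_explicit a i x0 w' v0 + ceh_explicit a i x0 w0 v')) (at t)"
      by (simp only: sum[symmetric])
  qed
qed

text \<open>The squared length of a vector transported by the fibre scaling with factor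
  \<open>1 + \<sigma>\<close>. Here \<open>A\<close> is \<open>a ^ n\<close>, \<open>Q\<close> is
  \<open>u ^ n\<close>, \<open>f\<close> is the Fubini-Study part and \<open>m\<close> comes from
  the vertical form \<theta>.\<close>

lemma height_second_variation:
  fixes A Q f m :: real
  assumes n: "n > 0" and A: "A > 0" and Q: "Q \<ge> 0" and f: "f \<ge> 0" and m: "m \<ge> 0"
  obtains D where
    "((\<lambda>\<sigma>. root n (A + (1 + \<sigma>)\<^sup>2 * Q) * (f + m * (1 + \<sigma>)\<^sup>2 / (A + (1 + \<sigma>)\<^sup>2 * Q))) has_real_derivative D) (at 0)"
    "D \<ge> 0" "D = 0 \<Longrightarrow> Q * f = 0 \<and> m = 0"
proof -
  define q where "q \<sigma> = A + (1 + \<sigma>)\<^sup>2 * Q" for \<sigma>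
  have q0: "q 0 > 0" "q 0 = A + Q" using A Q by (auto simp: q_def intro: add_pos_nonneg)
  have dq: "(q has_real_derivative 2 * Q) (at 0)"
    unfolding q_def[abs_def] by (auto intro!: derivative_eq_intros)
  define S where "S = root n (q 0)"
  have S: "S > 0" "S ^ n = q 0" using n q0(1) by (simp_all add: S_def)
  have Sn: "inverse (real n * S ^ (n - Suc 0)) = S / (n * q 0)"
    using n S(1) unfolding S(2)[symmetric] by (cases n) (auto simp: field_simps simp del: of_nat_Suc)
  have dr: "((\<lambda>\<sigma>. root n (q \<sigma>)) has_real_derivative S / (n * q 0) * (2 * Q)) (at 0)"
    unfolding Sn[symmetric] unfolding S_def by (rule DERIV_chain2[OF DERIV_real_root[OF n q0(1)] dq])
  have dm: "((\<lambda>\<sigma>. f + m * (1 + \<sigma>)\<^sup>2 / q \<sigma>) has_real_derivative (m * 2 * q 0 - m * (2 * Q)) / (q 0 * q 0)) (at 0)"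
    using q0(1) dq by (auto intro!: derivative_eq_intros)
  define D where "D = S / (n * q 0) * (2 * Q) * (f + m / q 0) + (m * 2 * q 0 - m * (2 * Q)) / (q 0 * q 0) * S"
  have 1: "((\<lambda>\<sigma>. root n (q \<sigma>) * (f + m * (1 + \<sigma>)\<^sup>2 / q \<sigma>)) has_real_derivative D) (at 0)"
    using DERIV_mult[OF dr dm] by (simp add: D_def S_def)
  \<comment> \<open>The growth of the denominator costs less than that of the numerator gains: the
    difference is \<open>2 * A * m\<close>. Thus \<open>A > 0\<close> forces \<open>m = 0\<close> in
    the case of equality, even where \<open>Q = 0\<close>.\<close>
  have D: "D = 2 * S / (n * q 0) * (Q * f) + 2 * S / (n * q 0 * q 0) * (Q * m) + 2 * S * A / (q 0 * q 0) * m"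
  proof -
    have "m * 2 * q 0 - m * (2 * Q) = 2 * A * m" by (simp add: q0(2) algebra_simps)
    then show ?thesis using q0(1) n unfolding D_def by (simp add: field_simps)
  qed
  have pos: "2 * S / (n * q 0) > 0" "2 * S / (n * q 0 * q 0) > 0" "2 * S * A / (q 0 * q 0) > 0"
    using n A S(1) q0(1) by auto
  have nn: "2 * S / (n * q 0) * (Q * f) \<ge> 0" "2 * S / (n * q 0 * q 0) * (Q * m) \<ge> 0" "2 * S * A / (q 0 * q 0) * m \<ge> 0"
    using pos Q f m by (meson less_imp_le mult_nonneg_nonneg)+
  have "D \<ge> 0" unfolding D using nn by linarith
  moreover have "Q * f = 0 \<and> m = 0" if "D = 0"
  proof -
    have "2 * S / (n * q 0) * (Q * f) = 0" "2 * S * A / (q 0 * q 0) * m = 0"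
      using that nn unfolding D by linarith+
    then show ?thesis using pos by (metis less_irrefl mult_eq_0_iff)
  qed
  ultimately show ?thesis using that 1 unfolding q_def by blast
qed

section \<open>The height in charts and its derivatives along geodesics\<close>

lemma norm_sq_vec: "(norm (x :: complex ^ 'n))\<^sup>2 = (\<Sum>j\<in>UNIV. (norm (x $ j))\<^sup>2)"
  by (simp add: norm_vec_def L2_set_def sum_nonneg)

text \<open>Under the blow-down map \<open>z $ j\<close> is the \<open>n\<close>-th power of the \<open>j\<close>-th coordinate, so the base of the
  inner power is \<open>u = |z|\<^sup>2\<close> and \<open>height\<close> is \<open>(a ^ n + u ^ n) powr (1 / n)\<close>, the size of the
  projective directions in the metric.\<close>

definition height :: "real \<Rightarrow> (complex ^ 'n) \<times> (complex ^ 'n) set \<Rightarrow> real" where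
  "height a p = root CARD('n) (a ^ CARD('n) + (\<Sum>j\<in>UNIV. (root CARD('n) (norm (fst p $ j)))\<^sup>2) ^ CARD('n))"

text \<open>Taking the power removes the inner n-th roots: \<open>u ^ n\<close> is the squared
  modulus of the fibre coordinate times a power of the squared norm of \<open>unit_at i x\<close>.
  The height is therefore differentiable across the zero section.\<close>

lemma height_O_param:
  fixes x :: "complex ^ 'n"
  shows "height a (O_param i x) = root CARD('n) (a ^ CARD('n) + (norm (x $ i))\<^sup>2 * ((norm (unit_at i x))\<^sup>2) ^ CARD('n))"
proof -
  let ?r = "root CARD('n) (norm (x $ i))"
  have "root CARD('n) (norm (fst (O_param i x) $ j)) = norm (unit_at i x $ j) * ?r" for j
    by (simp add: O_param_def norm_mult norm_power real_root_mult real_root_power_cancel)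
  then have "(\<Sum>j\<in>UNIV. (root CARD('n) (norm (fst (O_param i x) $ j)))\<^sup>2) = (norm (unit_at i x))\<^sup>2 * ?r\<^sup>2"
    by (simp add: power_mult_distrib norm_sq_vec sum_distrib_right)
  moreover have "(?r\<^sup>2) ^ CARD('n) = (norm (x $ i))\<^sup>2"
    by (metis mult.commute norm_ge_zero power_mult real_root_pow_pos2 zero_less_card_finite)
  ultimately show ?thesis unfolding height_def by (simp add: power_mult_distrib mult.commute)
qed

lemma height_eq_iff:
  fixes p :: "(complex ^ 'n) \<times> (complex ^ 'n) set"
  assumes "a > 0"
  shows "height a p = a \<longleftrightarrow> fst p = 0"
proof -
  define u where "u = (\<Sum>j\<in>UNIV. (root CARD('n) (norm (fst p $ j)))\<^sup>2)"
  have "height a p = a \<longleftrightarrow> root CARD('n) (a ^ CARD('n) + u ^ CARD('n)) = root CARD('n) (a ^ CARD('n))"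
    using assms by (simp add: height_def u_def real_root_power_cancel)
  also have "\<dots> \<longleftrightarrow> u = 0" by simp
  also have "\<dots> \<longleftrightarrow> fst p = 0" by (simp add: u_def sum_nonneg_eq_0_iff vec_eq_iff)
  finally show ?thesis .
qed

text \<open>The gradient identity: \<open>axis i (x t $ i)\<close> is the fibre scaling field, and
  2n times it is the gradient of the height. The field has no projective component, so only the
  \<theta> term of the metric contributes.\<close>

lemma height_chart_deriv:
  fixes x :: "real \<Rightarrow> complex ^ 'n"
  assumes a: "a > 0" and x: "(x has_vector_derivative X) (at t)"
  shows "((\<lambda>s. height a (O_param i (x s))) has_real_derivative
     2 * real CARD('n) * ceh_explicit a i (x t) X (axis i (x t $ i))) (at t)"
proof -
  let ?n = "CARD('n)"
  define \<zeta> where "\<zeta> = unit_at i (x t)"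
  define M where "M s = (norm (x s $ i))\<^sup>2" for s
  define N where "N s = (norm (unit_at i (x s)))\<^sup>2" for s
  define q where "q s = a ^ ?n + M s * N s ^ ?n" for s
  define H where "H = Re (herm (tang_at i X) \<zeta>)"
  define C where "C = Re (X $ i * cnj (x t $ i))"
  have N0: "N t > 0" by (simp add: N_def unit_at_nonzero)
  have "M t \<ge> 0" by (simp add: M_def)
  then have q0: "q t > 0" unfolding q_def using a N0 by (intro add_pos_nonneg) auto
  have M': "(M has_real_derivative 2 * C) (at t)"
  proof -
    have "((\<lambda>s. Re (x s $ i * cnj (x s $ i))) has_real_derivative Re (x t $ i * cnj (X $ i) + X $ i * cnj (x t $ i))) (at t)"
      by (intro has_field_derivative_Re has_vector_derivative_mult has_vector_derivative_nth[OF x]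
          bounded_linear.has_vector_derivative[OF bounded_linear_cnj])
    moreover have "(\<lambda>s. Re (x s $ i * cnj (x s $ i))) = M"
      unfolding M_def by (metis Re_complex_of_real complex_norm_square)
    ultimately show ?thesis by (simp add: C_def algebra_simps)
  qed
  have "((\<lambda>s. unit_at i (x s)) has_vector_derivative tang_at i X) (at t)"
    unfolding unit_at_eq using bounded_linear.has_vector_derivative[OF bounded_linear_tang_at x]
    by (auto intro!: derivative_eq_intros)
  from has_real_derivative_norm_sq[OF this] have N': "(N has_real_derivative 2 * H) (at t)"
    unfolding N_def H_def \<zeta>_def .
  have q': "(q has_real_derivative M t * (real ?n * N t ^ (?n - Suc 0) * (2 * H)) + 2 * C * N t ^ ?n) (at t)"
    unfolding q_def[abs_def] by (auto intro!: derivative_eq_intros M' N')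
  have Nn: "N t ^ (?n - Suc 0) = N t ^ ?n / N t"
    using N0 by (simp add: power_diff)
  define S where "S = root ?n (q t)"
  have S: "S > 0" "S ^ ?n = q t" using q0 by (simp_all add: S_def)
  have Sn: "inverse (real ?n * S ^ (?n - Suc 0)) = S / (real ?n * q t)"
  proof -
    have "S ^ (?n - Suc 0) = q t / S" unfolding S(2)[symmetric] using S(1) by (simp add: power_diff)
    then show ?thesis using S(1) q0 by (simp add: field_simps)
  qed
  have h: "height a (O_param i (x s)) = root ?n (q s)" for s
    by (simp add: height_O_param q_def M_def N_def)
  have "((\<lambda>s. height a (O_param i (x s))) has_real_derivative
      S / (real ?n * q t) * (M t * (real ?n * N t ^ (?n - Suc 0) * (2 * H)) + 2 * C * N t ^ ?n)) (at t)"
    unfolding h Sn[symmetric] unfolding S_def by (rule DERIV_chain2[OF DERIV_real_root[OF _ q0] q']) simp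
  also have "S / (real ?n * q t) * (M t * (real ?n * N t ^ (?n - Suc 0) * (2 * H)) + 2 * C * N t ^ ?n)
      = 2 * real ?n * (S * (N t ^ ?n / q t * ((C / real ?n + M t * H / N t) / real ?n)))"
    unfolding Nn using q0 N0 by (simp add: field_simps)
  also have "S * (N t ^ ?n / q t * ((C / real ?n + M t * H / N t) / real ?n)) = ceh_explicit a i (x t) X (axis i (x t $ i))"
  proof -
    have t0: "tang_at i (axis i (x t $ i)) = 0" by (auto simp: tang_at_def axis_def vec_eq_iff)
    have "Re ((X $ i / of_nat ?n + x t $ i * herm (tang_at i X) \<zeta> / of_real (N t)) * cnj (x t $ i / of_nat ?n))
        = (C / real ?n + M t * H / N t) / real ?n"
    proof -
      have "(X $ i / of_nat ?n + x t $ i * herm (tang_at i X) \<zeta> / of_real (N t)) * cnj (x t $ i / of_nat ?n)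
         = (X $ i * cnj (x t $ i) / of_real (real ?n) + (x t $ i * cnj (x t $ i)) * herm (tang_at i X) \<zeta> / of_real (N t)) / of_real (real ?n)"
        by (simp add: add_divide_distrib algebra_simps)
      also have "x t $ i * cnj (x t $ i) = of_real (M t)" by (simp only: M_def complex_norm_square)
      finally show ?thesis
        by (simp only: Re_divide_of_real plus_complex.sel C_def H_def Re_complex_of_real) simp
    qed
    then show ?thesis
      unfolding ceh_explicit_def Let_def t0 \<zeta>_def[symmetric] N_def[symmetric]
      by (simp add: fubini_study_eq S_def q_def M_def N_def[of t, folded \<zeta>_def, symmetric] axis_def)
  qed
  finally show ?thesis .
qed

text \<open>For a geodesic \<open>x\<close> and a vector field \<open>V\<close> the derivative of
  \<open>g(x', V)\<close> is half the Lie derivative of \<open>g\<close> along \<open>V\<close>,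
  evaluated on \<open>x'\<close>. For the fibre scaling field this is the derivative found in
  \<open>height_second_variation\<close>.\<close>

lemma height_chart_deriv2:
  fixes x :: "real \<Rightarrow> complex ^ 'n"
  assumes a: "a > 0" and x: "(x has_vector_derivative vel x t) (at t)" "(vel x has_vector_derivative vel (vel x) t) (at t)"
    and geo: "\<And>v. ceh_explicit a i (x t) (vel (vel x) t) v + christoffel (ceh_explicit a i) (x t) (vel x t) (vel x t) v = 0"
  obtains D where "((\<lambda>s. ceh_explicit a i (x s) (vel x s) (axis i (x s $ i))) has_real_derivative D) (at t)"
    "D \<ge> 0" "D = 0 \<Longrightarrow> ceh_explicit a i (x t) (vel x t) (axis i (x t $ i)) = 0 \<and> (x t $ i = 0 \<or> vel x t = 0)"
proof -
  let ?n = "CARD('n)"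
  define X A V V' where "X = vel x t" and "A = vel (vel x) t" and "V = axis i (x t $ i)" and "V' = axis i (X $ i)"
  have lin: "bounded_linear (axis i :: complex \<Rightarrow> complex ^ 'n)"
  proof -
    have "linear (axis i :: complex \<Rightarrow> complex ^ 'n)" by (auto simp: linear_iff axis_def vec_eq_iff)
    then show ?thesis using linear_conv_bounded_linear by blast
  qed
  have c: "((\<lambda>s. c) has_vector_derivative 0) (at s)" for c :: "complex ^ 'n" and s :: real
    by (rule has_vector_derivative_const)
  have l: "((\<lambda>s. c + s *\<^sub>R d) has_vector_derivative d) (at 0)" for c d :: "complex ^ 'n"
    by (auto intro!: derivative_eq_intros)
  have z: "ceh_explicit a i y 0 v = 0" "ceh_explicit a i y v 0 = 0" for y v
    using ceh_explicit_linear(2)[of a i y 0 0 v] ceh_explicit_sym[of a i y v 0] by simp_all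
  obtain G where G: "\<And>y w v y' w' v' s. y s = x t \<Longrightarrow> w s = X \<Longrightarrow> v s = V \<Longrightarrow> (y has_vector_derivative y') (at s) \<Longrightarrow>
       (w has_vector_derivative w') (at s) \<Longrightarrow> (v has_vector_derivative v') (at s) \<Longrightarrow>
       ((\<lambda>s. ceh_explicit a i (y s) (w s) (v s)) has_real_derivative
          (G y' + ceh_explicit a i (x t) w' V + ceh_explicit a i (x t) X v')) (at s)"
    using ceh_explicit_curve[OF a] by blast
  obtain G2 where G2: "\<And>y w v y' w' v' s. y s = x t \<Longrightarrow> w s = X \<Longrightarrow> v s = X \<Longrightarrow> (y has_vector_derivative y') (at s) \<Longrightarrow>
       (w has_vector_derivative w') (at s) \<Longrightarrow> (v has_vector_derivative v') (at s) \<Longrightarrow>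
       ((\<lambda>s. ceh_explicit a i (y s) (w s) (v s)) has_real_derivative
          (G2 y' + ceh_explicit a i (x t) w' X + ceh_explicit a i (x t) X v')) (at s)"
    using ceh_explicit_curve[OF a] by blast
  have d1: "((\<lambda>s. ceh_explicit a i (x s) (vel x s) (axis i (x s $ i))) has_real_derivative
      (G X + ceh_explicit a i (x t) A V + ceh_explicit a i (x t) X V')) (at t)"
    by (rule G) (simp_all add: X_def A_def V_def V'_def x
        bounded_linear.has_vector_derivative[OF lin has_vector_derivative_nth[OF x(1)]])
  have "((\<lambda>s. ceh_explicit a i (x t + s *\<^sub>R X) X V) has_real_derivative G X + ceh_explicit a i (x t) 0 V + ceh_explicit a i (x t) X 0) (at 0)"
    by (rule G) (simp_all add: l)
  then have e1: "dir_deriv (\<lambda>y. ceh_explicit a i y X V) (x t) X = G X"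
    unfolding dir_deriv_def z by (simp add: DERIV_imp_deriv)
  have "((\<lambda>s. ceh_explicit a i (x t + s *\<^sub>R V) X X) has_real_derivative G2 V + ceh_explicit a i (x t) 0 X + ceh_explicit a i (x t) X 0) (at 0)"
    by (rule G2) (simp_all add: l)
  then have e2: "dir_deriv (\<lambda>y. ceh_explicit a i y X X) (x t) V = G2 V"
    unfolding dir_deriv_def z by (simp add: DERIV_imp_deriv)
  \<comment> \<open>In the equation tested on \<open>V\<close> the first two Christoffel terms
    coincide; they absorb \<open>G X\<close> and leave half the derivative of the metric along
    \<open>V\<close>.\<close>
  have e3: "G X + ceh_explicit a i (x t) A V = G2 V / 2"
    using geo[of V] unfolding christoffel_def X_def[symmetric] A_def[symmetric] e1 e2 by (simp add: field_simps)
  define N where "N = (norm (unit_at i (x t)))\<^sup>2"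
  define Q where "Q = (norm (x t $ i))\<^sup>2 * N ^ ?n"
  define f where "f = fubini_study (unit_at i (x t)) (tang_at i X) (tang_at i X)"
  define \<theta> where "\<theta> = X $ i / of_nat ?n + x t $ i * herm (tang_at i X) (unit_at i (x t)) / of_real N"
  have N0: "N > 0" by (simp add: N_def unit_at_nonzero)
  \<comment> \<open>Multiplying the fibre coordinate by \<open>1 + \<sigma>\<close> moves
    \<open>x\<close> by \<open>\<sigma> V\<close>, and its differential moves \<open>X\<close> by
    \<open>\<sigma> V'\<close>. The projective components are unchanged, and \<theta> is multiplied
    by \<open>1 + \<sigma>\<close>.\<close>
  have F: "ceh_explicit a i (x t + \<sigma> *\<^sub>R V) (X + \<sigma> *\<^sub>R V') (X + \<sigma> *\<^sub>R V')
     = root ?n (a ^ ?n + (1 + \<sigma>)\<^sup>2 * Q) * (f + (N ^ ?n * (norm \<theta>)\<^sup>2) * (1 + \<sigma>)\<^sup>2 / (a ^ ?n + (1 + \<sigma>)\<^sup>2 * Q))" for \<sigma>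
  proof -
    have 1: "unit_at i (x t + \<sigma> *\<^sub>R V) = unit_at i (x t)" "tang_at i (X + \<sigma> *\<^sub>R V') = tang_at i X"
      by (auto simp: unit_at_def tang_at_def V_def V'_def axis_def vec_eq_iff)
    have 2: "(x t + \<sigma> *\<^sub>R V) $ i = of_real (1 + \<sigma>) * x t $ i" "(X + \<sigma> *\<^sub>R V') $ i = of_real (1 + \<sigma>) * X $ i"
      by (simp_all add: V_def V'_def axis_def scaleR_conv_of_real[where 'a = complex] distrib_right)
    have 3: "of_real (1 + \<sigma>) * X $ i / of_nat ?n + of_real (1 + \<sigma>) * x t $ i * herm (tang_at i X) (unit_at i (x t)) / of_real N
       = of_real (1 + \<sigma>) * \<theta>"
      by (simp add: \<theta>_def distrib_left mult.assoc)
    have 4: "Re (z * cnj z) = (norm z)\<^sup>2" for z by (metis Re_complex_of_real complex_norm_square)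
    have 5: "(norm (of_real (1 + \<sigma>) * z))\<^sup>2 = (1 + \<sigma>)\<^sup>2 * (norm z)\<^sup>2" for z :: complex
      by (simp add: norm_mult power_mult_distrib del: of_real_add)
    show ?thesis
      unfolding ceh_explicit_def Let_def 1 2 N_def[symmetric] 3 4 5 f_def[symmetric]
      by (simp add: Q_def mult_ac)
  qed
  obtain D where D: "((\<lambda>\<sigma>. root ?n (a ^ ?n + (1 + \<sigma>)\<^sup>2 * Q) * (f + (N ^ ?n * (norm \<theta>)\<^sup>2) * (1 + \<sigma>)\<^sup>2 / (a ^ ?n + (1 + \<sigma>)\<^sup>2 * Q))) has_real_derivative D) (at 0)"
      "D \<ge> 0" "D = 0 \<Longrightarrow> Q * f = 0 \<and> N ^ ?n * (norm \<theta>)\<^sup>2 = 0"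
    by (rule height_second_variation[of ?n "a ^ ?n" Q f "N ^ ?n * (norm \<theta>)\<^sup>2"])
      (use a N0 in \<open>auto simp: Q_def f_def fubini_study_nonneg\<close>)
  have "((\<lambda>\<sigma>. ceh_explicit a i (x t + \<sigma> *\<^sub>R V) (X + \<sigma> *\<^sub>R V') (X + \<sigma> *\<^sub>R V')) has_real_derivative
     G2 V + ceh_explicit a i (x t) V' X + ceh_explicit a i (x t) X V') (at 0)"
    by (rule G2) (simp_all add: l)
  from DERIV_unique[OF this D(1)[folded F]]
  have "D = G2 V + 2 * ceh_explicit a i (x t) X V'" using ceh_explicit_sym[of a i "x t" V' X] by simp
  then have "((\<lambda>s. ceh_explicit a i (x s) (vel x s) (axis i (x s $ i))) has_real_derivative D / 2) (at t)"
    using d1 unfolding e3 by (simp add: add_divide_distrib)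
  \<comment> \<open>In the case of equality \<theta> vanishes, hence so does the pairing with
    \<open>V\<close>. Off the zero section the Fubini-Study part vanishes too, and both together
    determine \<open>X\<close>.\<close>
  moreover have "ceh_explicit a i (x t) X V = 0 \<and> (x t $ i = 0 \<or> X = 0)" if "D / 2 = 0"
  proof -
    have Qf: "Q * f = 0" and \<theta>0: "\<theta> = 0" using D(3) that N0 by auto
    have "tang_at i V = 0" by (auto simp: tang_at_def V_def axis_def vec_eq_iff)
    then have "ceh_explicit a i (x t) X V = 0"
      unfolding ceh_explicit_def Let_def N_def[symmetric] \<theta>_def[symmetric] \<theta>0 by (simp add: fubini_study_eq)
    moreover have "X = 0" if "x t $ i \<noteq> 0"
    proof -
      have "Q \<noteq> 0" using that N0 by (simp add: Q_def)
      then have "f = 0" using Qf by simp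
      then have "tang_at i X = 0"
        unfolding f_def by (intro fubini_study_definite[of "unit_at i (x t)" i]) auto
      moreover from this have "X $ i = 0" using \<theta>0 by (simp add: \<theta>_def)
      ultimately show ?thesis by (metis tang_at_id)
    qed
    ultimately show ?thesis by blast
  qed
  ultimately show ?thesis
    using that[of "D / 2"] D(2) unfolding X_def V_def by simp
qed

text \<open>The derivative \<open>h'\<close> is both nondecreasing and periodic, hence constant on a
  window of one period. Vanishing of the second derivative is the form in which the equality case
  can be applied.\<close>

lemma periodic_convex_deriv2_zero:
  fixes h h' :: "real \<Rightarrow> real"
  assumes T: "T > 0" "\<And>t. h (t + T) = h t" and h: "\<And>t. (h has_real_derivative h' t) (at t)"
    and h': "\<And>t. \<exists>D\<ge>0. (h' has_real_derivative D) (at t)"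
  shows "(h' has_real_derivative 0) (at t)"
proof -
  have per: "h' (t + T) = h' t" for t
  proof -
    have "((\<lambda>t. h (t + T)) has_real_derivative h' (t + T)) (at t)"
      using h[of "t + T"] unfolding DERIV_shift .
    then have "(h has_real_derivative h' (t + T)) (at t)" unfolding T(2) .
    from DERIV_unique[OF this h] show ?thesis .
  qed
  have mono: "h' s \<le> h' r" if "s \<le> r" for s r
    by (rule DERIV_nonneg_imp_nondecreasing[OF that]) (use h' in metis)
  \<comment> \<open>A window of length \<open>T\<close> centred at \<open>t\<close>; monotonicity
    traps \<open>h'\<close> between its two equal end values.\<close>
  have const: "h' (t - T / 2) = h' s" if "s \<in> {t - T / 2<..<t + T / 2}" for s
  proof (rule antisym)
    have "h' s \<le> h' (t - T / 2 + T)" using that by (intro mono) auto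
    then show "h' s \<le> h' (t - T / 2)" unfolding per .
    show "h' (t - T / 2) \<le> h' s" using that by (intro mono) auto
  qed
  have "t \<in> {t - T / 2<..<t + T / 2}" using T(1) by auto
  from has_field_derivative_transform_within_open[OF DERIV_const open_greaterThanLessThan this const]
  show ?thesis .
qed

theorem closed_geodesic_in_zero_section:
  fixes \<gamma> :: "real \<Rightarrow> (complex ^ 'n) \<times> (complex ^ 'n) set"
  assumes a: "a > 0" and \<gamma>: "closed_geodesic (O_CEH a) T \<gamma>" and nc: "nonconstant_on UNIV \<gamma>"
  shows "\<gamma> = zero_section \<circ> (snd \<circ> \<gamma>)"
proof -
  define h where "h t = height a (\<gamma> t)" for t
  have T: "T > 0" "\<And>t. h (t + T) = h t" and geo: "geodesic_on (O_CEH a) UNIV \<gamma>"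
    using \<gamma> by (auto simp: closed_geodesic_def h_def)
  have sm: "smooth_map (O_CEH a) UNIV \<gamma>" using geo by (simp add: geodesic_on_def)
  have loc: "\<exists>i x W. open W \<and> t \<in> W \<and> (\<forall>s\<in>W. \<gamma> s = O_param i (x s) \<and>
      (x has_vector_derivative vel x s) (at s) \<and> (vel x has_vector_derivative vel (vel x) s) (at s) \<and>
      (\<forall>v. ceh_explicit a i (x s) (vel (vel x) s) v + christoffel (ceh_explicit a i) (x s) (vel x s) (vel x s) v = 0))" for t
  proof -
    obtain i where "\<gamma> t \<in> cdom (O_CEH a) i" using smooth_map_chart_ex[OF sm UNIV_I] by blast
    with sm obtain W where W: "open W" "t \<in> W" "\<gamma> ` W \<subseteq> O_dom i" "smooth_on (O_chart i \<circ> \<gamma>) W"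
      by (elim smooth_mapE) auto
    define x where "x = O_chart i \<circ> \<gamma>"
    have c1: "ceh_explicit a i (x s) (vel (vel x) s) v + christoffel (ceh_explicit a i) (x s) (vel x s) (vel x s) v = 0"
      if "s \<in> W" for s v
    proof -
      have "\<gamma> s \<in> O_dom i" using W(3) that by blast
      then show ?thesis
        using geo unfolding geodesic_on_def O_CEH_simps metr_O_CEH[OF a] Let_def x_def by blast
    qed
    have c2: "\<gamma> s = O_param i (x s)" if "s \<in> W" for s
    proof -
      have "\<gamma> s \<in> O_dom i" using W(3) that by blast
      then show ?thesis by (simp add: x_def O_param_O_chart)
    qed
    note d = smooth_on_curveD[OF W(4), folded x_def]
    show ?thesis
      by (intro exI[of _ i] exI[of _ x] exI[of _ W] conjI ballI allI W(1,2) c1 c2 d)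
  qed
  \<comment> \<open>The charts vary with \<open>t\<close>, but \<open>h\<close> and
    \<open>deriv h\<close> do not depend on them, so the local statements combine into global
    convexity.\<close>
  have D2: "\<exists>i x W. open W \<and> t \<in> W \<and> (\<forall>s\<in>W. \<gamma> s = O_param i (x s) \<and> (x has_vector_derivative vel x s) (at s) \<and>
     (h has_real_derivative deriv h s) (at s) \<and> (\<exists>D\<ge>0. (deriv h has_real_derivative D) (at s) \<and>
     (D = 0 \<longrightarrow> deriv h s = 0 \<and> (x s $ i = 0 \<or> vel x s = 0))))" for t
  proof -
    obtain i x W where W: "open W" "t \<in> W" and x: "\<And>s. s \<in> W \<Longrightarrow> \<gamma> s = O_param i (x s)"
        "\<And>s. s \<in> W \<Longrightarrow> (x has_vector_derivative vel x s) (at s)"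
        "\<And>s. s \<in> W \<Longrightarrow> (vel x has_vector_derivative vel (vel x) s) (at s)"
        "\<And>s v. s \<in> W \<Longrightarrow> ceh_explicit a i (x s) (vel (vel x) s) v + christoffel (ceh_explicit a i) (x s) (vel x s) (vel x s) v = 0"
      using loc[of t] by blast
    define g where "g s = ceh_explicit a i (x s) (vel x s) (axis i (x s $ i))" for s
    have h: "(h has_real_derivative 2 * real CARD('n) * g s) (at s)" if "s \<in> W" for s
      by (rule has_field_derivative_transform_within_open[OF height_chart_deriv[OF a x(2)[OF that], of i, folded g_def] W(1) that])
        (simp add: h_def x(1))
    then have dh: "deriv h s = 2 * real CARD('n) * g s" if "s \<in> W" for s
      using that DERIV_imp_deriv by blast
    have D: "\<exists>D\<ge>0. (deriv h has_real_derivative D) (at s) \<and> (D = 0 \<longrightarrow> deriv h s = 0 \<and> (x s $ i = 0 \<or> vel x s = 0))"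
      if s: "s \<in> W" for s
    proof -
      obtain D where D: "(g has_real_derivative D) (at s)" "D \<ge> 0" "D = 0 \<Longrightarrow> g s = 0 \<and> (x s $ i = 0 \<or> vel x s = 0)"
        using height_chart_deriv2[OF a x(2,3)[OF s] x(4)[OF s]] unfolding g_def by blast
      have "(deriv h has_real_derivative 2 * real CARD('n) * D) (at s)"
        by (rule has_field_derivative_transform_within_open[OF DERIV_cmult[OF D(1)] W(1) s]) (simp add: dh)
      then show ?thesis
        using D(2,3) dh[OF s] by (intro exI[of _ "2 * real CARD('n) * D"]) auto
    qed
    have h': "(h has_real_derivative deriv h s) (at s)" if "s \<in> W" for s using h[OF that] dh[OF that] by simp
    show ?thesis
      by (rule exI[of _ i], rule exI[of _ x], rule exI[of _ W]) (intro conjI ballI W x(1,2) h' D)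
  qed
  have hd: "(h has_real_derivative deriv h t) (at t)" for t
    using D2[of t] by (elim exE conjE ballE[of _ _ t]) simp_all
  have "\<exists>D\<ge>0. (deriv h has_real_derivative D) (at t)" for t
    using D2[of t] by (elim exE conjE ballE[of _ _ t]) auto
  from periodic_convex_deriv2_zero[OF T hd this]
  have hd2: "(deriv h has_real_derivative 0) (at t)" for t .
  have key: "\<exists>i x W. open W \<and> t \<in> W \<and> (\<forall>s\<in>W. \<gamma> s = O_param i (x s) \<and> (x has_vector_derivative vel x s) (at s) \<and>
     deriv h s = 0 \<and> (x s $ i = 0 \<or> vel x s = 0))" for t
  proof -
    obtain i x W where *: "open W \<and> t \<in> W \<and> (\<forall>s\<in>W. \<gamma> s = O_param i (x s) \<and> (x has_vector_derivative vel x s) (at s) \<and>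
     (h has_real_derivative deriv h s) (at s) \<and> (\<exists>D\<ge>0. (deriv h has_real_derivative D) (at s) \<and>
     (D = 0 \<longrightarrow> deriv h s = 0 \<and> (x s $ i = 0 \<or> vel x s = 0))))"
      using D2[of t] by (elim exE) (rule that)
    then have W: "open W" "t \<in> W" by simp_all
    have x: "\<gamma> s = O_param i (x s) \<and> (x has_vector_derivative vel x s) (at s)" if "s \<in> W" for s
      using * that by simp
    have D: "\<exists>D. (deriv h has_real_derivative D) (at s) \<and> (D = 0 \<longrightarrow> deriv h s = 0 \<and> (x s $ i = 0 \<or> vel x s = 0))"
      if "s \<in> W" for s
      using bspec[OF conjunct2[OF conjunct2[OF *]] that] by blast
    have z: "deriv h s = 0" "x s $ i = 0 \<or> vel x s = 0" if s: "s \<in> W" for s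
    proof -
      obtain E where E: "(deriv h has_real_derivative E) (at s)" "E = 0 \<longrightarrow> deriv h s = 0 \<and> (x s $ i = 0 \<or> vel x s = 0)"
        using D[OF s] by blast
      have "E = 0" using DERIV_unique[OF E(1) hd2] .
      then show "deriv h s = 0" "x s $ i = 0 \<or> vel x s = 0" using E(2) by blast+
    qed
    show ?thesis
      by (rule exI[of _ i], rule exI[of _ x], rule exI[of _ W]) (intro conjI ballI W x[THEN conjunct1] x[THEN conjunct2] z)
  qed
  \<comment> \<open>The equality case already contains \<open>deriv h = 0\<close> at every
    time.\<close>
  have hc: "h t = h 0" for t
  proof -
    have "deriv h s = 0" for s using key[of s] by (elim exE conjE ballE[of _ _ s]) simp_all
    then show ?thesis using hd by (intro DERIV_isconst_all) metis
  qed
  show ?thesis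
  proof (cases "h 0 = a")
    case True
    then have "fst (\<gamma> t) = 0" for t using hc[of t] height_eq_iff[OF a, of "\<gamma> t"] by (simp add: h_def)
    then show ?thesis by (auto simp: fun_eq_iff zero_section_def prod_eq_iff)
  next
    case False
    then have nz: "fst (\<gamma> t) \<noteq> 0" for t using hc[of t] height_eq_iff[OF a, of "\<gamma> t"] by (simp add: h_def)
    \<comment> \<open>Constant height keeps the curve off the zero section at all times, so the
      equality case gives zero velocity in each chart and the curve is locally constant, contrary to
      assumption.\<close>
    have "\<gamma> r = \<gamma> t" for r t
    proof (rule connected_local_const[of UNIV r t \<gamma>])
      show "\<forall>t\<in>UNIV. eventually (\<lambda>s. \<gamma> t = \<gamma> s) (at t within UNIV)"
      proof
        fix t
        obtain i x W where *: "open W \<and> t \<in> W \<and> (\<forall>s\<in>W. \<gamma> s = O_param i (x s) \<and>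
            (x has_vector_derivative vel x s) (at s) \<and> deriv h s = 0 \<and> (x s $ i = 0 \<or> vel x s = 0))"
          using key[of t] by (elim exE) (rule that)
        then have W: "open W" "t \<in> W" by simp_all
        have x: "\<gamma> s = O_param i (x s)" "(x has_vector_derivative vel x s) (at s)" "x s $ i = 0 \<or> vel x s = 0"
          if "s \<in> W" for s using * that by simp_all
        have "x s $ i \<noteq> 0" if "s \<in> W" for s
          using nz[of s] x(1)[OF that] by (auto simp: O_param_def vec_eq_iff)
        then have d: "(x has_vector_derivative 0) (at s)" if "s \<in> W" for s
          using x(2,3)[OF that] that by metis
        obtain e where e: "e > 0" "ball t e \<subseteq> W" using W open_contains_ball by blast
        have "x s = x t" if "s \<in> ball t e" for s
        proof (rule has_derivative_zero_unique_connected[of "ball t e" x])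
          fix r assume "r \<in> ball t e"
          then show "(x has_derivative (\<lambda>x. 0)) (at r)"
            using d[of r] e(2) by (auto simp: has_vector_derivative_def)
        qed (use that e in auto)
        then have "\<gamma> t = \<gamma> s" if "s \<in> ball t e" for s using that x(1) e W(2) by (metis subsetD)
        then show "eventually (\<lambda>s. \<gamma> t = \<gamma> s) (at t within UNIV)"
          using e(1) unfolding eventually_at_topological by (intro exI[of _ "ball t e"]) auto
      qed
    qed auto
    then show ?thesis using nc unfolding nonconstant_on_def by blast
  qed
qed

theorem corollary10:
  fixes a :: real
  assumes "CARD('n::finite) \<ge> 2" and "a > 0"
  shows
    "(\<forall>T (\<gamma> :: real \<Rightarrow> (complex ^ 'n) \<times> (complex ^ 'n) set).
        closed_geodesic (O_CEH a) T \<gamma> \<and> nonconstant_on UNIV \<gamma> \<longrightarrow>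
        (\<exists>c. geodesic_on CP_FS UNIV c \<and> nonconstant_on UNIV c \<and> \<gamma> = zero_section \<circ> c)) \<and>
     (\<forall>I (c :: real \<Rightarrow> (complex ^ 'n) set).
        open I \<and> is_interval I \<and> geodesic_on CP_FS I c \<and> nonconstant_on I c \<longrightarrow>
        (\<exists>c'. geodesic_on CP_FS UNIV c' \<and> (\<forall>t\<in>I. c' t = c t))) \<and>
     (\<forall>c :: real \<Rightarrow> (complex ^ 'n) set.
        geodesic_on CP_FS UNIV c \<and> nonconstant_on UNIV c \<longrightarrow>
        (\<exists>T. closed_geodesic (O_CEH a) T (zero_section \<circ> c)) \<and>
        (\<forall>T. closed_geodesic (O_CEH a) T (zero_section \<circ> c) \<longrightarrow>
              \<not> stable_geodesic (O_CEH a) T (zero_section \<circ> c)))"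
proof (intro conjI allI impI)
  fix T and \<gamma> :: "real \<Rightarrow> (complex ^ 'n) \<times> (complex ^ 'n) set"
  assume \<gamma>: "closed_geodesic (O_CEH a) T \<gamma> \<and> nonconstant_on UNIV \<gamma>"
  then have e: "\<gamma> = zero_section \<circ> (snd \<circ> \<gamma>)"
    using closed_geodesic_in_zero_section[OF assms(2)] by blast
  have "geodesic_on (O_CEH a) UNIV \<gamma>" using \<gamma> by (simp add: closed_geodesic_def)
  then have "geodesic_on (O_CEH a) UNIV (zero_section \<circ> (snd \<circ> \<gamma>))"
    by (rule subst[OF e])
  then have "geodesic_on CP_FS UNIV (snd \<circ> \<gamma>)" using geodesic_zero_section_iff[OF assms(2)] by blast
  moreover have "nonconstant_on UNIV (snd \<circ> \<gamma>)"
  proof -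
    have g: "\<gamma> r = zero_section (snd (\<gamma> r))" for r
      using fun_cong[OF e, of r] unfolding o_apply .
    have "\<gamma> s = \<gamma> t" if "snd (\<gamma> s) = snd (\<gamma> t)" for s t
      by (subst g[of s], subst g[of t]) (simp only: that)
    then show ?thesis using \<gamma> unfolding nonconstant_on_def o_apply by blast
  qed
  ultimately show "\<exists>c. geodesic_on CP_FS UNIV c \<and> nonconstant_on UNIV c \<and> \<gamma> = zero_section \<circ> c"
    using e by blast
next
  fix I and c :: "real \<Rightarrow> (complex ^ 'n) set"
  assume c: "open I \<and> is_interval I \<and> geodesic_on CP_FS I c \<and> nonconstant_on I c"
  then have "I \<noteq> {}" by (auto simp: nonconstant_on_def)
  with c obtain p w where "p \<noteq> 0" "herm w p = 0" "\<And>t. t \<in> I \<Longrightarrow> c t = cline (hor_lift p w t)"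
    using geodesic_CP_FS_hor_lift[of I c] by blast
  \<comment> \<open>The circle found on \<open>I\<close> is defined for all real times and is itself
    the extension.\<close>
  then show "\<exists>c'. geodesic_on CP_FS UNIV c' \<and> (\<forall>t\<in>I. c' t = c t)"
    using geodesic_hor_lift[of p w] by (intro exI[of _ "\<lambda>t. cline (hor_lift p w t)"]) simp
next
  fix c :: "real \<Rightarrow> (complex ^ 'n) set"
  assume c: "geodesic_on CP_FS UNIV c \<and> nonconstant_on UNIV c"
  then obtain p w where p: "p \<noteq> 0" "herm w p = 0" and ct: "\<And>t. c t = cline (hor_lift p w t)"
    using geodesic_CP_FS_hor_lift[of UNIV c] by (metis UNIV_I UNIV_not_empty is_interval_univ open_UNIV)
  have "w \<noteq> 0" using c by (auto simp: nonconstant_on_def ct hor_lift_def)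
  define l where "l = norm w / norm p"
  have l: "l > 0" using p \<open>w \<noteq> 0\<close> by (simp add: l_def)
  have geo: "geodesic_on (O_CEH a) UNIV (zero_section \<circ> c)"
    using c geodesic_zero_section_iff[OF assms(2)] by blast
  \<comment> \<open>Half a turn of the lift already closes the projected curve, because it
    multiplies the lift by -1.\<close>
  have "c (t + pi / l) = c t" for t
  proof -
    have "sin (l * (pi / l)) = 0" "cos (l * (pi / l)) = - 1" using l by simp_all
    then have "hor_lift p w (t + pi / l) = (- 1) *\<^sub>R hor_lift p w t"
      using hor_lift_period(1)[OF p(1), of w "pi / l" t] unfolding l_def[symmetric] by simp
    then show ?thesis unfolding ct by (simp only: cline_scaleR)
  qed
  then show "\<exists>T. closed_geodesic (O_CEH a) T (zero_section \<circ> c)"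
    using geo l by (intro exI[of _ "pi / l"]) (simp add: closed_geodesic_def)
  fix T
  assume "closed_geodesic (O_CEH a) T (zero_section \<circ> c)"
  then have T: "T > 0" "\<And>t. c (t + T) = c t" by (auto simp: closed_geodesic_def zero_section_def)
  have "zero_section \<circ> c = (\<lambda>t. zero_section (cline (hor_lift p w t)))" by (simp add: fun_eq_iff ct)
  then show "\<not> stable_geodesic (O_CEH a) T (zero_section \<circ> c)"
    using not_stable_hor_lift[OF assms(2) p \<open>w \<noteq> 0\<close> T(1)] T(2) unfolding ct by simp
qed

end
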